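(* Let $\mathbb{G}$ be a homogeneous Lie group of homogeneous dimension $Q$, let $|\cdot|$ be an arbitrary homogeneous quasi-norm, and let $1<p<r<\infty$ and $p<q<(r-1)p'$, where $1/p+1/p'=1$. Let $a=Q/p$ and let $T^{(2)}_{a}$ be a function on $\mathbb G\setminus\{0\}$ such that, for some positive $C_{2}=C_{2}(a,Q)$, $$|T^{(2)}_{a}(x)|\le C_2|x|^{a-Q}\ \text{ for all } x\in\mathbb{G}\setminus\{0\},\qquad |T^{(2)}_{a}(x)|\le C_2|x|^{-Q}\ \text{ for all } x\in\mathbb{G}\text{ with }|x|\ge1 .$$ Then there exists a positive constant $C_{1}=C_{1}(p,q,r,Q)$ such that $$\left\|\frac{f\ast T^{(2)}_{Q/p}}{\left(\log\left(e+\frac{1}{|x|}\right)\right)^{r/q}|x|^{Q/q}}\right\|_{L^{q}(\mathbb{G})}\le C_{1}\|f\|_{L^{p}(\mathbb{G})}$$ holds for all $f\in L^{p}(\mathbb{G})$.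
   Context: A homogeneous group $\mathbb{G}$ is a connected simply connected Lie group whose Lie algebra $\mathfrak g$ is equipped with a family of dilations $D_\lambda=\mathrm{Exp}(A\ln\lambda)$, $\lambda>0$, where $A$ is a diagonalisable linear operator on $\mathfrak g$ with positive eigenvalues and each $D_\lambda$ is a Lie algebra morphism. Through the exponential map, $\mathbb G$ is identified with $\mathbb R^n$ (identity element $0$), the dilations act on $\mathbb G$ (written $x\mapsto\lambda x$), and Lebesgue measure $dx$ is a Haar measure. The homogeneous dimension is $Q=\mathrm{Tr}\,A$. A homogeneous quasi-norm is a continuous function $|\cdot|:\mathbb G\to[0,\infty)$ with $|x^{-1}|=|x|$, $|\lambda x|=\lambda|x|$ for $\lambda>0$, and $|x|=0$ iff $x=0$. Convolution: $(f\ast g)(x)=\int_{\mathbb G}f(y)g(y^{-1}x)\,dy$. All functions are measurable. The group, the quasi-norm and $C_2$ are fixed, and the constant $C_1$ is independent of $f$. *)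

theory Defs
  imports "HOL-Analysis.Analysis"
begin

section \<open>Homogeneous groups in exponential coordinates\<close>

text \<open>
  The group is R^n with neutral element 0; \<open>mul\<close> and \<open>ginv\<close> are the multiplication and the
  inversion.
\<close>

primrec C_k :: "nat \<Rightarrow> ('a::euclidean_space \<Rightarrow> 'b::real_normed_vector) \<Rightarrow> bool" where
  "C_k 0 f \<longleftrightarrow> continuous_on UNIV f"
| "C_k (Suc k) f \<longleftrightarrow>
     (\<exists>f'. (\<forall>x. (f has_derivative f' x) (at x)) \<and> (\<forall>v. C_k k (\<lambda>x. f' x v)))"

definition smooth :: "('a::euclidean_space \<Rightarrow> 'b::real_normed_vector) \<Rightarrow> bool" where
  "smooth f \<longleftrightarrow> (\<forall>k. C_k k f)"

text \<open>
  The last condition of the following locale says that the one-parameter subgroup with initial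
  velocity \<open>v\<close> is the straight line \<open>t v\<close>. The exponential map of the Lie group, from its Lie
  algebra R^n (the tangent space at 0) to the group, is therefore the identity map. Connectedness
  and simple connectedness hold because the underlying manifold is R^n.
\<close>

locale exp_lie_group = group mul "0 :: real ^ 'n" ginv
  for mul :: "real ^ 'n \<Rightarrow> real ^ 'n \<Rightarrow> real ^ 'n" and ginv :: "real ^ 'n \<Rightarrow> real ^ 'n" +
  assumes smooth_mul: "smooth (\<lambda>(x, y). mul x y)"
    and smooth_ginv: "smooth ginv"
    and exp_coordinates: "mul (s *\<^sub>R v) (t *\<^sub>R v) = (s + t) *\<^sub>R v"

text \<open>The left-invariant vector field with value \<open>v\<close> at 0.\<close>

definition left_invariant_field ::
    "(real ^ 'n \<Rightarrow> real ^ 'n \<Rightarrow> real ^ 'n) \<Rightarrow> real ^ 'n \<Rightarrow> real ^ 'n \<Rightarrow> real ^ 'n" where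
  "left_invariant_field mul v x = frechet_derivative (mul x) (at 0) v"

definition vf_bracket ::
    "(real ^ 'n \<Rightarrow> real ^ 'n) \<Rightarrow> (real ^ 'n \<Rightarrow> real ^ 'n) \<Rightarrow> real ^ 'n \<Rightarrow> real ^ 'n" where
  "vf_bracket X Y x =
     frechet_derivative Y (at x) (X x) - frechet_derivative X (at x) (Y x)"

definition lie_bracket ::
    "(real ^ 'n \<Rightarrow> real ^ 'n \<Rightarrow> real ^ 'n) \<Rightarrow> real ^ 'n \<Rightarrow> real ^ 'n \<Rightarrow> real ^ 'n" where
  "lie_bracket mul v w =
     vf_bracket (left_invariant_field mul v) (left_invariant_field mul w) 0"

definition lie_algebra_morphism ::
    "(real ^ 'n \<Rightarrow> real ^ 'n \<Rightarrow> real ^ 'n) \<Rightarrow> (real ^ 'n \<Rightarrow> real ^ 'n) \<Rightarrow> bool" where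
  "lie_algebra_morphism mul \<phi> \<longleftrightarrow>
     linear \<phi> \<and> (\<forall>v w. \<phi> (lie_bracket mul v w) = lie_bracket mul (\<phi> v) (\<phi> w))"

definition diagonalisable :: "(real ^ 'n \<Rightarrow> real ^ 'n) \<Rightarrow> bool" where
  "diagonalisable A \<longleftrightarrow>
     (\<exists>B. independent B \<and> span B = UNIV \<and> (\<forall>b\<in>B. \<exists>\<mu>. A b = \<mu> *\<^sub>R b))"

definition op_Exp :: "(real ^ 'n \<Rightarrow> real ^ 'n) \<Rightarrow> real ^ 'n \<Rightarrow> real ^ 'n" where
  "op_Exp B v = (\<Sum>k. (1 / fact k) *\<^sub>R (B ^^ k) v)"

definition dil :: "(real ^ 'n \<Rightarrow> real ^ 'n) \<Rightarrow> real \<Rightarrow> real ^ 'n \<Rightarrow> real ^ 'n" where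
  "dil A l = op_Exp (\<lambda>v. ln l *\<^sub>R A v)"

locale homogeneous_group = exp_lie_group mul ginv
  for mul :: "real ^ 'n \<Rightarrow> real ^ 'n \<Rightarrow> real ^ 'n" and ginv :: "real ^ 'n \<Rightarrow> real ^ 'n" +
  fixes A :: "real ^ 'n \<Rightarrow> real ^ 'n"
  assumes linear_A: "linear A"
    and diagonalisable_A: "diagonalisable A"
    and eigenvalues_pos: "v \<noteq> 0 \<Longrightarrow> A v = \<mu> *\<^sub>R v \<Longrightarrow> \<mu> > 0"
    and dil_morphism: "l > 0 \<Longrightarrow> lie_algebra_morphism mul (dil A l)"

definition hom_dim :: "(real ^ 'n \<Rightarrow> real ^ 'n) \<Rightarrow> real" where
  "hom_dim A = trace (matrix A)"

definition homogeneous_quasi_norm ::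
    "(real ^ 'n \<Rightarrow> real ^ 'n) \<Rightarrow> (real ^ 'n \<Rightarrow> real ^ 'n) \<Rightarrow> (real ^ 'n \<Rightarrow> real) \<Rightarrow> bool" where
  "homogeneous_quasi_norm ginv A N \<longleftrightarrow>
     continuous_on UNIV N \<and> (\<forall>x. N x \<ge> 0) \<and> (\<forall>x. N (ginv x) = N x) \<and>
     (\<forall>l>0. \<forall>x. N (dil A l x) = l * N x) \<and> (\<forall>x. N x = 0 \<longleftrightarrow> x = 0)"

section \<open>Lebesgue spaces and convolution\<close>

definition in_Lp :: "real \<Rightarrow> (real ^ 'n \<Rightarrow> complex) \<Rightarrow> bool" where
  "in_Lp p f \<longleftrightarrow>
     f \<in> borel_measurable lebesgue \<and> integrable lebesgue (\<lambda>x. norm (f x) powr p)"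

text \<open>
  Meaningful only together with \<^const>\<open>in_Lp\<close>: the Bochner integral of a non-integrable function
  is 0. The same caveat applies to \<open>conv\<close>, whence \<open>conv_exists\<close>.
\<close>

definition Lp_norm :: "real \<Rightarrow> (real ^ 'n \<Rightarrow> complex) \<Rightarrow> real" where
  "Lp_norm p f = (\<integral>x. norm (f x) powr p \<partial>lebesgue) powr (1 / p)"

definition conv_exists ::
    "(real ^ 'n \<Rightarrow> real ^ 'n \<Rightarrow> real ^ 'n) \<Rightarrow> (real ^ 'n \<Rightarrow> real ^ 'n) \<Rightarrow>
     (real ^ 'n \<Rightarrow> complex) \<Rightarrow> (real ^ 'n \<Rightarrow> complex) \<Rightarrow> real ^ 'n \<Rightarrow> bool" where
  "conv_exists mul ginv f g x \<longleftrightarrow> integrable lebesgue (\<lambda>y. f y * g (mul (ginv y) x))"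

definition conv ::
    "(real ^ 'n \<Rightarrow> real ^ 'n \<Rightarrow> real ^ 'n) \<Rightarrow> (real ^ 'n \<Rightarrow> real ^ 'n) \<Rightarrow>
     (real ^ 'n \<Rightarrow> complex) \<Rightarrow> (real ^ 'n \<Rightarrow> complex) \<Rightarrow> real ^ 'n \<Rightarrow> complex" where
  "conv mul ginv f g x = (\<integral>y. f y * g (mul (ginv y) x) \<partial>lebesgue)"

text \<open>
  Condition on a kernel on the group minus 0. The value \<open>T 0\<close> is unconstrained; it enters
  \<^term>\<open>conv mul ginv f T x\<close> only through the null set \<^prop>\<open>y = x\<close>.
\<close>

definition kernel_bounds ::
    "(real ^ 'n \<Rightarrow> real) \<Rightarrow> real \<Rightarrow> real \<Rightarrow> real \<Rightarrow> (real ^ 'n \<Rightarrow> complex) \<Rightarrow> bool" where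
  "kernel_bounds N Q a C T \<longleftrightarrow>
     T \<in> borel_measurable (lebesgue_on (- {0})) \<and>
     (\<forall>x. x \<noteq> 0 \<longrightarrow> norm (T x) \<le> C * N x powr (a - Q)) \<and>
     (\<forall>x. N x \<ge> 1 \<longrightarrow> norm (T x) \<le> C * N x powr (- Q))"

end

theory Submission
  imports Defs
begin

text \<open>
  A dilation is linear and respects the bracket. In exponential coordinates the differentials of the
  left translations satisfy, along lines through 0, a linear ODE in which only the bracket enters;
  so dilations commute with these differentials and hence with the multiplication. Consequently the
  Jacobian of a left translation is dilation invariant, which by letting the dilation parameter tend
  to 0 makes it equal to 1: Lebesgue measure is left invariant. As the quasi-norm has bounded balls,
  it satisfies a quasi-triangle inequality and its image measure has density \<open>c t\<^sup>Q\<^sup>-\<^sup>1\<close>.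

  The convolution with the kernel is split according to whether \<open>N (y\<^sup>-\<^sup>1x)\<close> is at most \<open>\<epsilon> N x\<close> or not,
  for a small \<open>\<epsilon>\<close>. Away from the diagonal, Hoelder's inequality bounds it pointwise by the norm of \<open>f\<close>
  times the \<open>L\<^sup>p\<^sup>'\<close> norm of the kernel outside a ball of radius \<open>\<epsilon> N x\<close>, which grows like a power \<open>1 / p'\<close>
  of the logarithm as \<open>x\<close> tends to 0 and decays polynomially at infinity; the weight is then integrable
  because \<open>r - q / p' > 1\<close>. Near the diagonal \<open>N x\<close> and \<open>N y\<close> are comparable, and the kernel multiplied
  by \<open>N x\<close> to the power \<open>- Q / q\<close> is uniformly in \<open>L\<^sup>s\<close> in each variable for \<open>1 / s = 1 / q + 1 / p'\<close>, so
  that the Schur test applies without any help from the logarithm.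
\<close>

section \<open>Lie algebra morphisms in exponential coordinates\<close>

text \<open>For \<open>a = Q / p\<close> the kernel has exponent \<open>a - Q = - Q / p'\<close>.
  Its \<open>p'\<close>-th power is \<open>N\<close> to the power \<open>- Q\<close>, which fails to
  be integrable at 0 by exactly one logarithm, so Hoelder's inequality is usable only once a
  neighbourhood of the diagonal has been cut out. Cutting at a fixed multiple of \<open>N x\<close>
  leaves the shells between \<open>\<epsilon> * N x\<close> and 1, and these produce the logarithm.
  In the part cut out, \<open>1 / s = 1 / q + 1 / p'\<close> forces \<open>s < p'\<close>; so the
  kernel to the power \<open>s\<close> is locally integrable, and the factor
  \<open>N x powr (- (Q / q))\<close> makes its integral independent of the scale. The choice
  \<open>\<epsilon> = 1 / (2 * \<kappa>)\<close>, with \<kappa> the quasi-triangle constant, allows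
  \<open>N x \<le> \<kappa> * (N y + \<epsilon> * N x)\<close> to be solved for \<open>N x\<close>.
  All estimates are made for a radial majorant \<open>k0\<close> of the kernel; the final constant
  is therefore uniform in the kernel and depends linearly on \<open>C\<^sub>2\<close>.\<close>

text \<open>The second difference of \<open>f\<close> over the parallelogram with sides
  \<open>h u\<close> and \<open>h v\<close> is symmetric in \<open>u\<close> and \<open>v\<close>.
  Two applications of the mean value theorem, in either order, evaluate it as \<open>h * h\<close>
  times a mixed derivative at a point close to \<open>x\<close>. Only the two mixed entries have to
  be continuous.\<close>

lemma symmetric_second_derivative_real:
  fixes f :: "'a::real_normed_vector \<Rightarrow> real"
  assumes f: "\<And>z. (f has_derivative f' z) (at z)"
    and fu: "\<And>z. ((\<lambda>z. f' z u) has_derivative fu z) (at z)"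
    and fv: "\<And>z. ((\<lambda>z. f' z v) has_derivative fv z) (at z)"
    and cu: "continuous (at x) (\<lambda>z. fu z v)" and cv: "continuous (at x) (\<lambda>z. fv z u)"
  shows "fu x v = fv x u"
proof -
  define \<Delta> where "\<Delta> h = f (x + h *\<^sub>R u + h *\<^sub>R v) - f (x + h *\<^sub>R u) - f (x + h *\<^sub>R v) + f x" for h
  have mvt: "\<exists>\<xi> \<eta>. 0 < \<xi> \<and> \<xi> < h \<and> 0 < \<eta> \<and> \<eta> < h \<and> 
      f (x + h *\<^sub>R u + h *\<^sub>R v) - f (x + h *\<^sub>R u) - f (x + h *\<^sub>R v) + f x = h * h * g (x + \<xi> *\<^sub>R u + \<eta> *\<^sub>R v) v"
    if "h > 0" and g: "\<And>z. ((\<lambda>z. f' z u) has_derivative g z) (at z)" for h u v g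
  proof -
    have d1: "((\<lambda>t. f (x + t *\<^sub>R u + h *\<^sub>R v) - f (x + t *\<^sub>R u)) has_real_derivative 
        (f' (x + t *\<^sub>R u + h *\<^sub>R v) u - f' (x + t *\<^sub>R u) u)) (at t)" for t
      unfolding has_field_derivative_def
      apply (rule derivative_eq_intros has_derivative_compose[OF _ f] | simp)+
      apply (simp add: fun_eq_iff linear_scale[OF has_derivative_linear[OF f]] algebra_simps)
      done
    have "\<exists>\<xi>>0. \<xi> < h \<and> (f (x + h *\<^sub>R u + h *\<^sub>R v) - f (x + h *\<^sub>R u)) - (f (x + 0 *\<^sub>R u + h *\<^sub>R v) - f (x + 0 *\<^sub>R u))
       = (h - 0) * (f' (x + \<xi> *\<^sub>R u + h *\<^sub>R v) u - f' (x + \<xi> *\<^sub>R u) u)"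
      by (rule MVT2[OF that(1), where f = "\<lambda>t. f (x + t *\<^sub>R u + h *\<^sub>R v) - f (x + t *\<^sub>R u)"]) (rule d1)
    then obtain \<xi> where \<xi>: "0 < \<xi>" "\<xi> < h" "(f (x + h *\<^sub>R u + h *\<^sub>R v) - f (x + h *\<^sub>R u)) - (f (x + 0 *\<^sub>R u + h *\<^sub>R v) - f (x + 0 *\<^sub>R u))
       = (h - 0) * (f' (x + \<xi> *\<^sub>R u + h *\<^sub>R v) u - f' (x + \<xi> *\<^sub>R u) u)"
      by blast
    have "((\<lambda>t. x + \<xi> *\<^sub>R u + t *\<^sub>R v) has_derivative (\<lambda>h. h *\<^sub>R v)) (at t)" for t
      by (auto intro!: derivative_eq_intros)
    from has_derivative_compose[OF this g]
    have d2: "((\<lambda>t. f' (x + \<xi> *\<^sub>R u + t *\<^sub>R v) u) has_real_derivative g (x + \<xi> *\<^sub>R u + t *\<^sub>R v) v) (at t)" for t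
      unfolding has_field_derivative_def
      by (rule has_derivative_eq_rhs) (simp add: fun_eq_iff linear_scale[OF has_derivative_linear[OF g]])
    have "\<exists>\<eta>>0. \<eta> < h \<and> f' (x + \<xi> *\<^sub>R u + h *\<^sub>R v) u - f' (x + \<xi> *\<^sub>R u + 0 *\<^sub>R v) u 
       = (h - 0) * g (x + \<xi> *\<^sub>R u + \<eta> *\<^sub>R v) v"
      by (rule MVT2[OF that(1), where f = "\<lambda>t. f' (x + \<xi> *\<^sub>R u + t *\<^sub>R v) u"]) (rule d2)
    then obtain \<eta> where \<eta>: "0 < \<eta>" "\<eta> < h" "f' (x + \<xi> *\<^sub>R u + h *\<^sub>R v) u - f' (x + \<xi> *\<^sub>R u + 0 *\<^sub>R v) u 
       = (h - 0) * g (x + \<xi> *\<^sub>R u + \<eta> *\<^sub>R v) v"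
      by blast
    show ?thesis
      by (rule exI[of _ \<xi>], rule exI[of _ \<eta>]) (use \<xi> \<eta> in \<open>simp add: algebra_simps\<close>)
  qed
  \<comment> \<open>Here \<open>u\<close> and \<open>v\<close> are bound afresh, so that one fact
    serves both orders of differentiation; its last premise is the symmetry of
    \<open>\<Delta>\<close>.\<close>
  have lim: "((\<lambda>n. \<Delta> (1 / real (Suc n)) * (real (Suc n))\<^sup>2) \<longlongrightarrow> g x v) sequentially"
    if g: "\<And>z. ((\<lambda>z. f' z u) has_derivative g z) (at z)" and c: "continuous (at x) (\<lambda>z. g z v)"
     and \<Delta>: "\<And>h. \<Delta> h = f (x + h *\<^sub>R u + h *\<^sub>R v) - f (x + h *\<^sub>R u) - f (x + h *\<^sub>R v) + f x"
     for g u v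
  proof -
    have "\<forall>n. \<exists>\<xi> \<eta>. 0 < \<xi> \<and> \<xi> < 1 / real (Suc n) \<and> 0 < \<eta> \<and> \<eta> < 1 / real (Suc n) \<and> 
       \<Delta> (1 / real (Suc n)) = 1 / real (Suc n) * (1 / real (Suc n)) * g (x + \<xi> *\<^sub>R u + \<eta> *\<^sub>R v) v"
      unfolding \<Delta> by (rule allI, rule mvt[OF _ g]) auto
    then obtain \<xi> \<eta> where *: "\<And>n. 0 < \<xi> n \<and> \<xi> n < 1 / real (Suc n) \<and> 0 < \<eta> n \<and> \<eta> n < 1 / real (Suc n) \<and> 
       \<Delta> (1 / real (Suc n)) = 1 / real (Suc n) * (1 / real (Suc n)) * g (x + \<xi> n *\<^sub>R u + \<eta> n *\<^sub>R v) v"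
      by metis
    have z: "(\<lambda>n. 1 / real (Suc n)) \<longlonglongrightarrow> 0"
      using LIMSEQ_inverse_real_of_nat by (simp add: inverse_eq_divide)
    have x0: "\<xi> \<longlonglongrightarrow> 0" "\<eta> \<longlonglongrightarrow> 0"
      by (rule real_tendsto_sandwich[OF _ _ tendsto_const z]; use * in \<open>force intro!: always_eventually simp: less_imp_le\<close>)+
    have "(\<lambda>n. x + \<xi> n *\<^sub>R u + \<eta> n *\<^sub>R v) \<longlonglongrightarrow> x + 0 *\<^sub>R u + 0 *\<^sub>R v"
      by (intro tendsto_intros x0)
    then have l: "(\<lambda>n. x + \<xi> n *\<^sub>R u + \<eta> n *\<^sub>R v) \<longlonglongrightarrow> x" by simp
    have "(\<lambda>n. g (x + \<xi> n *\<^sub>R u + \<eta> n *\<^sub>R v) v) \<longlonglongrightarrow> g x v"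
      using isCont_tendsto_compose[OF c l] .
    moreover have "(\<lambda>n. g (x + \<xi> n *\<^sub>R u + \<eta> n *\<^sub>R v) v) = (\<lambda>n. \<Delta> (1 / real (Suc n)) * (real (Suc n))\<^sup>2)"
      using * by (simp add: fun_eq_iff power2_eq_square del: of_nat_Suc)
    ultimately show ?thesis by simp
  qed
  have "((\<lambda>n. \<Delta> (1 / real (Suc n)) * (real (Suc n))\<^sup>2) \<longlongrightarrow> fu x v) sequentially"
    by (rule lim[OF fu cu]) (simp add: \<Delta>_def)
  moreover have "((\<lambda>n. \<Delta> (1 / real (Suc n)) * (real (Suc n))\<^sup>2) \<longlongrightarrow> fv x u) sequentially"
    by (rule lim[OF fv cv]) (simp add: \<Delta>_def algebra_simps)
  ultimately show ?thesis using LIMSEQ_unique by blast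
qed

lemma symmetric_second_derivative:
  fixes f :: "'a::real_normed_vector \<Rightarrow> 'b::euclidean_space"
  assumes f: "\<And>z. (f has_derivative f' z) (at z)"
    and fu: "\<And>z. ((\<lambda>z. f' z u) has_derivative fu z) (at z)"
    and fv: "\<And>z. ((\<lambda>z. f' z v) has_derivative fv z) (at z)"
    and cu: "continuous (at x) (\<lambda>z. fu z v)" and cv: "continuous (at x) (\<lambda>z. fv z u)"
  shows "fu x v = fv x u"
proof (rule euclidean_eqI)
  fix b :: 'b
  show "fu x v \<bullet> b = fv x u \<bullet> b"
    by (rule symmetric_second_derivative_real[where f = "\<lambda>z. f z \<bullet> b" and f' = "\<lambda>z h. f' z h \<bullet> b"
       and fu = "\<lambda>z h. fu z h \<bullet> b" and fv = "\<lambda>z h. fv z h \<bullet> b"])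
      (intro has_derivative_inner_left f fu fv continuous_intros cu cv)+
qed

text \<open>The predicate \<open>C_k\<close> yields derivatives of \<open>\<lambda>y. F y h\<close>
  for each fixed \<open>h\<close> separately. Their linear dependence on \<open>h\<close> is
  recovered from uniqueness of derivatives.\<close>

lemma linear_parameter_derivative:
  assumes "\<And>y. linear (F y)" and "\<And>h. ((\<lambda>y. F y h) has_derivative F' h) (at z)"
  shows "linear (\<lambda>h. F' h k)"
proof
  fix a b
  have "((\<lambda>y. F y (a + b)) has_derivative (\<lambda>k. F' a k + F' b k)) (at z)"
    using has_derivative_add[OF assms(2)[of a] assms(2)[of b]] by (simp add: linear_add[OF assms(1)])
  then have "F' (a + b) = (\<lambda>k. F' a k + F' b k)" using has_derivative_unique assms(2) by blast
  then show "F' (a + b) k = F' a k + F' b k" by simp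
next
  fix r b
  have "((\<lambda>y. F y (r *\<^sub>R b)) has_derivative (\<lambda>k. r *\<^sub>R F' b k)) (at z)"
    using has_derivative_scaleR_right[OF assms(2)[of b]] by (simp add: linear_scale[OF assms(1)])
  then have "F' (r *\<^sub>R b) = (\<lambda>k. r *\<^sub>R F' b k)" using has_derivative_unique assms(2) by blast
  then show "F' (r *\<^sub>R b) k = r *\<^sub>R F' b k" by simp
qed

text \<open>A product rule for a matrix-valued map known to be differentiable only entry by entry:
  expanding the argument in the finite basis turns it into a finite sum of products.\<close>

lemma has_derivative_apply_linear:
  fixes F :: "'a::real_normed_vector \<Rightarrow> 'b::euclidean_space \<Rightarrow> 'c::real_normed_vector"
  assumes lin: "\<And>y. linear (F y)" and F: "\<And>h. ((\<lambda>y. F y h) has_derivative F' h) (at z)"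
    and g: "(g has_derivative g') (at z)"
  shows "((\<lambda>y. F y (g y)) has_derivative (\<lambda>k. F' (g z) k + F z (g' k))) (at z)"
proof -
  have expand: "L w = (\<Sum>b\<in>Basis. (w \<bullet> b) *\<^sub>R L b)" if "linear L" for L :: "'b \<Rightarrow> 'c" and w
  proof -
    have "L w = L (\<Sum>b\<in>Basis. (w \<bullet> b) *\<^sub>R b)" by (simp only: euclidean_representation)
    also have "\<dots> = (\<Sum>b\<in>Basis. (w \<bullet> b) *\<^sub>R L b)" by (simp add: linear_sum[OF that] linear_scale[OF that])
    finally show ?thesis .
  qed
  note F'lin = linear_parameter_derivative[OF lin F]
  have "((\<lambda>y. \<Sum>b\<in>Basis. (g y \<bullet> b) *\<^sub>R F y b) has_derivative 
      (\<lambda>k. \<Sum>b\<in>Basis. (g z \<bullet> b) *\<^sub>R F' b k + (g' k \<bullet> b) *\<^sub>R F z b)) (at z)"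
    by (intro has_derivative_sum has_derivative_scaleR F has_derivative_inner_left g)
  moreover have "(\<lambda>y. F y (g y)) = (\<lambda>y. \<Sum>b\<in>Basis. (g y \<bullet> b) *\<^sub>R F y b)"
    by (rule ext, rule expand[OF lin])
  moreover have "F' (g z) k + F z (g' k) = (\<Sum>b\<in>Basis. (g z \<bullet> b) *\<^sub>R F' b k + (g' k \<bullet> b) *\<^sub>R F z b)" for k
    by (subst expand[OF F'lin], subst expand[OF lin]) (simp add: sum.distrib)
  ultimately show ?thesis by presburger
qed

text \<open>Gronwall's argument: with \<open>K\<close> a bound for \<open>L\<close>, the function
  \<open>E\<close> (the squared norm of \<open>Z s\<close>, damped by
  \<open>exp (- (2 * K * s))\<close>) does not increase, and it starts at 0.\<close>

lemma linear_ode_zero: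
  fixes Z :: "real \<Rightarrow> 'a::euclidean_space"
  assumes L: "linear L" and Z: "\<And>t. (Z has_vector_derivative L (Z t)) (at t)" and "Z 0 = 0" "t \<ge> 0"
  shows "Z t = 0"
proof -
  obtain K where K: "\<And>x. norm (L x) \<le> K * norm x" and "K > 0"
    using linear_bounded_pos[OF L] by (auto simp: mult.commute)
  define E where "E s = exp (- (2 * K * s)) * (Z s \<bullet> Z s)" for s
  have E: "(E has_real_derivative exp (- (2 * K * s)) * (2 * (Z s \<bullet> L (Z s)) - 2 * K * (Z s \<bullet> Z s))) (at s)" for s
  proof -
    have "(Z has_derivative (\<lambda>h. h *\<^sub>R L (Z s))) (at s)" using Z by (simp add: has_vector_derivative_def)
    from has_derivative_inner[OF this this]
    have "((\<lambda>s. Z s \<bullet> Z s) has_real_derivative 2 * (Z s \<bullet> L (Z s))) (at s)"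
      unfolding has_field_derivative_def by (rule has_derivative_eq_rhs) (simp add: fun_eq_iff inner_commute)
    then show ?thesis unfolding E_def
      by (auto intro!: derivative_eq_intros simp: algebra_simps)
  qed
  have "E t \<le> E 0"
  proof (rule DERIV_nonpos_imp_nonincreasing[OF \<open>t \<ge> 0\<close>])
    fix s
    have "Z s \<bullet> L (Z s) \<le> norm (Z s) * norm (L (Z s))" by (rule norm_cauchy_schwarz)
    also have "\<dots> \<le> norm (Z s) * (K * norm (Z s))" by (intro mult_left_mono K) auto
    also have "\<dots> = K * (Z s \<bullet> Z s)" by (simp add: dot_square_norm power2_eq_square)
    finally have "exp (- (2 * K * s)) * (2 * (Z s \<bullet> L (Z s)) - 2 * K * (Z s \<bullet> Z s)) \<le> 0"
      by (simp add: mult_nonneg_nonpos)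
    then show "\<exists>y. (E has_real_derivative y) (at s) \<and> y \<le> 0" using E by blast
  qed
  then have "exp (- (2 * K * t)) * (Z t \<bullet> Z t) \<le> 0" using \<open>Z 0 = 0\<close> by (simp add: E_def)
  then have "Z t \<bullet> Z t \<le> 0" by (simp add: mult_le_0_iff)
  then show ?thesis by (metis inner_ge_zero inner_eq_zero_iff order_antisym)
qed

context exp_lie_group
begin

lemma mul_zero_left [simp]: "mul 0 x = x" and mul_zero_right [simp]: "mul x 0 = x"
  by (simp_all)

lemma ginv_eq_uminus: "ginv x = - x"
proof -
  have "mul x (- x) = 0" using exp_coordinates[of 1 x "-1"] by simp
  then show ?thesis by (metis inverse_unique)
qed

lemma mul_uminus_cancel [simp]: "mul (- x) (mul x y) = y" "mul x (mul (- x) y) = y"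
  by (metis ginv_eq_uminus left_inverse assoc mul_zero_left minus_minus)+

end

section \<open>Left-invariant fields and the Maurer-Cartan equation\<close>

text \<open>Fixes a choice of the first two derivatives of the multiplication. In
  \<open>d2 h z k\<close> the direction \<open>h\<close> of the first differentiation is a
  parameter, as in \<open>C_k\<close>, and \<open>k\<close> is the direction of the second
  one.\<close>

locale lie_group_derivs = exp_lie_group mul ginv
  for mul :: "real ^ 'n \<Rightarrow> real ^ 'n \<Rightarrow> real ^ 'n" and ginv +
  fixes d :: "(real ^ 'n) \<times> (real ^ 'n) \<Rightarrow> (real ^ 'n) \<times> (real ^ 'n) \<Rightarrow> real ^ 'n"
    and d2 :: "(real ^ 'n) \<times> (real ^ 'n) \<Rightarrow> (real ^ 'n) \<times> (real ^ 'n) \<Rightarrow> (real ^ 'n) \<times> (real ^ 'n) \<Rightarrow> real ^ 'n"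
  assumes mul_deriv: "((\<lambda>(x, y). mul x y) has_derivative d z) (at z)"
    and d_deriv: "((\<lambda>z. d z h) has_derivative d2 h z) (at z)"
    and d2_cont: "continuous_on UNIV (\<lambda>z. d2 h z k)"
begin

lemma d_linear: "linear (d z)"
  using mul_deriv has_derivative_linear by blast

lemma d_right_linear: "linear (\<lambda>v. d z (0, v))"
  using linear_compose[OF _ d_linear, of "\<lambda>v. (0, v)"] by (simp add: o_def linear_iff)

lemma mul_has_derivative:
  assumes "(f has_derivative f') (at z)" "(g has_derivative g') (at z)"
  shows "((\<lambda>z. mul (f z) (g z)) has_derivative (\<lambda>h. d (f z, g z) (f' h, g' h))) (at z)"
  using has_derivative_compose[OF has_derivative_Pair[OF assms] mul_deriv] by simp

lemma d_has_derivative: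
  assumes "(f has_derivative f') (at z)" "(g has_derivative g') (at z)"
  shows "((\<lambda>z. d (f z, g z) h) has_derivative (\<lambda>k. d2 h (f z, g z) (f' k, g' k))) (at z)"
  using has_derivative_compose[OF has_derivative_Pair[OF assms] d_deriv] by simp

text \<open>\<open>M x\<close> is the differential at 0 of the left translation by \<open>x\<close>, so that \<open>\<lambda>x. M x v\<close> is the
  left-invariant field with value \<open>v\<close> at 0; \<open>W x\<close> is the inverse of \<open>M x\<close>, \<open>DM x u\<close> is the derivative
  of \<open>M\<close> at \<open>x\<close> in direction \<open>u\<close>, and \<open>br\<close> is the Lie bracket.\<close>

definition M :: "real ^ 'n \<Rightarrow> real ^ 'n \<Rightarrow> real ^ 'n" where "M x v = d (x, 0) (0, v)"
definition W :: "real ^ 'n \<Rightarrow> real ^ 'n \<Rightarrow> real ^ 'n" where "W x v = d (- x, x) (0, v)"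
definition DM :: "real ^ 'n \<Rightarrow> real ^ 'n \<Rightarrow> real ^ 'n \<Rightarrow> real ^ 'n" where "DM x u v = d2 (0, v) (x, 0) (u, 0)"
definition br :: "real ^ 'n \<Rightarrow> real ^ 'n \<Rightarrow> real ^ 'n" where "br v w = DM 0 v w - DM 0 w v"

lemma M_linear: "linear (M x)" and W_linear: "linear (W x)"
  unfolding M_def[abs_def] W_def[abs_def] by (rule d_right_linear)+

lemma mul_right_deriv: "(mul x has_derivative (\<lambda>v. d (x, y) (0, v))) (at y)"
  using mul_has_derivative[OF has_derivative_const has_derivative_ident] by simp

lemma M_deriv: "((\<lambda>x. M x v) has_derivative (\<lambda>u. DM x u v)) (at x)"
  unfolding M_def DM_def using d_has_derivative[OF has_derivative_ident has_derivative_const] by simp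

lemma DM_linear_left: "linear (\<lambda>u. DM x u v)"
  using M_deriv has_derivative_linear by blast

lemma DM_linear_right: "linear (DM x u)"
  using linear_parameter_derivative[OF M_linear M_deriv, of x u] by simp

lemma M_zero [simp]: "M 0 v = v"
proof -
  have "((\<lambda>y. mul 0 y) has_derivative (\<lambda>v. M 0 v)) (at 0)"
    unfolding M_def by (rule mul_right_deriv)
  moreover have "((\<lambda>y. mul 0 y) has_derivative (\<lambda>v. v)) (at 0)" by simp
  ultimately have "(\<lambda>v. M 0 v) = (\<lambda>v. v)" by (rule has_derivative_unique)
  then show ?thesis by (rule fun_cong)
qed

lemma M_W [simp]: "M x (W x v) = v"
proof -
  have "((\<lambda>y. mul x (mul (- x) y)) has_derivative (\<lambda>v. d (x, mul (- x) x) (0, d (- x, x) (0, v)))) (at x)"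
    by (rule mul_has_derivative[OF has_derivative_const mul_right_deriv])
  moreover have "mul (- x) x = 0" using mul_uminus_cancel(1)[of x 0] by simp
  ultimately have "((\<lambda>y. y) has_derivative (\<lambda>v. M x (W x v))) (at x)" by (simp add: M_def W_def)
  then have "(\<lambda>v. M x (W x v)) = (\<lambda>v. v)" using has_derivative_unique has_derivative_ident by blast
  then show ?thesis by metis
qed

lemma W_M [simp]: "W x (M x v) = v"
proof -
  have "((\<lambda>y. mul (- x) (mul x y)) has_derivative (\<lambda>v. d (- x, mul x 0) (0, d (x, 0) (0, v)))) (at 0)"
    by (rule mul_has_derivative[OF has_derivative_const mul_right_deriv])
  then have "((\<lambda>y. y) has_derivative (\<lambda>v. W x (M x v))) (at 0)" by (simp add: M_def W_def)
  then have "(\<lambda>v. W x (M x v)) = (\<lambda>v. v)" using has_derivative_unique has_derivative_ident by blast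
  then show ?thesis by metis
qed

text \<open>Associativity differentiated at 0 in the last factor. This is the left invariance of the
  fields \<open>\<lambda>x. M x w\<close>.\<close>

lemma M_mul: "M (mul a y) w = d (a, y) (0, M y w)"
proof -
  have "((\<lambda>z. mul a (mul y z)) has_derivative (\<lambda>v. d (a, mul y 0) (0, d (y, 0) (0, v)))) (at 0)"
    by (rule mul_has_derivative[OF has_derivative_const mul_right_deriv])
  moreover have "((\<lambda>z. mul (mul a y) z) has_derivative (\<lambda>v. d (mul a y, 0) (0, v))) (at 0)"
    by (rule mul_right_deriv)
  ultimately have "(\<lambda>v. d (mul a y, 0) (0, v)) = (\<lambda>v. d (a, mul y 0) (0, d (y, 0) (0, v)))"
    unfolding assoc by (metis has_derivative_unique)
  then have "(\<lambda>v. d (mul a y, 0) (0, v)) = (\<lambda>v. d (a, y) (0, d (y, 0) (0, v)))" by simp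
  then show ?thesis unfolding M_def by metis
qed

text \<open>In exponential coordinates \<open>t \<mapsto> y (t y) = (1 + t) y\<close> is a straight
  line with velocity \<open>y\<close>: on its own ray, the left-invariant field of \<open>y\<close>
  is constant.\<close>

lemma M_self [simp]: "M y y = y"
proof -
  have t: "((\<lambda>t. t *\<^sub>R y) has_derivative (\<lambda>h. h *\<^sub>R y)) (at 0)" for y :: "real ^ 'n"
    by (auto intro!: derivative_eq_intros)
  have "((\<lambda>t. mul y (t *\<^sub>R y)) has_derivative (\<lambda>h. d (y, 0 *\<^sub>R y) (0, h *\<^sub>R y))) (at 0)"
    by (rule mul_has_derivative[OF has_derivative_const t])
  moreover have "mul y (t *\<^sub>R y) = (1 + t) *\<^sub>R y" for t using exp_coordinates[of 1 y t] by simp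
  ultimately have "((\<lambda>t. (1 + t) *\<^sub>R y) has_derivative (\<lambda>h. M y (h *\<^sub>R y))) (at 0)"
    by (simp add: M_def)
  moreover have "((\<lambda>t. (1 + t) *\<^sub>R y) has_derivative (\<lambda>h. h *\<^sub>R y)) (at 0)"
    by (auto intro!: derivative_eq_intros)
  ultimately have "(\<lambda>h. M y (h *\<^sub>R y)) = (\<lambda>h. h *\<^sub>R y)" using has_derivative_unique by blast
  then show ?thesis by (metis scaleR_one)
qed

lemma M_scaleR_self [simp]: "M (t *\<^sub>R y) y = y"
proof (cases "t = 0")
  case False
  have "t *\<^sub>R M (t *\<^sub>R y) y = t *\<^sub>R y" unfolding linear_scale[OF M_linear, symmetric] by (rule M_self)
  with False show ?thesis by (metis scaleR_cancel_left)
qed simp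

text \<open>Differentiating \<open>M_mul\<close> in \<open>y\<close> at 0 expresses
  \<open>DM a (M a v) w\<close> through \<open>M a (DM 0 v w)\<close> and a second derivative of the
  multiplication in its right factor. The latter is symmetric in \<open>v\<close> and
  \<open>w\<close> and cancels on antisymmetrising.\<close>

lemma maurer_cartan: "DM a (M a v) w - DM a (M a w) v = M a (br v w)"
proof -
  have *: "DM a (M a v) w = d2 (0, w) (a, 0) (0, v) + M a (DM 0 v w)" for v w
  proof -
    have lhs: "((\<lambda>y. M (mul a y) w) has_derivative (\<lambda>v. DM (mul a 0) (M a v) w)) (at 0)"
      using has_derivative_compose[OF mul_right_deriv[of a 0] M_deriv[of w "mul a 0"]]
      by (simp add: M_def[of a])
    have dd: "((\<lambda>y. d (a, y) (0, h)) has_derivative (\<lambda>k. d2 (0, h) (a, 0) (0, k))) (at 0)" for h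
      by (rule d_has_derivative[OF has_derivative_const has_derivative_ident])
    have "((\<lambda>y. d (a, y) (0, M y w)) has_derivative 
          (\<lambda>v. d2 (0, M 0 w) (a, 0) (0, v) + d (a, 0) (0, DM 0 v w))) (at 0)"
      by (rule has_derivative_apply_linear[where F = "\<lambda>y h. d (a, y) (0, h)", OF d_right_linear dd M_deriv])
    then have "((\<lambda>y. M (mul a y) w) has_derivative (\<lambda>v. d2 (0, w) (a, 0) (0, v) + M a (DM 0 v w))) (at 0)"
      by (simp add: M_mul) (simp add: M_def)
    from has_derivative_unique[OF lhs this] show ?thesis by (simp add: fun_eq_iff)
  qed
  have "d2 (0, w) (a, 0) (0, v) = d2 (0, v) (a, 0) (0, w)"
    by (rule symmetric_second_derivative[where f = "\<lambda>(x, y). mul x y" and f' = d])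
      (use d2_cont in \<open>auto intro: mul_deriv d_deriv simp: continuous_on_eq_continuous_at\<close>)
  then show ?thesis by (simp add: * br_def linear_diff[OF M_linear])
qed

lemma DM_self: "DM y u y + M y u = u"
proof -
  have "((\<lambda>y. M y y) has_derivative (\<lambda>u. DM y u y + M y u)) (at y)"
    by (rule has_derivative_apply_linear[OF M_linear M_deriv has_derivative_ident])
  then have "((\<lambda>y. y) has_derivative (\<lambda>u. DM y u y + M y u)) (at y)" by simp
  then have "(\<lambda>u. DM y u y + M y u) = (\<lambda>u. u)" using has_derivative_unique has_derivative_ident by blast
  then show ?thesis by metis
qed

lemma br_linear_right: "linear (br v)"
  unfolding br_def[abs_def] by (intro linear_compose_sub DM_linear_right DM_linear_left)

text \<open>The variation \<open>t v\<close> of the ray \<open>t x\<close>, read in the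
  left-invariant frame. Differentiating \<open>M (t x) (Y t) = t v\<close> along the ray and
  \<open>M y y = y\<close> in direction \<open>t v\<close> gives two formulas for \<open>v\<close>;
  since \<open>M (t x) x = x\<close>, their difference is a case of \<open>maurer_cartan\<close>.
  The factor \<open>t\<close> in front of \<open>v\<close> keeps the equation regular at
  \<open>t = 0\<close>.\<close>

lemma W_ode: "((\<lambda>t. W (t *\<^sub>R x) (t *\<^sub>R v)) has_vector_derivative 
     (v - br x (W (t *\<^sub>R x) (t *\<^sub>R v)))) (at t)"
proof -
  have l: "((\<lambda>t. t *\<^sub>R y) has_derivative (\<lambda>h. h *\<^sub>R y)) (at t)" for y :: "real ^ 'n"
    by (auto intro!: derivative_eq_intros)
  have dd: "((\<lambda>t. W (t *\<^sub>R x) h) has_derivative (\<lambda>k. d2 (0, h) (- (t *\<^sub>R x), t *\<^sub>R x) (- (k *\<^sub>R x), k *\<^sub>R x))) (at t)" for h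
    unfolding W_def by (rule d_has_derivative[OF has_derivative_minus[OF l] l])
  define Y where "Y t = W (t *\<^sub>R x) (t *\<^sub>R v)" for t
  obtain Y' where Y': "(Y has_derivative Y') (at t)"
    unfolding Y_def[abs_def] using has_derivative_apply_linear[OF W_linear dd l] by blast
  have MY: "M (t *\<^sub>R x) (Y t) = t *\<^sub>R v" for t by (simp add: Y_def)
  have "((\<lambda>t. M (t *\<^sub>R x) (Y t)) has_derivative (\<lambda>k. DM (t *\<^sub>R x) (k *\<^sub>R x) (Y t) + M (t *\<^sub>R x) (Y' k))) (at t)"
    by (rule has_derivative_apply_linear[OF M_linear has_derivative_compose[OF l M_deriv] Y'])
  moreover have "((\<lambda>t. M (t *\<^sub>R x) (Y t)) has_derivative (\<lambda>k. k *\<^sub>R v)) (at t)"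
    unfolding MY by (rule l)
  ultimately have "(\<lambda>k. DM (t *\<^sub>R x) (k *\<^sub>R x) (Y t) + M (t *\<^sub>R x) (Y' k)) = (\<lambda>k. k *\<^sub>R v)"
    using has_derivative_unique by blast
  then have 1: "DM (t *\<^sub>R x) x (Y t) + M (t *\<^sub>R x) (Y' 1) = v"
    by (drule_tac fun_cong[of _ _ 1]) simp
  have "t *\<^sub>R (t *\<^sub>R DM (t *\<^sub>R x) v x + M (t *\<^sub>R x) v) = t *\<^sub>R v"
    using DM_self[of "t *\<^sub>R x" "t *\<^sub>R v"]
    by (simp add: linear_scale[OF M_linear] linear_scale[OF DM_linear_right] linear_scale[OF DM_linear_left] algebra_simps)
  \<comment> \<open>At \<open>t = 0\<close>, where \<open>t\<close> cannot be cancelled, the claim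
    is \<open>M 0 v = v\<close>.\<close>
  then have 2: "t *\<^sub>R DM (t *\<^sub>R x) v x + M (t *\<^sub>R x) v = v" by (cases "t = 0") auto
  have 3: "DM (t *\<^sub>R x) x (Y t) - t *\<^sub>R DM (t *\<^sub>R x) v x = M (t *\<^sub>R x) (br x (Y t))"
    using maurer_cartan[of "t *\<^sub>R x" x "Y t"] by (simp add: MY linear_scale[OF DM_linear_left])
  have "M (t *\<^sub>R x) (Y' 1) = M (t *\<^sub>R x) (v - br x (Y t))"
  proof -
    have "M (t *\<^sub>R x) (Y' 1) = v - DM (t *\<^sub>R x) x (Y t)" using 1 by (simp add: eq_diff_eq add.commute)
    moreover have "M (t *\<^sub>R x) v = v - t *\<^sub>R DM (t *\<^sub>R x) v x" using 2 by (simp add: eq_diff_eq add.commute)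
    ultimately show ?thesis by (simp add: linear_diff[OF M_linear] flip: 3)
  qed
  then have "W (t *\<^sub>R x) (M (t *\<^sub>R x) (Y' 1)) = W (t *\<^sub>R x) (M (t *\<^sub>R x) (v - br x (Y t)))" by (rule arg_cong)
  then have "Y' 1 = v - br x (Y t)" by (simp only: W_M)
  moreover have "Y' k = k *\<^sub>R Y' 1" for k
    using linear_scale[OF has_derivative_linear[OF Y'], of k 1] by simp
  ultimately have "Y' k = k *\<^sub>R (v - br x (Y t))" for k by metis
  then have "Y' = (\<lambda>k. k *\<^sub>R (v - br x (Y t)))" by (rule ext)
  then show ?thesis using Y' by (simp add: has_vector_derivative_def Y_def[abs_def])
qed

text \<open>Along \<open>t \<mapsto> t x\<close> the inverse of the left translation differential solves a linear ODE that only
  involves the bracket, so it is transported by Lie algebra morphisms.\<close>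

lemma M_morphism:
  assumes \<phi>: "linear \<phi>" and br: "\<And>v w. \<phi> (br v w) = br (\<phi> v) (\<phi> w)"
  shows "\<phi> (M x w) = M (\<phi> x) (\<phi> w)"
proof -
  have W: "\<phi> (W x v) = W (\<phi> x) (\<phi> v)" for v
  proof -
    define Z where "Z t = W (t *\<^sub>R \<phi> x) (t *\<^sub>R \<phi> v) - \<phi> (W (t *\<^sub>R x) (t *\<^sub>R v))" for t
    have "Z 1 = 0"
    proof (rule linear_ode_zero[where L = "\<lambda>z. - br (\<phi> x) z"])
      show "linear (\<lambda>z. - br (\<phi> x) z)" by (intro linear_compose_neg br_linear_right)
      show "Z 0 = 0" by (simp add: Z_def linear_0[OF W_linear] linear_0[OF \<phi>])
      fix t
      have "bounded_linear \<phi>" using \<phi> by (rule linear_conv_bounded_linear[THEN iffD1])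
      from bounded_linear.has_vector_derivative[OF this W_ode[of x v t]]
      have "((\<lambda>t. \<phi> (W (t *\<^sub>R x) (t *\<^sub>R v))) has_vector_derivative \<phi> (v - br x (W (t *\<^sub>R x) (t *\<^sub>R v)))) (at t)" .
      from has_vector_derivative_diff[OF W_ode[of "\<phi> x" "\<phi> v" t] this]
      show "(Z has_vector_derivative - br (\<phi> x) (Z t)) (at t)"
        unfolding Z_def by (simp add: linear_diff[OF \<phi>] linear_diff[OF br_linear_right] br)
    qed simp
    then show ?thesis by (simp add: Z_def)
  qed
  have "M (\<phi> x) (\<phi> w) = M (\<phi> x) (\<phi> (W x (M x w)))" by simp
  also have "\<dots> = \<phi> (M x w)" by (simp only: W M_W)
  finally show ?thesis by simp
qed

text \<open>Both \<open>\<phi> (x (t y))\<close> and \<open>\<phi> x (t \<phi> y)\<close> are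
  integral curves of the left-invariant field of \<open>\<phi> y\<close> starting at
  \<open>\<phi> x\<close>. Instead of quoting uniqueness, the first curve is multiplied on the right
  by \<open>- (t w)\<close>, the inverse of the one-parameter subgroup, and the product
  \<open>k\<close> is shown to be constant.\<close>

lemma mul_morphism:
  assumes \<phi>: "linear \<phi>" and br: "\<And>v w. \<phi> (br v w) = br (\<phi> v) (\<phi> w)"
  shows "\<phi> (mul x y) = mul (\<phi> x) (\<phi> y)"
proof -
  have l: "((\<lambda>t. t *\<^sub>R y) has_derivative (\<lambda>h. h *\<^sub>R y)) (at t)" for t and y :: "real ^ 'n"
    by (auto intro!: derivative_eq_intros)
  define c where "c t = \<phi> (mul x (t *\<^sub>R y))" for t
  define w where "w = \<phi> y"
  have c: "(c has_derivative (\<lambda>h. h *\<^sub>R M (c t) w)) (at t)" for t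
  proof -
    have "bounded_linear \<phi>" using \<phi> by (rule linear_conv_bounded_linear[THEN iffD1])
    from bounded_linear.has_derivative[OF this has_derivative_compose[OF l mul_right_deriv]]
    have "(c has_derivative (\<lambda>h. \<phi> (d (x, t *\<^sub>R y) (0, h *\<^sub>R y)))) (at t)" unfolding c_def .
    moreover have "\<phi> (d (x, t *\<^sub>R y) (0, h *\<^sub>R y)) = h *\<^sub>R M (c t) w" for h
      using M_mul[of x "t *\<^sub>R y" y] M_morphism[OF assms, of "mul x (t *\<^sub>R y)" y]
      by (simp add: linear_scale[OF d_right_linear] c_def w_def linear_scale[OF \<phi>])
    ultimately show ?thesis by simp
  qed
  \<comment> \<open>Obtained from \<open>a (s w) (- t w) = a ((s - t) w)\<close> by differentiation
    at \<open>s = 0\<close>: moving the left factor along the field of \<open>w\<close> has the same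
    effect as moving the right factor along \<open>w\<close>. The two contributions to the
    derivative of \<open>k\<close> therefore cancel.\<close>
  have right: "d (a, - (t *\<^sub>R w)) (h *\<^sub>R M a w, 0) = d (a, - (t *\<^sub>R w)) (0, h *\<^sub>R w)" for a t h
  proof -
    have 1: "((\<lambda>s. mul (mul a (s *\<^sub>R w)) (- (t *\<^sub>R w))) has_derivative 
        (\<lambda>h. d (mul a (0 *\<^sub>R w), - (t *\<^sub>R w)) (d (a, 0 *\<^sub>R w) (0, h *\<^sub>R w), 0))) (at 0)"
      by (intro mul_has_derivative has_derivative_const l)
    have 2: "((\<lambda>s. mul a (s *\<^sub>R w - t *\<^sub>R w)) has_derivative 
        (\<lambda>h. d (a, 0 *\<^sub>R w - t *\<^sub>R w) (0, h *\<^sub>R w - 0))) (at 0)"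
      by (intro mul_has_derivative has_derivative_const l has_derivative_diff)
    have 3: "mul (mul a (s *\<^sub>R w)) (- (t *\<^sub>R w)) = mul a (s *\<^sub>R w - t *\<^sub>R w)" for s
      using exp_coordinates[of s w "- t"] by (simp add: assoc scaleR_diff_left)
    have "(\<lambda>h. d (mul a (0 *\<^sub>R w), - (t *\<^sub>R w)) (d (a, 0 *\<^sub>R w) (0, h *\<^sub>R w), 0))
        = (\<lambda>h. d (a, 0 *\<^sub>R w - t *\<^sub>R w) (0, h *\<^sub>R w - 0))"
      using has_derivative_unique[OF 1[unfolded 3] 2] .
    then have "d (a, - (t *\<^sub>R w)) (M a (h *\<^sub>R w), 0) = d (a, - (t *\<^sub>R w)) (0, h *\<^sub>R w)"
      by (drule_tac fun_cong[of _ _ h]) (simp add: M_def)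
    then show ?thesis by (simp only: linear_scale[OF M_linear])
  qed
  define k where "k t = mul (c t) (- (t *\<^sub>R w))" for t
  have k: "(k has_derivative (\<lambda>h. 0)) (at t)" for t
  proof -
    have "(k has_derivative (\<lambda>h. d (c t, - (t *\<^sub>R w)) (h *\<^sub>R M (c t) w, - (h *\<^sub>R w)))) (at t)"
      unfolding k_def by (intro mul_has_derivative c has_derivative_minus l)
    moreover have "d (c t, - (t *\<^sub>R w)) (h *\<^sub>R M (c t) w, - (h *\<^sub>R w)) = 0" for h
    proof -
      have "d (c t, - (t *\<^sub>R w)) ((h *\<^sub>R M (c t) w, 0) - (0, h *\<^sub>R w)) = 0"
        by (simp only: linear_diff[OF d_linear] right) simp
      then show ?thesis by simp
    qed
    ultimately show ?thesis by simp
  qed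
  have "\<exists>c. \<forall>t\<in>UNIV. k t = c"
    by (rule has_derivative_zero_constant) (use k in auto)
  then have "k 1 = k 0" by auto
  then have "mul (\<phi> (mul x y)) (- \<phi> y) = \<phi> x" by (simp add: k_def c_def w_def)
  then have "mul (mul (\<phi> (mul x y)) (- \<phi> y)) (\<phi> y) = mul (\<phi> x) (\<phi> y)" by simp
  moreover have "mul (- \<phi> y) (\<phi> y) = 0" using mul_uminus_cancel(1)[of "\<phi> y" 0] by simp
  ultimately show ?thesis by (simp add: assoc)
qed

lemma left_invariant_field_eq: "left_invariant_field mul v x = M x v"
  using frechet_derivative_at[OF mul_right_deriv[of x 0]] by (simp add: left_invariant_field_def M_def fun_eq_iff)

lemma lie_bracket_eq: "lie_bracket mul v w = br v w"
  using frechet_derivative_at[OF M_deriv[of _ 0]]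
  by (simp add: lie_bracket_def vf_bracket_def left_invariant_field_eq[abs_def] br_def fun_eq_iff)

end

context exp_lie_group
begin

lemma obtain_derivs: obtains d d2 where "lie_group_derivs mul ginv d d2"
proof -
  have "C_k (Suc (Suc 0)) (\<lambda>(x, y). mul x y)" using smooth_mul by (simp add: smooth_def)
  then obtain d where d: "\<And>z. ((\<lambda>(x, y). mul x y) has_derivative d z) (at z)" 
    and "\<And>h. C_k (Suc 0) (\<lambda>z. d z h)" by auto
  then have "\<forall>h. \<exists>f'. (\<forall>z. ((\<lambda>z. d z h) has_derivative f' z) (at z)) \<and> (\<forall>v. continuous_on UNIV (\<lambda>z. f' z v))" by simp
  then obtain d2 where "\<forall>h. (\<forall>z. ((\<lambda>z. d z h) has_derivative d2 h z) (at z)) \<and> (\<forall>v. continuous_on UNIV (\<lambda>z. d2 h z v))"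
    by metis
  with d have "lie_group_derivs mul ginv d d2" by unfold_locales blast+
  then show thesis by (rule that)
qed

lemma lie_algebra_morphism_imp_mul_morphism:
  assumes "lie_algebra_morphism mul \<phi>"
  shows "\<phi> (mul x y) = mul (\<phi> x) (\<phi> y)"
proof -
  obtain d d2 where "lie_group_derivs mul ginv d d2" by (rule obtain_derivs)
  then interpret lie_group_derivs mul ginv d d2 .
  show ?thesis using assms by (intro mul_morphism) (auto simp: lie_algebra_morphism_def lie_bracket_eq)
qed

end

section \<open>Maps with constant Jacobian\<close>

text \<open>The change of variables theorems of the library require an index type of class
  \<^class>\<open>wellorder\<close>. The type \<open>'a idx\<close> is a well-ordered copy of an arbitrary finite type.\<close>

typedef ('a::finite) idx = "{..<CARD('a)}"
  by (auto intro: exI[of _ 0])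

instantiation idx :: (finite) linorder
begin

definition less_eq_idx :: "'a idx \<Rightarrow> 'a idx \<Rightarrow> bool" where "x \<le> y \<longleftrightarrow> Rep_idx x \<le> Rep_idx y"
definition less_idx :: "'a idx \<Rightarrow> 'a idx \<Rightarrow> bool" where "x < y \<longleftrightarrow> Rep_idx x < Rep_idx y"

instance
  by standard (auto simp: less_eq_idx_def less_idx_def Rep_idx_inject)

end

instance idx :: (finite) wellorder
proof
  fix P :: "'a idx \<Rightarrow> bool" and a
  assume step: "\<And>x. (\<And>y. y < x \<Longrightarrow> P y) \<Longrightarrow> P x"
  show "P a"
    by (induction a rule: measure_induct_rule[of Rep_idx]) (auto intro: step simp: less_idx_def)
qed

lemma bij_Rep_idx: "bij_betw Rep_idx (UNIV :: 'a::finite idx set) {..<CARD('a)}"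
proof (rule bij_betwI[where g = Abs_idx])
  show "Rep_idx \<in> (UNIV :: 'a idx set) \<rightarrow> {..<CARD('a)}" using Rep_idx by blast
qed (simp_all add: Rep_idx_inverse Abs_idx_inverse)

instance idx :: (finite) finite
  by standard (use bij_Rep_idx bij_betw_finite in blast)

lemma ex_bij_idx: "\<exists>e :: 'a::finite idx \<Rightarrow> 'a. bij e"
proof -
  have "card (UNIV :: 'a idx set) = CARD('a)"
    using bij_betw_same_card[OF bij_Rep_idx] by simp
  then show ?thesis using finite_same_card_bij[of "UNIV :: 'a idx set" "UNIV :: 'a set"] by auto
qed

text \<open>Conjugation by \<open>e\<close> is a sign-preserving bijection between the permutations
  of the two index types.\<close>

lemma det_reindex:
  fixes A :: "real ^ 'n ^ 'n" and e :: "'m::finite \<Rightarrow> 'n"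
  assumes "bij e"
  shows "det (\<chi> i j. A $ e i $ e j) = det A"
proof -
  let ?m = "map_permutation UNIV e"
  have e: "bij_betw e UNIV UNIV" "inj e" using assms by (auto simp: bij_def)
  have perm: "?m p permutes UNIV" if "p permutes UNIV" for p
    using map_permutation_permutes[OF e(1) that] .
  have sgn: "sign (?m p) = sign p" if "p permutes UNIV" for p
    using sign_map_permutation[OF _ that] e by auto
  have app: "?m p (e i) = e (p i)" for p i
    using map_permutation_apply[of e UNIV i p] e by simp
  have "bij_betw ?m {p. p permutes UNIV} {p. p permutes UNIV}"
  proof (rule bij_betw_byWitness[where f' = "map_permutation UNIV (inv e)"])
    have ei: "bij_betw (inv e) UNIV UNIV" using e(1) by (rule bij_imp_bij_inv)
    show "\<forall>p\<in>{p. p permutes UNIV}. map_permutation UNIV (inv e) (?m p) = p"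
      using e by (auto intro!: map_permutation_compose_inv)
    show "\<forall>p\<in>{p. p permutes UNIV}. ?m (map_permutation UNIV (inv e) p) = p"
      using ei assms by (auto intro!: map_permutation_compose_inv simp: bij_is_surj surj_f_inv_f)
    show "?m ` {p. p permutes UNIV} \<subseteq> {p. p permutes UNIV}" using perm by auto
    show "map_permutation UNIV (inv e) ` {p. p permutes UNIV} \<subseteq> {p. p permutes UNIV}"
      using map_permutation_permutes[OF ei] by auto
  qed
  from sum.reindex_bij_betw[OF this, of "\<lambda>p. of_int (sign p) * (\<Prod>i\<in>UNIV. A $ i $ p i)"]
  have "det A = (\<Sum>p | p permutes UNIV. of_int (sign (?m p)) * (\<Prod>i\<in>UNIV. A $ i $ ?m p i))"
    by (simp add: det_def)
  also have "\<dots> = (\<Sum>p | p permutes UNIV. of_int (sign p) * (\<Prod>i\<in>UNIV. A $ e i $ e (p i)))"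
  proof (rule sum.cong[OF refl])
    fix p :: "'m \<Rightarrow> 'm" assume "p \<in> {p. p permutes UNIV}"
    then show "of_int (sign (?m p)) * (\<Prod>i\<in>UNIV. A $ i $ ?m p i) = of_int (sign p) * (\<Prod>i\<in>UNIV. A $ e i $ e (p i))"
      using prod.reindex_bij_betw[OF e(1), of "\<lambda>i. A $ i $ ?m p i"] by (simp add: sgn app)
  qed
  finally show ?thesis by (simp add: det_def)
qed

text \<open>Relabelling of coordinates, by which the change of variables formula is carried from a
  well-ordered index type to an arbitrary finite one.\<close>

definition reindex :: "('m \<Rightarrow> 'n) \<Rightarrow> real ^ 'n \<Rightarrow> real ^ 'm" where
  "reindex e x = (\<chi> i. x $ e i)"

lemma linear_reindex: "linear (reindex e :: real ^ 'n \<Rightarrow> real ^ 'm)"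
  by (simp add: reindex_def linear_iff vec_eq_iff)

lemma reindex_inv: 
  assumes "bij e"
  shows "reindex (inv e) (reindex e x) = x" "reindex e (reindex (inv e) y) = y"
  using assms by (auto simp: reindex_def vec_eq_iff bij_is_surj surj_f_inv_f bij_is_inj inv_f_f)

lemma det_matrix_reindex:
  fixes e :: "'m::finite \<Rightarrow> 'n::finite"
  assumes "bij e" "linear f"
  shows "det (matrix (\<lambda>x. reindex e (f (reindex (inv e) x)))) = det (matrix f)"
proof -
  have "reindex (inv e) (axis j 1) = axis (e j) 1" for j
    using bij_inv_eq_iff[OF assms(1)] by (auto simp: reindex_def vec_eq_iff axis_def bij_is_inj[OF assms(1)])
  then have "matrix (\<lambda>x. reindex e (f (reindex (inv e) x))) = (\<chi> i j. matrix f $ e i $ e j)"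
    by (simp add: matrix_def vec_eq_iff reindex_def)
  then show ?thesis using det_reindex[OF assms(1)] by metis
qed

lemma emeasure_lborel_box_cart:
  fixes l u :: "real ^ 'n"
  assumes "\<And>i. l $ i \<le> u $ i"
  shows "emeasure lborel (box l u) = ennreal (\<Prod>i\<in>UNIV. u $ i - l $ i)"
proof -
  have B: "(Basis :: (real ^ 'n) set) = range (\<lambda>i. axis i 1)" by (auto simp: Basis_vec_def)
  have inj: "inj (\<lambda>i::'n. axis i (1::real))" by (auto simp: inj_on_def axis_eq_axis)
  have "emeasure lborel (box l u) = ennreal (\<Prod>b\<in>Basis. (u - l) \<bullet> b)"
    by (rule emeasure_lborel_box) (use assms in \<open>auto simp: B inner_axis\<close>)
  also have "(\<Prod>b\<in>Basis. (u - l) \<bullet> b) = (\<Prod>i\<in>UNIV. u $ i - l $ i)"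
    unfolding B by (simp add: prod.reindex[OF inj] inner_axis o_def)
  finally show ?thesis .
qed

lemma borel_reindex [measurable]: "reindex e \<in> borel_measurable borel"
  by (intro borel_measurable_continuous_onI linear_continuous_on linear_conv_bounded_linear[THEN iffD1] linear_reindex)

lemma lborel_reindex:
  fixes e :: "'m::finite \<Rightarrow> 'n::finite"
  assumes "bij e"
  shows "distr lborel borel (reindex e) = lborel"
proof (rule lborel_eqI[symmetric])
  fix l u :: "real ^ 'm" assume le: "\<And>b. b \<in> Basis \<Longrightarrow> l \<bullet> b \<le> u \<bullet> b"
  have B: "(Basis :: (real ^ 'm) set) = range (\<lambda>i. axis i 1)" by (auto simp: Basis_vec_def)
  have lu: "l $ i \<le> u $ i" for i using le[of "axis i 1"] by (simp add: B inner_axis)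
  have "(\<forall>i. l $ i < x $ e i \<and> x $ e i < u $ i) \<longleftrightarrow> (\<forall>j. l $ inv e j < x $ j \<and> x $ j < u $ inv e j)" for x :: "real ^ 'n"
    using assms by (metis bij_inv_eq_iff)
  then have "reindex e -` box l u = box (reindex (inv e) l) (reindex (inv e) u)"
    by (auto simp: mem_box_cart reindex_def)
  then have "emeasure (distr lborel borel (reindex e)) (box l u) = ennreal (\<Prod>i\<in>UNIV. u $ inv e i - l $ inv e i)"
    by (subst emeasure_distr) (simp_all add: emeasure_lborel_box_cart lu reindex_def)
  also have "(\<Prod>i\<in>UNIV. u $ inv e i - l $ inv e i) = (\<Prod>i\<in>UNIV. u $ i - l $ i)"
    using prod.reindex_bij_betw[OF bij_imp_bij_inv[OF assms], of "\<lambda>i. u $ i - l $ i"] by simp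
  also have "ennreal (\<Prod>i\<in>UNIV. u $ i - l $ i) = emeasure lborel (box l u)" by (simp add: emeasure_lborel_box_cart lu)
  also have "\<dots> = (\<Prod>b\<in>Basis. (u - l) \<bullet> b)" by (rule emeasure_lborel_box) (rule le)
  finally show "emeasure (distr lborel borel (reindex e)) (box l u) = (\<Prod>b\<in>Basis. (u - l) \<bullet> b)" .
qed simp

text \<open>A measure is identified with \<open>lborel\<close> by its values on boxes, and the
  preimage of a box under \<open>h\<close> is its image under \<open>g\<close>, whose volume the
  change of variables formula multiplies by \<open>c\<close>.\<close>

lemma lborel_constant_jacobian_wellorder:
  fixes g :: "real ^ 'n::{finite,wellorder} \<Rightarrow> real ^ 'n::_"
  assumes g': "\<And>x. (g has_derivative g' x) (at x)" and c: "\<And>x. \<bar>det (matrix (g' x))\<bar> = c" "c > 0"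
    and inv: "\<And>x. h (g x) = x" "\<And>x. g (h x) = x" and h: "continuous_on UNIV h"
  shows "distr lborel borel h = density lborel (\<lambda>_. ennreal c)"
proof -
  have hm [measurable]: "h \<in> borel_measurable borel" using h by (rule borel_measurable_continuous_onI)
  \<comment> \<open>The box criterion identifies a measure with \<open>lborel\<close> itself, so the
    density is first put on the other side as \<open>1 / c\<close> and moved back
    afterwards.\<close>
  have "lborel = density (distr lborel borel h) (\<lambda>_. ennreal (1 / c))"
  proof (rule lborel_eqI)
    fix l u :: "real ^ 'n::_" assume le: "\<And>b. b \<in> Basis \<Longrightarrow> l \<bullet> b \<le> u \<bullet> b"
    let ?B = "box l u"
    have pre: "h -` ?B = g ` ?B" using inv by (metis (no_types, lifting) image_eqI subsetI subset_antisym vimage_eq imageE)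
    have "((\<lambda>x. c) has_integral (c * measure lebesgue ?B)) ?B"
      using has_integral_mult_right[OF has_integral_measure_lborel[of ?B], of c]
        emeasure_bounded_finite[OF bounded_box, of l u] by simp
    then have "g ` ?B \<in> lmeasurable \<and> measure lebesgue (g ` ?B) = c * measure lebesgue ?B"
      by (subst has_measure_differentiable_image[where f' = g'])
        (auto intro: has_derivative_at_withinI[OF g'] inj_on_inverseI[where g = h] simp: c inv)
    then have "emeasure lebesgue (g ` ?B) = ennreal (c * measure lebesgue ?B)"
      by (metis emeasure_eq_measure2 fmeasurable_def)
    moreover have "g ` ?B \<in> sets borel" unfolding pre[symmetric] using measurable_sets[OF hm, of ?B] by simp
    ultimately have "emeasure lborel (h -` ?B) = ennreal (c * measure lborel ?B)"
      by (simp add: pre)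
    then have "emeasure (density (distr lborel borel h) (\<lambda>_. ennreal (1 / c))) ?B = ennreal (1 / c) * ennreal (c * measure lborel ?B)"
      by (simp add: emeasure_density emeasure_distr nn_integral_cmult)
    also have "\<dots> = ennreal (measure lborel ?B)" using c by (simp flip: ennreal_mult')
    also have "measure lborel ?B = (\<Prod>b\<in>Basis. (u - l) \<bullet> b)" by (rule measure_lborel_box) (rule le)
    finally show "emeasure (density (distr lborel borel h) (\<lambda>_. ennreal (1 / c))) ?B = (\<Prod>b\<in>Basis. (u - l) \<bullet> b)" .
  qed simp
  then have "density lborel (\<lambda>_. ennreal c) = density (density (distr lborel borel h) (\<lambda>_. ennreal (1 / c))) (\<lambda>_. ennreal c)"
    by simp
  also have "\<dots> = density (distr lborel borel h) (\<lambda>_. ennreal (1 / c) * ennreal c)"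
    by (rule density_density_eq) auto
  also have "\<dots> = distr lborel borel h" using c by (simp flip: ennreal_mult' add: density_1)
  finally show ?thesis by simp
qed

lemma lborel_constant_jacobian:
  fixes g :: "real ^ 'n \<Rightarrow> real ^ 'n"
  assumes g': "\<And>x. (g has_derivative g' x) (at x)" and c: "\<And>x. \<bar>det (matrix (g' x))\<bar> = c" "c > 0"
    and inv: "\<And>x. h (g x) = x" "\<And>x. g (h x) = x" and h: "continuous_on UNIV h"
  shows "distr lborel borel h = density lborel (\<lambda>_. ennreal c)"
proof -
  obtain e :: "'n idx \<Rightarrow> 'n" where e: "bij e" using ex_bij_idx by blast
  let ?R = "reindex e :: real ^ 'n \<Rightarrow> real ^ 'n idx" and ?S = "reindex (inv e) :: real ^ 'n idx \<Rightarrow> real ^ 'n"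
  note RS = reindex_inv[OF e]
  have bl: "bounded_linear ?R" "bounded_linear ?S"
    by (intro linear_conv_bounded_linear[THEN iffD1] linear_reindex)+
  have [measurable]: "h \<in> borel_measurable borel" using h by (rule borel_measurable_continuous_onI)
  have S: "distr lborel borel ?S = lborel" by (rule lborel_reindex) (rule bij_imp_bij_inv[OF e])
  have "distr lborel borel (\<lambda>x. ?R (h (?S x))) = density lborel (\<lambda>_. ennreal c)"
  proof (rule lborel_constant_jacobian_wellorder[where g = "\<lambda>x. ?R (g (?S x))" and g' = "\<lambda>x v. ?R (g' (?S x) (?S v))"])
    fix x
    show "((\<lambda>x. ?R (g (?S x))) has_derivative (\<lambda>v. ?R (g' (?S x) (?S v)))) (at x)"
      by (intro bounded_linear.has_derivative[OF bl(1)] has_derivative_compose[OF _ g'] bounded_linear_imp_has_derivative[OF bl(2)])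
    show "\<bar>det (matrix (\<lambda>v. ?R (g' (?S x) (?S v))))\<bar> = c"
      using det_matrix_reindex[OF e has_derivative_linear[OF g']] c by simp
    show "continuous_on UNIV (\<lambda>x. ?R (h (?S x)))"
      by (intro bounded_linear.continuous_on[OF bl(1)] continuous_on_compose2[OF h] bounded_linear.continuous_on[OF bl(2)] continuous_on_id) auto
  qed (use c inv RS in auto)
  then have "distr (distr lborel borel (\<lambda>x. ?R (h (?S x)))) borel ?S = distr (density lborel (\<lambda>_. ennreal c)) borel ?S"
    by simp
  also have "\<dots> = density (distr lborel borel ?S) (\<lambda>_. ennreal c)"
    by (subst density_distr) auto
  also have "\<dots> = density lborel (\<lambda>_. ennreal c)" by (simp add: S)
  also have "distr (distr lborel borel (\<lambda>x. ?R (h (?S x)))) borel ?S = distr lborel borel (h \<circ> ?S)"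
    by (subst distr_distr) (auto simp: RS o_def)
  also have "\<dots> = distr (distr lborel borel ?S) borel h"
    by (subst distr_distr) auto
  finally show ?thesis by (simp add: S)
qed

section \<open>Haar measure and quasi-norms of homogeneous groups\<close>

text \<open>The endpoints may be infinite or singular, since only one-sided limits of the
  antiderivative enter; nonnegativity of \<open>f\<close> gives integrability together with the
  value. All radial integrals below are computed in this way.\<close>

lemma nn_integral_FTC_open:
  fixes f F :: "real \<Rightarrow> real" and a b :: ereal
  assumes "a < b"
    and F: "\<And>x. a < ereal x \<Longrightarrow> ereal x < b \<Longrightarrow> DERIV F x :> f x"
    and f: "\<And>x. a < ereal x \<Longrightarrow> ereal x < b \<Longrightarrow> isCont f x"
    and nn: "\<And>x. a < ereal x \<Longrightarrow> ereal x < b \<Longrightarrow> 0 \<le> f x"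
    and A: "((F \<circ> real_of_ereal) \<longlongrightarrow> A) (at_right a)"
    and B: "((F \<circ> real_of_ereal) \<longlongrightarrow> B) (at_left b)"
  shows "(\<integral>\<^sup>+x. ennreal (f x) * indicator (einterval a b) x \<partial>lborel) = ennreal (B - A)"
proof -
  have 1: "set_integrable lborel (einterval a b) f" and 2: "(LBINT x=a..b. f x) = B - A"
    using interval_integral_FTC_nonneg[OF assms(1) F f _ A B] nn by auto
  have "(\<integral>\<^sup>+x. ennreal (f x) * indicator (einterval a b) x \<partial>lborel)
      = (\<integral>\<^sup>+x. ennreal (indicator (einterval a b) x *\<^sub>R f x) \<partial>lborel)"
    by (intro nn_integral_cong) (auto split: split_indicator)
  also have "\<dots> = ennreal (\<integral>x. indicator (einterval a b) x *\<^sub>R f x \<partial>lborel)"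
    using 1 by (intro nn_integral_eq_integral) (auto simp: set_integrable_def einterval_iff nn split: split_indicator)
  also have "(\<integral>x. indicator (einterval a b) x *\<^sub>R f x \<partial>lborel) = B - A"
    using 2 \<open>a < b\<close> by (simp add: interval_lebesgue_integral_def set_lebesgue_integral_def less_imp_le)
  finally show ?thesis .
qed

section \<open>Dilations in eigencoordinates\<close>

context homogeneous_group
begin

text \<open>An eigenbasis of \<open>A\<close> has \<open>CARD('n)\<close> elements and can be
  indexed by \<open>'n\<close>. \<open>T\<close> maps the standard basis to it, \<open>S\<close>
  takes coordinates with respect to it, and \<open>m i\<close> are the eigenvalues.\<close>

lemma eigen_coordinates:
  "\<exists>(T :: real ^ 'n \<Rightarrow> real ^ 'n) (S :: real ^ 'n \<Rightarrow> real ^ 'n) m. linear T \<and> linear S \<and> (\<forall>x. S (T x) = x) \<and> (\<forall>x. T (S x) = x) \<and> (\<forall>i::'n. m i > 0) \<and>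
     (\<forall>x. A x = T (\<chi> i. m i * S x $ i))"
proof -
  obtain B where B: "independent B" "span B = UNIV" "\<And>b. b \<in> B \<Longrightarrow> \<exists>\<mu>. A b = \<mu> *\<^sub>R b"
    using diagonalisable_A unfolding diagonalisable_def by blast
  have fB: "finite B" using B(1) by (rule independent_imp_finite)
  have "card B = CARD('n)" using basis_card_eq_dim[of B UNIV] B by (simp add: dim_UNIV)
  then obtain b where b: "bij_betw b (UNIV :: 'n set) B"
    using finite_same_card_bij[of "UNIV :: 'n set" B] fB by auto
  then have bB: "b i \<in> B" for i by (auto simp: bij_betw_def)
  have "\<exists>\<mu>. A (b i) = \<mu> *\<^sub>R b i" for i using B(3) bB by blast
  then obtain m where m: "\<And>i. A (b i) = m i *\<^sub>R b i" by metis
  have "b i \<noteq> 0" for i using bB B(1) dependent_zero by metis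
  then have mpos: "m i > 0" for i using eigenvalues_pos m by blast
  define T where "T x = (\<Sum>i\<in>UNIV. x $ i *\<^sub>R b i)" for x :: "real ^ 'n"
  have T: "linear T"
    unfolding T_def by (auto simp: linear_iff sum.distrib scaleR_add_left scaleR_sum_right)
  have "surj T"
  proof -
    have "\<exists>x. y = T x" for y
    proof -
      have "y \<in> span B" using B by simp
      then obtain u where "y = (\<Sum>v\<in>B. u v *\<^sub>R v)" using span_finite[OF fB] by auto
      also have "\<dots> = (\<Sum>i\<in>UNIV. u (b i) *\<^sub>R b i)" using sum.reindex_bij_betw[OF b, of "\<lambda>v. u v *\<^sub>R v"] by simp
      finally have "y = T (\<chi> i. u (b i))" by (simp add: T_def)
      then show ?thesis by blast
    qed
    then show ?thesis by (metis surjI)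
  qed
  from linear_surjective_isomorphism[OF T this]
  obtain S where S: "linear S" "\<And>x. S (T x) = x" "\<And>x. T (S x) = x" by blast
  have "A x = T (\<chi> i. m i * S x $ i)" for x
  proof -
    have "A x = A (T (S x))" by (simp add: S)
    also have "\<dots> = T (\<chi> i. m i * S x $ i)"
      unfolding T_def by (simp add: linear_sum[OF linear_A] linear_scale[OF linear_A] m mult.commute)
    finally show ?thesis .
  qed
  with T S mpos show ?thesis by (intro exI[of _ T] exI[of _ S] exI[of _ m]) auto
qed

end

locale homogeneous_group_coords = homogeneous_group mul ginv A
  for mul :: "real ^ 'n \<Rightarrow> real ^ 'n \<Rightarrow> real ^ 'n" and ginv A +
  fixes T S :: "real ^ 'n \<Rightarrow> real ^ 'n" and m :: "'n \<Rightarrow> real"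
  assumes T_linear: "linear T" and S_linear: "linear S" and ST [simp]: "S (T x) = x" and TS [simp]: "T (S x) = x"
    and m_pos: "m i > 0" and A_eq: "A x = T (\<chi> i. m i * S x $ i)"
begin

text \<open>In these coordinates the exponential series is diagonal and sums entrywise to
  \<open>exp (ln l * m i)\<close>.\<close>

lemma dil_eq:
  assumes "l > 0"
  shows "dil A l x = T (\<chi> i. l powr m i * S x $ i)"
proof -
  have pow: "((\<lambda>v. ln l *\<^sub>R A v) ^^ k) x = T (\<chi> i. (ln l * m i) ^ k * S x $ i)" for k
  proof (induction k)
    case 0
    have "(\<chi> i. S x $ i) = S x" by (simp add: vec_eq_iff)
    then show ?case by simp
  next
    case (Suc k)
    have "((\<lambda>v. ln l *\<^sub>R A v) ^^ Suc k) x = ln l *\<^sub>R A (T (\<chi> i. (ln l * m i) ^ k * S x $ i))"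
      by (simp add: Suc)
    also have "\<dots> = T (ln l *\<^sub>R (\<chi> i. m i * S (T (\<chi> i. (ln l * m i) ^ k * S x $ i)) $ i))"
      by (simp only: A_eq[of "T _"] linear_scale[OF T_linear])
    also have "\<dots> = T (\<chi> i. (ln l * m i) ^ Suc k * S x $ i)"
      by (rule arg_cong[where f = T]) (simp add: vec_eq_iff)
    finally show ?case .
  qed
  have T': "bounded_linear T" using T_linear by (rule linear_conv_bounded_linear[THEN iffD1])
  have "(\<lambda>k. \<chi> i. (1 / fact k) * ((ln l * m i) ^ k * S x $ i)) sums (\<chi> i. l powr m i * S x $ i)"
    unfolding sums_def
  proof (rule vec_tendstoI)
    fix i
    have "(\<lambda>k. (ln l * m i) ^ k /\<^sub>R fact k) sums exp (ln l * m i)" by (rule exp_converges)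
    from sums_mult2[OF this, of "S x $ i"]
    have "(\<lambda>k. (1 / fact k) * ((ln l * m i) ^ k * S x $ i)) sums (l powr m i * S x $ i)"
      using assms by (simp add: powr_def divide_inverse mult_ac)
    then show "(\<lambda>n. (\<Sum>k<n. \<chi> i. (1 / fact k) * ((ln l * m i) ^ k * S x $ i)) $ i) \<longlonglongrightarrow> (\<chi> i. l powr m i * S x $ i) $ i"
      by (simp add: sums_def)
  qed
  from bounded_linear.sums[OF T' this]
  have "(\<lambda>k. T (\<chi> i. (1 / fact k) * ((ln l * m i) ^ k * S x $ i))) sums T (\<chi> i. l powr m i * S x $ i)" .
  moreover have "T (\<chi> i. (1 / fact k) * ((ln l * m i) ^ k * S x $ i)) = (1 / fact k) *\<^sub>R ((\<lambda>v. ln l *\<^sub>R A v) ^^ k) x" for k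
    unfolding pow linear_scale[OF T_linear, symmetric] by (rule arg_cong[where f = T]) (simp add: vec_eq_iff)
  ultimately have "(\<lambda>k. (1 / fact k) *\<^sub>R ((\<lambda>v. ln l *\<^sub>R A v) ^^ k) x) sums T (\<chi> i. l powr m i * S x $ i)" by (simp only:)
  from sums_unique[OF this] show ?thesis by (simp add: dil_def op_Exp_def)
qed

lemma trace_det_conj: 
  assumes "linear f" shows "trace (matrix (\<lambda>x. T (f (S x)))) = trace (matrix f)"
    and "det (matrix (\<lambda>x. T (f (S x)))) = det (matrix f)"
proof -
  have *: "matrix (\<lambda>x. T (f (S x))) = matrix T ** (matrix f ** matrix S)"
    using matrix_compose[OF linear_compose[OF S_linear assms] T_linear] matrix_compose[OF S_linear assms]
    by (simp add: o_def)
  have ST': "matrix S ** matrix T = mat 1"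
    using matrix_compose[OF T_linear S_linear] by (simp add: o_def matrix_id_mat_1[unfolded id_def])
  show "trace (matrix (\<lambda>x. T (f (S x)))) = trace (matrix f)"
    unfolding * by (subst trace_mul_sym) (simp add: matrix_mul_assoc[symmetric] ST')
  have "det (matrix S) * det (matrix T) = 1" using ST' by (metis det_I det_mul)
  then show "det (matrix (\<lambda>x. T (f (S x)))) = det (matrix f)"
    unfolding * det_mul by (simp add: mult_ac)
qed

lemma linear_diag: "linear (\<lambda>x :: real ^ 'n. \<chi> i. c i * x $ i)"
  by (simp add: linear_iff vec_eq_iff algebra_simps)

lemma matrix_diag: "matrix (\<lambda>x :: real ^ 'n. \<chi> i. c i * x $ i) = (\<chi> i j. if i = j then c i else 0)"
  by (simp add: matrix_def vec_eq_iff axis_def)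

lemma hom_dim_eq: "hom_dim A = (\<Sum>i\<in>UNIV. m i)"
proof -
  have "A = (\<lambda>x. T (\<chi> i. m i * S x $ i))" using A_eq by blast
  then have "trace (matrix A) = trace (matrix (\<lambda>x. T ((\<lambda>x. \<chi> i. m i * x $ i) (S x))))" by metis
  also have "\<dots> = (\<Sum>i\<in>UNIV. m i)" unfolding trace_det_conj(1)[OF linear_diag] matrix_diag by (simp add: trace_def)
  finally show ?thesis by (simp add: hom_dim_def)
qed

lemma det_dil:
  assumes "l > 0"
  shows "det (matrix (dil A l)) = l powr hom_dim A"
proof -
  have "dil A l = (\<lambda>x. T (\<chi> i. l powr m i * S x $ i))" using dil_eq[OF assms] by blast
  then have "det (matrix (dil A l)) = det (matrix (\<lambda>x. T ((\<lambda>x. \<chi> i. l powr m i * x $ i) (S x))))" by metis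
  also have "\<dots> = (\<Prod>i\<in>UNIV. l powr m i)"
    unfolding trace_det_conj(2)[OF linear_diag] matrix_diag by (subst det_diagonal) auto
  also have "\<dots> = l powr hom_dim A" using assms by (simp add: hom_dim_eq powr_sum)
  finally show ?thesis .
qed

lemma T_continuous: "continuous_on UNIV T"
  by (intro linear_continuous_on linear_conv_bounded_linear[THEN iffD1] T_linear)

lemma T_tendsto: "(f \<longlongrightarrow> y) F \<Longrightarrow> ((\<lambda>z. T (f z)) \<longlongrightarrow> T y) F"
  using T_continuous by (auto simp: continuous_on_eq_continuous_at intro: isCont_tendsto_compose)

lemma dil_tendsto_0: "((\<lambda>l. dil A l x) \<longlongrightarrow> 0) (at_right 0)"
proof -
  have "((\<lambda>l. T (\<chi> i. l powr m i * S x $ i)) \<longlongrightarrow> T (\<chi> i. 0 * S x $ i)) (at_right 0)"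
  proof (intro T_tendsto vec_tendstoI)
    fix i
    have "((\<lambda>l. l powr m i) \<longlongrightarrow> 0 powr m i) (at_right 0)"
      by (rule tendsto_powr2[OF tendsto_ident_at tendsto_const])
        (auto simp: m_pos intro!: eventually_at_rightI[of 0 1])
    from tendsto_mult[OF this tendsto_const[of "S x $ i"]]
    show "((\<lambda>l. (\<chi> i. l powr m i * S x $ i) $ i) \<longlongrightarrow> (\<chi> i. 0 * S x $ i) $ i) (at_right 0)"
      by simp
  qed
  moreover have "T (\<chi> i. 0 * S x $ i) = 0" using linear_0[OF T_linear] by (simp add: zero_vec_def)
  moreover have "eventually (\<lambda>l. dil A l x = T (\<chi> i. l powr m i * S x $ i)) (at_right 0)"
    by (rule eventually_at_rightI[of 0 1]) (auto simp: dil_eq)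
  ultimately show ?thesis by (simp add: tendsto_cong)
qed

lemma dil_continuous: "continuous_on {0<..} (\<lambda>l. dil A l x)"
proof -
  have "continuous_on {0<..} (\<lambda>l. T (\<chi> i. l powr m i * S x $ i))"
    by (rule continuous_on_compose2[OF T_continuous]) (auto intro!: continuous_intros)
  then show ?thesis by (rule continuous_on_cong[THEN iffD1, rotated -1]) (auto simp: dil_eq)
qed

lemma dil_compose: "k > 0 \<Longrightarrow> l > 0 \<Longrightarrow> dil A k (dil A l x) = dil A (k * l) x"
  by (simp add: dil_eq powr_mult mult_ac)

lemma dil_1 [simp]: "dil A 1 x = x"
proof -
  have "(\<chi> i. S x $ i) = S x" by (simp add: vec_eq_iff)
  then show ?thesis by (simp add: dil_eq)
qed

lemma hom_dim_pos: "hom_dim A > 0"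
  unfolding hom_dim_eq by (rule sum_pos) (auto simp: m_pos)

end

context homogeneous_group
begin

lemma obtain_coords: obtains T S m where "homogeneous_group_coords mul ginv A T S m"
proof -
  obtain T S :: "real ^ 'n \<Rightarrow> real ^ 'n" and m where "linear T" "linear S" "\<forall>x. S (T x) = x" "\<forall>x. T (S x) = x" "\<forall>i::'n. m i > 0"
     "\<forall>x. A x = T (\<chi> i. m i * S x $ i)"
    using eigen_coordinates by blast
  then have "homogeneous_group_coords_axioms A T S m" by (simp add: homogeneous_group_coords_axioms_def)
  then have "homogeneous_group_coords mul ginv A T S m"
    by (intro homogeneous_group_coords.intro homogeneous_group_axioms)
  then show thesis by (rule that)
qed

lemma dil_linear: "l > 0 \<Longrightarrow> linear (dil A l)"
  using dil_morphism by (simp add: lie_algebra_morphism_def)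

lemma dil_mul: "l > 0 \<Longrightarrow> dil A l (mul x y) = mul (dil A l x) (dil A l y)"
  using lie_algebra_morphism_imp_mul_morphism[OF dil_morphism] .

lemma Q_pos: "hom_dim A > 0"
  by (rule obtain_coords) (rule homogeneous_group_coords.hom_dim_pos)

lemma dil_facts:
  shows dil_det: "l > 0 \<Longrightarrow> det (matrix (dil A l)) = l powr hom_dim A"
    and dil_lim: "((\<lambda>l. dil A l x) \<longlongrightarrow> 0) (at_right 0)"
    and dil_cont: "continuous_on {0<..} (\<lambda>l. dil A l x)"
    and dil_dil: "k > 0 \<Longrightarrow> l > 0 \<Longrightarrow> dil A k (dil A l x) = dil A (k * l) x"
    and dil_one [simp]: "dil A 1 x = x"
proof -
  obtain T S m where "homogeneous_group_coords mul ginv A T S m" by (rule obtain_coords)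
  then interpret homogeneous_group_coords mul ginv A T S m .
  show "l > 0 \<Longrightarrow> det (matrix (dil A l)) = l powr hom_dim A" by (rule det_dil)
  show "((\<lambda>l. dil A l x) \<longlongrightarrow> 0) (at_right 0)" by (rule dil_tendsto_0)
  show "continuous_on {0<..} (\<lambda>l. dil A l x)" by (rule dil_continuous)
  show "k > 0 \<Longrightarrow> l > 0 \<Longrightarrow> dil A k (dil A l x) = dil A (k * l) x" by (rule dil_compose)
  show "dil A 1 x = x" by (rule dil_1)
qed

lemma mul_continuous: "continuous_on UNIV (\<lambda>(x, y). mul x y)"
proof -
  obtain d d2 where "lie_group_derivs mul ginv d d2" by (rule obtain_derivs)
  then interpret lie_group_derivs mul ginv d d2 .
  show ?thesis unfolding continuous_on_eq_continuous_at[OF open_UNIV]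
    by (intro ballI has_derivative_continuous[OF mul_deriv])
qed

lemma mul_continuous_left: "continuous_on UNIV (mul x)"
  using continuous_on_compose2[OF mul_continuous, OF continuous_on_Pair[OF continuous_on_const continuous_on_id]]
  by simp

text \<open>The Jacobian of a left translation at 0 is invariant under dilations, and hence equal to its
  value at the neutral element.\<close>

lemma left_translation_jacobian:
  "\<exists>D. (mul a has_derivative D) (at y) \<and> det (matrix D) = 1"
proof -
  obtain d d2 where "lie_group_derivs mul ginv d d2" by (rule obtain_derivs)
  then interpret lie_group_derivs mul ginv d d2 .
  have det_M: "det (matrix (M x)) = 1" for x
  proof -
    have inv: "det (matrix (M (dil A l x))) = det (matrix (M x))" if l: "l > 0" for l
    proof -
      have "\<And>v w. dil A l (br v w) = br (dil A l v) (dil A l w)"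
        using dil_morphism[OF l] by (simp add: lie_algebra_morphism_def lie_bracket_eq)
      from M_morphism[OF dil_linear[OF l] this]
      have "dil A l \<circ> M x = M (dil A l x) \<circ> dil A l" by (simp add: fun_eq_iff)
      then have "det (matrix (dil A l) ** matrix (M x)) = det (matrix (M (dil A l x)) ** matrix (dil A l))"
        using matrix_compose[OF M_linear dil_linear[OF l]] matrix_compose[OF dil_linear[OF l] M_linear] by metis
      then show ?thesis using l by (simp add: det_mul dil_det)
    qed
    have "((\<lambda>l. det (matrix (M (dil A l x)))) \<longlongrightarrow> det (matrix (M 0))) (at_right 0)"
      unfolding det_def
    proof (intro tendsto_sum tendsto_mult[OF tendsto_const] tendsto_prod)
      fix p :: "'n \<Rightarrow> 'n" and i
      let ?j = "p i"
      have "isCont (\<lambda>x. M x (axis ?j 1)) 0" using M_deriv has_derivative_continuous by blast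
      then have "((\<lambda>l. M (dil A l x) (axis ?j 1)) \<longlongrightarrow> M 0 (axis ?j 1)) (at_right 0)"
        using dil_lim by (rule isCont_tendsto_compose)
      from tendsto_vec_nth[OF this, of i]
      show "((\<lambda>l. matrix (M (dil A l x)) $ i $ ?j) \<longlongrightarrow> matrix (M 0) $ i $ ?j) (at_right 0)"
        unfolding matrix_def vec_lambda_beta .
    qed
    moreover have "eventually (\<lambda>l. det (matrix (M (dil A l x))) = det (matrix (M x))) (at_right 0)"
      by (rule eventually_at_rightI[of 0 1]) (auto simp: inv)
    ultimately have "((\<lambda>l. det (matrix (M x))) \<longlongrightarrow> det (matrix (M 0))) (at_right (0::real))"
      by (simp add: tendsto_cong)
    then have "det (matrix (M x)) = det (matrix (M 0))"
      unfolding tendsto_const_iff[OF trivial_limit_at_right_real] .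
    moreover have "M 0 = id" by (simp add: fun_eq_iff)
    ultimately show ?thesis by (simp add: matrix_id_mat_1)
  qed
  \<comment> \<open>Passage from 0 to an arbitrary point: by the chain rule the derivative of the
    translation at \<open>y\<close> is a quotient of two differentials at 0, both of determinant
    1.\<close>
  have "M (mul a y) = (\<lambda>v. d (a, y) (0, v)) \<circ> M y" by (simp add: fun_eq_iff M_mul)
  then have "det (matrix (M (mul a y))) = det (matrix (\<lambda>v. d (a, y) (0, v)) ** matrix (M y))"
    using matrix_compose[OF M_linear d_right_linear] by metis
  then have "det (matrix (\<lambda>v. d (a, y) (0, v))) = 1" by (simp add: det_mul det_M)
  with mul_right_deriv show ?thesis by blast
qed

lemma lborel_mul_left: "distr lborel borel (mul x) = lborel"
proof -
  obtain D where D: "\<And>y. (mul (- x) has_derivative D y) (at y)" "\<And>y. det (matrix (D y)) = 1"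
    using left_translation_jacobian[of "- x"] by metis
  have "distr lborel borel (mul x) = density lborel (\<lambda>_. ennreal 1)"
    by (rule lborel_constant_jacobian[where g = "mul (- x)" and g' = D])
      (use D in \<open>auto intro: mul_continuous_left\<close>)
  then show ?thesis by (simp add: density_1)
qed

lemma borel_mul_left [measurable]: "mul x \<in> borel_measurable borel"
  by (intro borel_measurable_continuous_onI mul_continuous_left)

lemma nn_integral_mul_left:
  assumes [measurable]: "f \<in> borel_measurable borel"
  shows "(\<integral>\<^sup>+y. f (mul x y) \<partial>lborel) = (\<integral>\<^sup>+y. f y \<partial>lborel)"
  by (subst lborel_mul_left[of x, symmetric], subst nn_integral_distr) auto

lemma lborel_dil:
  assumes l: "l > 0"
  shows "distr lborel borel (dil A (1 / l)) = density lborel (\<lambda>_. ennreal (l powr hom_dim A))"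
proof (rule lborel_constant_jacobian[where g = "dil A l" and g' = "\<lambda>_. dil A l"])
  have "bounded_linear (dil A l)" "bounded_linear (dil A (1 / l))"
    using l by (auto intro!: linear_conv_bounded_linear[THEN iffD1] dil_linear)
  then show "(dil A l has_derivative dil A l) (at x)" "continuous_on UNIV (dil A (1 / l))" for x
    by (auto intro: bounded_linear_imp_has_derivative linear_continuous_on)
  show "\<bar>det (matrix (dil A l))\<bar> = l powr hom_dim A" "l powr hom_dim A > 0"
    using l by (simp_all add: dil_det)
  show "dil A (1 / l) (dil A l x) = x" "dil A l (dil A (1 / l) x) = x" for x
    using l by (simp_all add: dil_dil)
qed

end

section \<open>Bounded balls, quasi-triangle inequality and polar coordinates\<close>

locale quasi_normed_group = homogeneous_group mul ginv A
  for mul :: "real ^ 'n \<Rightarrow> real ^ 'n \<Rightarrow> real ^ 'n" and ginv A +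
  fixes N :: "real ^ 'n \<Rightarrow> real"
  assumes quasi_norm: "homogeneous_quasi_norm ginv A N"
begin

abbreviation Q :: real where "Q \<equiv> hom_dim A"

lemma N_continuous: "continuous_on UNIV N" and N_nonneg [simp]: "0 \<le> N x" and N_uminus [simp]: "N (- x) = N x"
  and N_dil: "l > 0 \<Longrightarrow> N (dil A l x) = l * N x" and N_eq_0 [simp]: "N x = 0 \<longleftrightarrow> x = 0"
  using quasi_norm by (auto simp: homogeneous_quasi_norm_def ginv_eq_uminus)

lemma N_zero [simp]: "N 0 = 0"
  by simp

lemma N_pos: "x \<noteq> 0 \<Longrightarrow> 0 < N x"
  using N_nonneg[of x] N_eq_0[of x] by linarith

lemma borel_N [measurable]: "N \<in> borel_measurable borel"
  by (intro borel_measurable_continuous_onI N_continuous)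

text \<open>On the Euclidean unit sphere \<open>N\<close> has a positive minimum \<open>c\<close>. A
  point outside the Euclidean unit ball with \<open>N x < c\<close> is impossible: its orbit under
  shrinking dilations tends to 0, so it crosses the sphere, and \<open>N\<close> only decreases
  along it. Balls of other radii are dilates of a set inside \<open>{x. N x < c}\<close>.\<close>

lemma bounded_N_ball: "bounded {x. N x \<le> r}"
proof -
  have "compact (sphere (0 :: real ^ 'n) 1)" "sphere (0 :: real ^ 'n) 1 \<noteq> {}" by auto
  from continuous_attains_inf[OF this continuous_on_subset[OF N_continuous]]
  obtain x0 where x0: "norm x0 = 1" "\<And>x. norm x = 1 \<Longrightarrow> N x0 \<le> N x" by auto
  define c where "c = N x0"
  have c: "c > 0" unfolding c_def using x0(1) by (intro N_pos) auto
  have small: "norm x \<le> 1" if "N x < c" for x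
  proof (rule ccontr)
    assume x: "\<not> norm x \<le> 1"
    have "eventually (\<lambda>l. dist (dil A l x) 0 < 1) (at_right 0)" using dil_lim by (rule tendstoD) simp
    then obtain b where b: "b > 0" "\<And>l. 0 < l \<Longrightarrow> l < b \<Longrightarrow> norm (dil A l x) < 1"
      unfolding eventually_at_right_field by auto
    define k where "k = min (b / 2) (1 / 2)"
    have k: "0 < k" "k < 1" "norm (dil A k x) < 1" using b by (auto simp: k_def min_def)
    have "\<exists>l. k \<le> l \<and> l \<le> 1 \<and> norm (dil A l x) = 1"
    proof (rule IVT')
      show "continuous_on {k..1} (\<lambda>l. norm (dil A l x))"
        by (intro continuous_intros continuous_on_subset[OF dil_cont]) (use k in auto)
    qed (use k x in auto)
    then obtain l where l: "k \<le> l" "l \<le> 1" "norm (dil A l x) = 1" by blast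
    then have "c \<le> N (dil A l x)" unfolding c_def by (intro x0)
    also have "\<dots> = l * N x" using l k by (simp add: N_dil)
    also have "\<dots> \<le> 1 * N x" using l by (intro mult_right_mono) auto
    finally show False using that by simp
  qed
  \<comment> \<open>Chosen so that \<open>l * r < c\<close> whatever the sign of
    \<open>r\<close>.\<close>
  define l where "l = c / (2 * (\<bar>r\<bar> + 1))"
  have l: "l > 0" using c by (simp add: l_def)
  have "{x. N x \<le> r} \<subseteq> dil A (1 / l) ` cball 0 1"
  proof
    fix x assume "x \<in> {x. N x \<le> r}"
    then have "N (dil A l x) \<le> l * r" using l by (simp add: N_dil)
    also have "\<dots> < l * (2 * (\<bar>r\<bar> + 1))" using l by (intro mult_strict_left_mono) auto
    also have "\<dots> = c" by (simp add: l_def)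
    finally have "norm (dil A l x) \<le> 1" by (rule small)
    moreover have "x = dil A (1 / l) (dil A l x)" using l by (simp add: dil_dil)
    ultimately show "x \<in> dil A (1 / l) ` cball 0 1" by (metis image_eqI mem_cball_0)
  qed
  moreover have "bounded (dil A (1 / l) ` cball 0 1)"
    using l by (intro bounded_linear_image linear_conv_bounded_linear[THEN iffD1] dil_linear) auto
  ultimately show ?thesis by (rule bounded_subset[rotated])
qed

text \<open>Both sides are homogeneous of degree 1, so one may normalise to
  \<open>N x + N y = 1\<close>. Then \<open>x\<close> and \<open>y\<close> lie in the compact unit
  ball, on which the continuous function \<open>N (mul x y)\<close> is bounded.\<close>

lemma quasi_triangle: "\<exists>\<kappa>\<ge>1. \<forall>x y. N (mul x y) \<le> \<kappa> * (N x + N y)"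
proof -
  let ?K = "{x. N x \<le> 1}"
  have "closed ?K" by (intro closed_Collect_le N_continuous continuous_intros)
  then have K: "compact ?K" using bounded_N_ball by (simp add: compact_eq_bounded_closed)
  have "continuous_on UNIV (\<lambda>(x, y). N (mul x y))"
    using continuous_on_compose2[OF N_continuous mul_continuous] by (simp add: case_prod_unfold)
  then have "compact ((\<lambda>(x, y). N (mul x y)) ` (?K \<times> ?K))"
    by (intro compact_continuous_image compact_Times K) (rule continuous_on_subset, auto)
  then have "bounded ((\<lambda>(x, y). N (mul x y)) ` (?K \<times> ?K))" by (rule compact_imp_bounded)
  then obtain B where B: "\<And>x y. N x \<le> 1 \<Longrightarrow> N y \<le> 1 \<Longrightarrow> N (mul x y) \<le> B"
    unfolding bounded_iff by fastforce
  show ?thesis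
  proof (intro exI[of _ "max B 1"] conjI allI)
    fix x y
    show "N (mul x y) \<le> max B 1 * (N x + N y)"
    proof (cases "N x + N y = 0")
      case True
      then have "N x = 0" "N y = 0" using N_nonneg[of x] N_nonneg[of y] by linarith+
      then show ?thesis by simp
    next
      case False
      define l where "l = 1 / (N x + N y)"
      have s: "N x + N y > 0" using False N_nonneg[of x] N_nonneg[of y] by linarith
      then have l: "l > 0" by (simp add: l_def)
      have "l * N (mul x y) = N (mul (dil A l x) (dil A l y))" using l by (simp add: dil_mul flip: N_dil)
      also have "\<dots> \<le> B" using l s by (intro B) (auto simp: N_dil l_def)
      also have "\<dots> \<le> max B 1" by simp
      finally show ?thesis using s by (simp add: l_def divide_le_eq)
    qed
  qed simp
qed

definition ball_vol :: real where "ball_vol = measure lborel {x. N x \<le> 1}"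

lemma emeasure_N_ball:
  assumes "r > 0"
  shows "emeasure lborel {x. N x \<le> r} = ennreal (ball_vol * r powr Q)"
proof -
  have "emeasure lborel {x. N x \<le> 1} < \<infinity>" using bounded_N_ball by (rule emeasure_bounded_finite)
  then have v: "emeasure lborel {x. N x \<le> 1} = ennreal ball_vol"
    unfolding ball_vol_def by (intro emeasure_eq_ennreal_measure) auto
  have "bounded_linear (dil A (1 / r))" using assms by (auto intro!: linear_conv_bounded_linear[THEN iffD1] dil_linear)
  then have [measurable]: "dil A (1 / r) \<in> borel_measurable borel"
    by (intro borel_measurable_continuous_onI linear_continuous_on)
  have "{x. N x \<le> r} = dil A (1 / r) -` {x. N x \<le> 1}" using assms by (auto simp: N_dil)
  then have "emeasure lborel {x. N x \<le> r} = emeasure (distr lborel borel (dil A (1 / r))) {x. N x \<le> 1}"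
    by (simp add: emeasure_distr)
  also have "\<dots> = ennreal (r powr Q) * ennreal ball_vol"
    unfolding lborel_dil[OF assms] by (subst emeasure_density) (simp_all add: nn_integral_cmult v)
  finally show ?thesis by (simp add: ennreal_mult' mult.commute flip: ennreal_mult'')
qed

lemma ball_vol_nonneg [simp]: "0 \<le> ball_vol"
  by (simp add: ball_vol_def)

text \<open>Polar coordinates without a surface measure: half-lines generate the Borel sets, and
  their preimages under \<open>N\<close> are quasi-balls, whose volume
  \<open>ball_vol * r powr Q\<close> is the integral of the stated density.\<close>

lemma distr_N:
  "distr lborel borel N = density lborel (\<lambda>t. ennreal (ball_vol * Q * t powr (Q - 1)) * indicator {0<..} t)" (is "?L = ?R")
proof (rule measure_eqI_generator_eq[where E = "range atMost" and \<Omega> = UNIV and A = "\<lambda>i. {..real i}"])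
  show "Int_stable (range (atMost :: real \<Rightarrow> real set))" by (auto simp: Int_stable_def)
  show "sets ?L = sigma_sets UNIV (range atMost)" "sets ?R = sigma_sets UNIV (range atMost)"
    using borel_eq_atMost by (metis sets_distr sets_density sets_lborel sets_measure_of subset_UNIV Pow_UNIV)+
  have L: "emeasure ?L {..r} = (if r > 0 then ennreal (ball_vol * r powr Q) else 0)" for r
  proof (cases "r > 0")
    case True
    then show ?thesis using emeasure_N_ball by (simp add: emeasure_distr vimage_def)
  next
    case False
    then have "{x. N x \<le> r} \<subseteq> {0}" using N_pos by fastforce
    then have "emeasure lborel {x. N x \<le> r} \<le> emeasure lborel {0 :: real ^ 'n}" by (intro emeasure_mono) auto
    with False show ?thesis by (simp add: emeasure_distr vimage_def)
  qed
  show "emeasure ?L X = emeasure ?R X" if X: "X \<in> range atMost" for X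
  proof -
    obtain r where r: "X = {..r}" using X by blast
    have "emeasure ?R X = (\<integral>\<^sup>+t. ennreal (ball_vol * Q * t powr (Q - 1)) * indicator ({0<..} \<inter> {..r}) t \<partial>lborel)"
      unfolding r by (subst emeasure_density) (auto intro!: nn_integral_cong split: split_indicator)
    also have "\<dots> = (if r > 0 then ennreal (ball_vol * r powr Q) else 0)"
    proof (cases "r > 0")
      case False
      then have "{0<..} \<inter> {..r} = {}" by auto
      then show ?thesis using False by simp
    next
      case True
      have "(\<integral>\<^sup>+t. ennreal (ball_vol * Q * t powr (Q - 1)) * indicator ({0<..} \<inter> {..r}) t \<partial>lborel)
          = (\<integral>\<^sup>+t. ennreal (ball_vol * Q * t powr (Q - 1)) * indicator (einterval 0 (ereal r)) t \<partial>lborel)"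
        by (intro nn_integral_cong_AE, use AE_lborel_singleton[of r] in eventually_elim)
           (auto simp: einterval_iff split: split_indicator)
      also have "\<dots> = ennreal (ball_vol * r powr Q - 0)"
      proof (rule nn_integral_FTC_open[where F = "\<lambda>t. ball_vol * t powr Q"])
        fix t assume "0 < ereal t" "ereal t < ereal r"
        then have t: "t > 0" by simp
        show "((\<lambda>t. ball_vol * t powr Q) has_real_derivative ball_vol * Q * t powr (Q - 1)) (at t)"
          using DERIV_cmult[OF has_real_derivative_powr[OF t, of Q], of ball_vol] by (simp add: mult.assoc)
        show "isCont (\<lambda>t. ball_vol * Q * t powr (Q - 1)) t"
          by (intro continuous_intros) (use t in auto)
        show "0 \<le> ball_vol * Q * t powr (Q - 1)" using Q_pos by simp
      next
        show "(((\<lambda>t. ball_vol * t powr Q) \<circ> real_of_ereal) \<longlongrightarrow> 0) (at_right 0)"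
          unfolding zero_ereal_def ereal_tendsto_simps
          by (rule tendsto_eq_rhs[OF tendsto_mult[OF tendsto_const tendsto_powr2[OF tendsto_ident_at tendsto_const]]])
             (use Q_pos in \<open>auto intro!: eventually_at_rightI[of 0 1] less_imp_le\<close>)
        show "(((\<lambda>t. ball_vol * t powr Q) \<circ> real_of_ereal) \<longlongrightarrow> ball_vol * r powr Q) (at_left (ereal r))"
          unfolding ereal_tendsto_simps by (intro tendsto_intros) (use True in auto)
      qed (use True in simp)
      finally show ?thesis using True by simp
    qed
    finally show ?thesis unfolding r L by simp
  qed
  show "(\<Union>i. {..real i}) = UNIV" using real_arch_simple by auto
  show "emeasure ?L {..real i} \<noteq> \<infinity>" for i unfolding L by simp
qed blast+

lemma nn_integral_N:
  assumes [measurable]: "g \<in> borel_measurable borel"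
  shows "(\<integral>\<^sup>+x. g (N x) \<partial>lborel) = (\<integral>\<^sup>+t. ennreal (ball_vol * Q * t powr (Q - 1)) * indicator {0<..} t * g t \<partial>lborel)"
proof -
  have "(\<integral>\<^sup>+x. g (N x) \<partial>lborel) = (\<integral>\<^sup>+t. g t \<partial>distr lborel borel N)" by (simp add: nn_integral_distr)
  then show ?thesis unfolding distr_N by (simp add: nn_integral_density)
qed

end

section \<open>Hoelder's inequality and the Schur test\<close>

text \<open>Young's inequality twice: \<open>b\<close> and \<open>c\<close> are first merged into
  one weighted mean \<open>w\<close> of total weight \<open>\<beta> + \<gamma>\<close>.\<close>

lemma weighted_am_gm3:
  fixes a b c :: real
  assumes "0 \<le> a" "0 \<le> b" "0 \<le> c" "0 < \<alpha>" "0 < \<beta>" "0 < \<gamma>" "\<alpha> + \<beta> + \<gamma> = 1"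
  shows "a powr \<alpha> * b powr \<beta> * c powr \<gamma> \<le> \<alpha> * a + \<beta> * b + \<gamma> * c"
proof (cases "a = 0 \<or> b = 0 \<or> c = 0")
  case True
  then have "a powr \<alpha> * b powr \<beta> * c powr \<gamma> = 0" by auto
  moreover have "0 \<le> \<alpha> * a + \<beta> * b + \<gamma> * c" using assms by simp
  ultimately show ?thesis by linarith
next
  case False
  then have pos: "a > 0" "b > 0" "c > 0" using assms by auto
  define \<delta> where "\<delta> = \<beta> + \<gamma>"
  have \<delta>: "\<delta> > 0" "\<alpha> + \<delta> = 1" using assms by (auto simp: \<delta>_def)
  define w where "w = b powr (\<beta> / \<delta>) * c powr (\<gamma> / \<delta>)"
  have w: "w > 0" using pos by (simp add: w_def)
  have "\<beta> / \<delta> + \<gamma> / \<delta> = 1" using \<delta> by (simp add: \<delta>_def flip: add_divide_distrib)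
  then have "w \<le> \<beta> / \<delta> * b + \<gamma> / \<delta> * c"
    unfolding w_def using pos \<delta> assms by (intro Youngs_inequality_0) auto
  then have w_le: "\<delta> * w \<le> \<beta> * b + \<gamma> * c" using \<delta> by (simp add: field_simps)
  have "w powr \<delta> = b powr \<beta> * c powr \<gamma>"
    using pos \<delta> by (simp add: w_def powr_mult powr_powr)
  then have "a powr \<alpha> * b powr \<beta> * c powr \<gamma> = a powr \<alpha> * w powr \<delta>" by simp
  also have "\<dots> \<le> \<alpha> * a + \<delta> * w"
    using pos w \<delta> assms by (intro Youngs_inequality_0) auto
  finally show ?thesis using w_le by linarith
qed

text \<open>Normalising each factor by its bound reduces the claim to \<open>weighted_am_gm3\<close>
  under the integral. If some bound is 0, normalisation is impossible, but then that factor vanishes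
  almost everywhere. Real upper bounds in place of the integrals keep the powers within the
  reals.\<close>

lemma nn_integral_Holder3:
  fixes g1 g2 g3 :: "'a \<Rightarrow> real"
  assumes [measurable]: "g1 \<in> borel_measurable M" "g2 \<in> borel_measurable M" "g3 \<in> borel_measurable M"
    and nn: "\<And>x. 0 \<le> g1 x" "\<And>x. 0 \<le> g2 x" "\<And>x. 0 \<le> g3 x"
    and A: "(\<integral>\<^sup>+x. ennreal (g1 x) \<partial>M) \<le> ennreal A1" "(\<integral>\<^sup>+x. ennreal (g2 x) \<partial>M) \<le> ennreal A2"
      "(\<integral>\<^sup>+x. ennreal (g3 x) \<partial>M) \<le> ennreal A3" "0 \<le> A1" "0 \<le> A2" "0 \<le> A3"
    and exps: "0 < \<alpha>" "0 < \<beta>" "0 < \<gamma>" "\<alpha> + \<beta> + \<gamma> = 1"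
  shows "(\<integral>\<^sup>+x. ennreal (g1 x powr \<alpha> * g2 x powr \<beta> * g3 x powr \<gamma>) \<partial>M) \<le> ennreal (A1 powr \<alpha> * A2 powr \<beta> * A3 powr \<gamma>)"
proof (cases "A1 = 0 \<or> A2 = 0 \<or> A3 = 0")
  case True
  have zero: "AE x in M. g x = 0" if "(\<integral>\<^sup>+x. ennreal (g x) \<partial>M) \<le> ennreal 0" "\<And>x. 0 \<le> g x" 
    "g \<in> borel_measurable M" for g :: "'a \<Rightarrow> real"
  proof -
    have "(\<integral>\<^sup>+x. ennreal (g x) \<partial>M) = 0" using that by simp
    then have "AE x in M. ennreal (g x) = 0" using that by (subst (asm) nn_integral_0_iff_AE) auto
    then show ?thesis using that(2) by (auto elim!: eventually_mono simp: ennreal_eq_0_iff intro: order.antisym)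
  qed
  have "AE x in M. g1 x powr \<alpha> * g2 x powr \<beta> * g3 x powr \<gamma> = 0"
  proof -
    consider "A1 = 0" | "A2 = 0" | "A3 = 0" using True by blast
    then show ?thesis
    proof cases
      case 1
      then show ?thesis using zero[of g1] A nn by (auto elim!: eventually_mono)
    next
      case 2
      then show ?thesis using zero[of g2] A nn by (auto elim!: eventually_mono)
    next
      case 3
      then show ?thesis using zero[of g3] A nn by (auto elim!: eventually_mono)
    qed
  qed
  then have "(\<integral>\<^sup>+x. ennreal (g1 x powr \<alpha> * g2 x powr \<beta> * g3 x powr \<gamma>) \<partial>M) = (\<integral>\<^sup>+x. 0 \<partial>M)"
    by (intro nn_integral_cong_AE) (auto elim!: eventually_mono)
  then show ?thesis by simp
next
  case False
  then have pos: "A1 > 0" "A2 > 0" "A3 > 0" using A by auto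
  let ?P = "A1 powr \<alpha> * A2 powr \<beta> * A3 powr \<gamma>"
  have P: "?P \<ge> 0" by simp
  have "g1 x powr \<alpha> * g2 x powr \<beta> * g3 x powr \<gamma> \<le> ?P * (\<alpha> / A1 * g1 x + \<beta> / A2 * g2 x + \<gamma> / A3 * g3 x)" for x
  proof -
    have "(g1 x / A1) powr \<alpha> * (g2 x / A2) powr \<beta> * (g3 x / A3) powr \<gamma> \<le> \<alpha> * (g1 x / A1) + \<beta> * (g2 x / A2) + \<gamma> * (g3 x / A3)"
      using nn[of x] pos exps by (intro weighted_am_gm3) auto
    then have "?P * ((g1 x / A1) powr \<alpha> * (g2 x / A2) powr \<beta> * (g3 x / A3) powr \<gamma>) \<le> ?P * (\<alpha> / A1 * g1 x + \<beta> / A2 * g2 x + \<gamma> / A3 * g3 x)"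
      by (intro mult_left_mono P) simp
    then show ?thesis using pos nn[of x] by (simp add: powr_divide)
  qed
  then have "(\<integral>\<^sup>+x. ennreal (g1 x powr \<alpha> * g2 x powr \<beta> * g3 x powr \<gamma>) \<partial>M) 
     \<le> (\<integral>\<^sup>+x. ennreal (?P * (\<alpha> / A1 * g1 x + \<beta> / A2 * g2 x + \<gamma> / A3 * g3 x)) \<partial>M)"
    by (intro nn_integral_mono ennreal_leI)
  also have "\<dots> = (\<integral>\<^sup>+x. ennreal ?P * (ennreal (\<alpha> / A1) * ennreal (g1 x) + ennreal (\<beta> / A2) * ennreal (g2 x) + ennreal (\<gamma> / A3) * ennreal (g3 x)) \<partial>M)"
    using nn pos exps by (intro nn_integral_cong) (simp flip: ennreal_mult' ennreal_plus)
  also have "\<dots> = ennreal ?P * (ennreal (\<alpha> / A1) * (\<integral>\<^sup>+x. ennreal (g1 x) \<partial>M) + ennreal (\<beta> / A2) * (\<integral>\<^sup>+x. ennreal (g2 x) \<partial>M) + ennreal (\<gamma> / A3) * (\<integral>\<^sup>+x. ennreal (g3 x) \<partial>M))"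
    by (simp add: nn_integral_cmult nn_integral_add)
  also have "\<dots> \<le> ennreal ?P * (ennreal (\<alpha> / A1) * ennreal A1 + ennreal (\<beta> / A2) * ennreal A2 + ennreal (\<gamma> / A3) * ennreal A3)"
    by (intro mult_left_mono add_mono A) auto
  also have "\<dots> = ennreal (?P * (\<alpha> / A1 * A1 + \<beta> / A2 * A2 + \<gamma> / A3 * A3))"
    using pos exps by (simp flip: ennreal_mult' ennreal_plus)
  also have "?P * (\<alpha> / A1 * A1 + \<beta> / A2 * A2 + \<gamma> / A3 * A3) = ?P" using pos exps by simp
  finally show ?thesis .
qed

text \<open>The case of three factors, the first one being split into two equal factors of exponent
  \<open>1 / (2 * p)\<close>.\<close>

lemma nn_integral_Holder:
  fixes f g :: "'a \<Rightarrow> real"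
  assumes [measurable]: "f \<in> borel_measurable M" "g \<in> borel_measurable M"
    and nn: "\<And>x. 0 \<le> f x" "\<And>x. 0 \<le> g x"
    and A: "(\<integral>\<^sup>+x. ennreal (f x powr p) \<partial>M) \<le> ennreal A" "(\<integral>\<^sup>+x. ennreal (g x powr p') \<partial>M) \<le> ennreal B" "0 \<le> A" "0 \<le> B"
    and exps: "0 < p" "0 < p'" "1 / p + 1 / p' = 1"
  shows "(\<integral>\<^sup>+x. ennreal (f x * g x) \<partial>M) \<le> ennreal (A powr (1 / p) * B powr (1 / p'))"
proof -
  have "(\<integral>\<^sup>+x. ennreal ((f x powr p) powr (1 / (2 * p)) * (f x powr p) powr (1 / (2 * p)) * (g x powr p') powr (1 / p')) \<partial>M)
     \<le> ennreal (A powr (1 / (2 * p)) * A powr (1 / (2 * p)) * B powr (1 / p'))"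
    using A exps by (intro nn_integral_Holder3) (auto simp: field_simps)
  moreover have "(f x powr p) powr (1 / (2 * p)) * (f x powr p) powr (1 / (2 * p)) * (g x powr p') powr (1 / p') = f x * g x" for x
    using exps nn[of x] by (simp add: powr_powr flip: powr_add)
  moreover have "A powr (1 / (2 * p)) * A powr (1 / (2 * p)) = A powr (1 / p)"
    using exps by (simp flip: powr_add)
  ultimately show ?thesis by simp
qed

text \<open>Young's factorisation: \<open>k f\<close> is the product of
  \<open>k powr s * f powr p\<close> to the power \<open>1 / q\<close>, \<open>k powr s\<close> to
  the power \<open>1 / p'\<close>, and \<open>f powr p\<close> to the power
  \<open>1 / p - 1 / q\<close>. The exponents add up to 1, and \<open>p < q\<close> makes the last
  one positive. Hoelder's inequality in \<open>y\<close> leaves only the first factor dependent on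
  \<open>x\<close>; its integral \<open>I\<close> is bounded in the mean by Tonelli and the bound in
  the other variable.\<close>

lemma Schur_test:
  fixes k :: "'a \<Rightarrow> 'b \<Rightarrow> real" and f :: "'b \<Rightarrow> real"
  assumes X: "sigma_finite_measure X" and Y: "sigma_finite_measure Y"
    and [measurable]: "case_prod k \<in> borel_measurable (X \<Otimes>\<^sub>M Y)" "f \<in> borel_measurable Y"
    and nn: "\<And>x y. 0 \<le> k x y" "\<And>y. 0 \<le> f y"
    and kY: "\<And>x. (\<integral>\<^sup>+y. ennreal (k x y powr s) \<partial>Y) \<le> ennreal B"
    and kX: "\<And>y. (\<integral>\<^sup>+x. ennreal (k x y powr s) \<partial>X) \<le> ennreal B"
    and fA: "(\<integral>\<^sup>+y. ennreal (f y powr p) \<partial>Y) \<le> ennreal A" and AB: "0 \<le> A" "0 \<le> B"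
    and exps: "1 < p" "p < q" "0 < p'" "0 < s" "1 / p + 1 / p' = 1" "1 / s = 1 / q + 1 / p'"
  shows "AE x in X. (\<integral>\<^sup>+y. ennreal (k x y * f y) \<partial>Y) < \<infinity>"
    and "(\<integral>\<^sup>+x. ennreal (enn2real (\<integral>\<^sup>+y. ennreal (k x y * f y) \<partial>Y) powr q) \<partial>X) \<le> ennreal (B powr (1 + q / p') * A powr (q / p))"
proof -
  interpret sX: sigma_finite_measure X by fact
  interpret sY: sigma_finite_measure Y by fact
  interpret XY: pair_sigma_finite X Y ..
  define I where "I x = (\<integral>\<^sup>+y. ennreal (k x y powr s * f y powr p) \<partial>Y)" for x
  have [measurable]: "I \<in> borel_measurable X" unfolding I_def by measurable
  have "(\<integral>\<^sup>+x. I x \<partial>X) = (\<integral>\<^sup>+y. (\<integral>\<^sup>+x. ennreal (k x y powr s * f y powr p) \<partial>X) \<partial>Y)"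
    unfolding I_def by (rule XY.Fubini'[symmetric]) measurable
  also have "\<dots> = (\<integral>\<^sup>+y. (\<integral>\<^sup>+x. ennreal (k x y powr s) \<partial>X) * ennreal (f y powr p) \<partial>Y)"
  proof (rule nn_integral_cong)
    fix y assume [measurable]: "y \<in> space Y"
    show "(\<integral>\<^sup>+x. ennreal (k x y powr s * f y powr p) \<partial>X) = (\<integral>\<^sup>+x. ennreal (k x y powr s) \<partial>X) * ennreal (f y powr p)"
      by (subst nn_integral_multc[symmetric]) (auto simp: ennreal_mult')
  qed
  also have "\<dots> \<le> (\<integral>\<^sup>+y. ennreal B * ennreal (f y powr p) \<partial>Y)"
    by (intro nn_integral_mono mult_right_mono kX) auto
  also have "\<dots> = ennreal B * (\<integral>\<^sup>+y. ennreal (f y powr p) \<partial>Y)" by (rule nn_integral_cmult) measurable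
  also have "\<dots> \<le> ennreal B * ennreal A" by (intro mult_left_mono fA) auto
  also have "\<dots> = ennreal (B * A)" using AB by (simp add: ennreal_mult')
  finally have I_int: "(\<integral>\<^sup>+x. I x \<partial>X) \<le> ennreal (B * A)" .
  then have "(\<integral>\<^sup>+x. I x \<partial>X) \<noteq> \<infinity>" using ennreal_less_top leD neq_top_trans by fastforce
  from nn_integral_PInf_AE[OF _ this] have fin: "AE x in X. I x \<noteq> \<infinity>" by simp
  have bound: "(\<integral>\<^sup>+y. ennreal (k x y * f y) \<partial>Y) \<le> ennreal (enn2real (I x) powr (1 / q) * B powr (1 / p') * A powr (1 / p - 1 / q))"
    if "I x \<noteq> \<infinity>" and [measurable]: "x \<in> space X" for x
  proof -
    have "(\<integral>\<^sup>+y. ennreal ((k x y powr s * f y powr p) powr (1 / q) * (k x y powr s) powr (1 / p') * (f y powr p) powr (1 / p - 1 / q)) \<partial>Y)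
      \<le> ennreal (enn2real (I x) powr (1 / q) * B powr (1 / p') * A powr (1 / p - 1 / q))"
    proof (rule nn_integral_Holder3)
      show "(\<integral>\<^sup>+y. ennreal (k x y powr s * f y powr p) \<partial>Y) \<le> ennreal (enn2real (I x))"
        using that by (simp add: I_def ennreal_enn2real_if)
      show "1 / p - 1 / q > 0" using exps by (simp add: frac_less2)
    qed (use exps kY fA AB in auto)
    moreover have "(k x y powr s * f y powr p) powr (1 / q) * (k x y powr s) powr (1 / p') * (f y powr p) powr (1 / p - 1 / q) = k x y * f y" for y
    proof -
      have 1: "s * (1 / q) + s * (1 / p') = 1" using exps by (metis distrib_left less_numeral_extra(3) nonzero_mult_div_cancel_left times_divide_eq_right mult.right_neutral)
      have 2: "p * (1 / q) + p * (1 / p - 1 / q) = 1" using exps by (simp add: right_diff_distrib)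
      have "(k x y powr s * f y powr p) powr (1 / q) * (k x y powr s) powr (1 / p') * (f y powr p) powr (1 / p - 1 / q)
         = (k x y powr (s * (1 / q)) * k x y powr (s * (1 / p'))) * (f y powr (p * (1 / q)) * f y powr (p * (1 / p - 1 / q)))"
        by (simp only: powr_mult powr_powr nn powr_ge_zero mult_ac)
      then show ?thesis using nn(1)[of x y] nn(2)[of y] by (simp only: 1 2 flip: powr_add) simp
    qed
    ultimately show ?thesis by simp
  qed
  show "AE x in X. (\<integral>\<^sup>+y. ennreal (k x y * f y) \<partial>Y) < \<infinity>"
    using fin AE_space
  proof eventually_elim
    case (elim x)
    show ?case using bound[OF elim] by (rule order.strict_trans1) simp
  qed
  have "(\<integral>\<^sup>+x. ennreal (enn2real (\<integral>\<^sup>+y. ennreal (k x y * f y) \<partial>Y) powr q) \<partial>X) \<le> 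
     (\<integral>\<^sup>+x. I x * ennreal (B powr (q / p') * A powr (q / p - 1)) \<partial>X)"
  proof (rule nn_integral_mono_AE)
    show "AE x in X. ennreal (enn2real (\<integral>\<^sup>+y. ennreal (k x y * f y) \<partial>Y) powr q) \<le> I x * ennreal (B powr (q / p') * A powr (q / p - 1))"
      using fin AE_space
    proof eventually_elim
      case (elim x)
      have "enn2real (\<integral>\<^sup>+y. ennreal (k x y * f y) \<partial>Y) \<le> enn2real (I x) powr (1 / q) * B powr (1 / p') * A powr (1 / p - 1 / q)"
        using enn2real_mono[OF bound[OF elim]] by simp
      then have "enn2real (\<integral>\<^sup>+y. ennreal (k x y * f y) \<partial>Y) powr q \<le> (enn2real (I x) powr (1 / q) * B powr (1 / p') * A powr (1 / p - 1 / q)) powr q"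
        using exps by (intro powr_mono2) auto
      also have "\<dots> = enn2real (I x) * (B powr (q / p') * A powr (q / p - 1))"
        using exps by (simp add: powr_mult powr_powr left_diff_distrib)
      finally have "ennreal (enn2real (\<integral>\<^sup>+y. ennreal (k x y * f y) \<partial>Y) powr q) \<le> ennreal (enn2real (I x)) * ennreal (B powr (q / p') * A powr (q / p - 1))"
        by (simp add: ennreal_leI flip: ennreal_mult')
      then show ?case using elim by (simp add: ennreal_enn2real_if)
    qed
  qed
  also have "\<dots> = (\<integral>\<^sup>+x. I x \<partial>X) * ennreal (B powr (q / p') * A powr (q / p - 1))" by (rule nn_integral_multc) measurable
  also have "\<dots> \<le> ennreal (B * A) * ennreal (B powr (q / p') * A powr (q / p - 1))"
    by (intro mult_right_mono I_int) auto
  also have "\<dots> = ennreal ((B * B powr (q / p')) * (A * A powr (q / p - 1)))"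
    using AB by (simp add: mult_ac flip: ennreal_mult')
  also have "B * B powr (q / p') = B powr (1 + q / p')" using AB by (simp add: powr_add)
  also have "A * A powr (q / p - 1) = A powr (q / p)" using AB by (cases "A = 0") (simp_all add: powr_diff)
  finally show "(\<integral>\<^sup>+x. ennreal (enn2real (\<integral>\<^sup>+y. ennreal (k x y * f y) \<partial>Y) powr q) \<partial>X) \<le> ennreal (B powr (1 + q / p') * A powr (q / p))" .
qed

section \<open>The weighted convolution estimate\<close>

lemma nn_integral_powr_0:
  fixes \<gamma> R :: real
  assumes "0 < \<gamma>" "0 < R"
  shows "(\<integral>\<^sup>+t. ennreal (t powr (\<gamma> - 1)) * indicator {0<..<R} t \<partial>lborel) = ennreal (R powr \<gamma> / \<gamma>)"
proof -
  have "(\<integral>\<^sup>+t. ennreal (t powr (\<gamma> - 1)) * indicator (einterval 0 (ereal R)) t \<partial>lborel) = ennreal (R powr \<gamma> / \<gamma> - 0)"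
  proof (rule nn_integral_FTC_open[where F = "\<lambda>t. t powr \<gamma> / \<gamma>"])
    fix t assume "0 < ereal t" "ereal t < ereal R"
    then have t: "t > 0" by simp
    show "((\<lambda>t. t powr \<gamma> / \<gamma>) has_real_derivative t powr (\<gamma> - 1)) (at t)"
      using DERIV_cdivide[OF has_real_derivative_powr[OF t, of \<gamma>], of \<gamma>] assms by simp
    show "isCont (\<lambda>t. t powr (\<gamma> - 1)) t" by (intro continuous_intros) (use t in auto)
  next
    have "((\<lambda>t. t powr \<gamma>) \<longlongrightarrow> 0 powr \<gamma>) (at_right 0)"
      by (rule tendsto_powr2[OF tendsto_ident_at tendsto_const]) (use assms in \<open>auto intro!: eventually_at_rightI[of 0 1]\<close>)
    from tendsto_divide[OF this tendsto_const[of \<gamma>]]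
    show "(((\<lambda>t. t powr \<gamma> / \<gamma>) \<circ> real_of_ereal) \<longlongrightarrow> 0) (at_right 0)"
      unfolding zero_ereal_def ereal_tendsto_simps using assms by simp
    show "(((\<lambda>t. t powr \<gamma> / \<gamma>) \<circ> real_of_ereal) \<longlongrightarrow> R powr \<gamma> / \<gamma>) (at_left (ereal R))"
      unfolding ereal_tendsto_simps by (intro tendsto_intros) (use assms in auto)
  qed (use assms in auto)
  moreover have "einterval 0 (ereal R) = {0<..<R}" by (auto simp: einterval_iff)
  ultimately show ?thesis by simp
qed

lemma nn_integral_powr_inf:
  fixes \<delta> R :: real
  assumes "0 < \<delta>" "0 < R"
  shows "(\<integral>\<^sup>+t. ennreal (t powr (- \<delta> - 1)) * indicator {R<..} t \<partial>lborel) = ennreal (R powr - \<delta> / \<delta>)"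
proof -
  have "(\<integral>\<^sup>+t. ennreal (t powr (- \<delta> - 1)) * indicator (einterval (ereal R) \<infinity>) t \<partial>lborel) = ennreal (0 - - (R powr - \<delta> / \<delta>))"
  proof (rule nn_integral_FTC_open[where F = "\<lambda>t. - (t powr - \<delta> / \<delta>)"])
    fix t assume "ereal R < ereal t"
    then have t: "t > 0" using assms by simp
    have "((\<lambda>t. t powr - \<delta> / - \<delta>) has_real_derivative t powr (- \<delta> - 1)) (at t)"
      using DERIV_cdivide[OF has_real_derivative_powr[OF t, of "- \<delta>"], of "- \<delta>"] assms by simp
    then show "((\<lambda>t. - (t powr - \<delta> / \<delta>)) has_real_derivative t powr (- \<delta> - 1)) (at t)" by simp
    show "isCont (\<lambda>t. t powr (- \<delta> - 1)) t" by (intro continuous_intros) (use t in auto)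
  next
    have "((\<lambda>t. t powr - \<delta>) \<longlongrightarrow> 0) at_top"
      by (rule tendsto_neg_powr[OF _ filterlim_ident]) (use assms in auto)
    from tendsto_minus[OF tendsto_divide[OF this tendsto_const[of \<delta>]]]
    show "(((\<lambda>t. - (t powr - \<delta> / \<delta>)) \<circ> real_of_ereal) \<longlongrightarrow> 0) (at_left \<infinity>)"
      unfolding ereal_tendsto_simps using assms by simp
    show "(((\<lambda>t. - (t powr - \<delta> / \<delta>)) \<circ> real_of_ereal) \<longlongrightarrow> - (R powr - \<delta> / \<delta>)) (at_right (ereal R))"
      unfolding ereal_tendsto_simps by (intro tendsto_intros) (use assms in auto)
  qed (use assms in auto)
  moreover have "einterval (ereal R) \<infinity> = {R<..}" by (auto simp: einterval_iff)
  ultimately show ?thesis by simp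
qed

lemma nn_integral_inverse:
  fixes a :: real
  assumes "0 < a" "a < 1"
  shows "(\<integral>\<^sup>+t. ennreal (1 / t) * indicator {a<..<1} t \<partial>lborel) = ennreal (- ln a)"
proof -
  have "(\<integral>\<^sup>+t. ennreal (1 / t) * indicator (einterval (ereal a) (ereal 1)) t \<partial>lborel) = ennreal (ln 1 - ln a)"
  proof (rule nn_integral_FTC_open[where F = ln])
    fix t assume "ereal a < ereal t"
    then have t: "t > 0" using assms by simp
    show "(ln has_real_derivative 1 / t) (at t)" using DERIV_ln_divide[OF t] .
    show "isCont (\<lambda>t. 1 / t) t" by (intro continuous_intros) (use t in auto)
    show "0 \<le> 1 / t" using t by simp
  next
    show "((ln \<circ> real_of_ereal) \<longlongrightarrow> ln a) (at_right (ereal a))" "((ln \<circ> real_of_ereal) \<longlongrightarrow> ln 1) (at_left (ereal 1))"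
      unfolding ereal_tendsto_simps by (intro tendsto_intros; use assms in auto)+
  qed (use assms in auto)
  moreover have "einterval (ereal a) (ereal 1) = {a<..<1}" by (auto simp: einterval_iff)
  ultimately show ?thesis by simp
qed

definition log_weight :: "real \<Rightarrow> real" where "log_weight t = ln (exp 1 + 1 / t)"

lemma log_weight_ge_1: "0 \<le> t \<Longrightarrow> 1 \<le> log_weight t"
  unfolding log_weight_def by (subst ln_ge_iff) (auto intro: add_pos_nonneg)

lemma log_weight_ge_ln: "0 < t \<Longrightarrow> - ln t \<le> log_weight t"
proof -
  assume t: "0 < t"
  have "- ln t = ln (1 / t)" using t by (simp add: ln_div)
  also have "\<dots> \<le> log_weight t" unfolding log_weight_def using t by (intro ln_mono) (auto intro: add_pos_pos)
  finally show ?thesis .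
qed

lemma borel_log_weight [measurable]: "log_weight \<in> borel_measurable borel"
  unfolding log_weight_def by measurable

text \<open>Up to a constant, the integrand is the derivative of \<open>log_weight t powr (1 - \<gamma>)\<close>.\<close>

lemma nn_integral_log_weight:
  fixes \<gamma> :: real
  assumes "1 < \<gamma>"
  shows "(\<integral>\<^sup>+t. ennreal (log_weight t powr - \<gamma> / t) * indicator {0<..<1} t \<partial>lborel) \<le> ennreal ((exp 1 + 1) / (\<gamma> - 1))"
proof -
  \<comment> \<open>The exact derivative carries an additional factor
    \<open>1 / (exp 1 * t + 1)\<close>; removing it on the unit interval costs the constant
    \<open>exp 1 + 1\<close>.\<close>
  define g where "g t = log_weight t powr - \<gamma> / (t * (exp 1 * t + 1))" for t
  define F where "F t = log_weight t powr (1 - \<gamma>) / (\<gamma> - 1)" for t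
  have "(\<integral>\<^sup>+t. ennreal (g t) * indicator (einterval 0 (ereal 1)) t \<partial>lborel) = ennreal (F 1 - 0)"
  proof (rule nn_integral_FTC_open[where F = F])
    fix t assume "0 < ereal t" "ereal t < ereal 1"
    then have t: "t > 0" by simp
    have e: "exp 1 + 1 / t > 0" using t by (simp add: add_pos_pos)
    have L: "log_weight t > 0" using log_weight_ge_1[of t] t by simp
    have "((\<lambda>t. exp 1 + 1 / t) has_real_derivative - 1 / t\<^sup>2) (at t)"
      using t by (auto intro!: derivative_eq_intros simp: power2_eq_square)
    from DERIV_chain2[OF DERIV_ln_divide[OF e] this]
    have "(log_weight has_real_derivative 1 / (exp 1 + 1 / t) * (- 1 / t\<^sup>2)) (at t)"
      unfolding log_weight_def .
    also have "1 / (exp 1 + 1 / t) * (- 1 / t\<^sup>2) = - (1 / (t * (exp 1 * t + 1)))"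
      using t e by (simp add: power2_eq_square divide_simps)
    finally have dL: "(log_weight has_real_derivative - (1 / (t * (exp 1 * t + 1)))) (at t)" .
    have "((\<lambda>t. log_weight t powr (1 - \<gamma>)) has_real_derivative (1 - \<gamma>) * log_weight t powr (1 - \<gamma> - 1) * - (1 / (t * (exp 1 * t + 1)))) (at t)"
      using DERIV_chain2[OF has_real_derivative_powr[OF L, of "1 - \<gamma>"] dL] .
    from DERIV_cdivide[OF this, of "\<gamma> - 1"]
    have "(F has_real_derivative ((1 - \<gamma>) * log_weight t powr (1 - \<gamma> - 1) * - (1 / (t * (exp 1 * t + 1)))) / (\<gamma> - 1)) (at t)"
      unfolding F_def .
    also have "((1 - \<gamma>) * log_weight t powr (1 - \<gamma> - 1) * - (1 / (t * (exp 1 * t + 1)))) / (\<gamma> - 1) = 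
       - ((1 - \<gamma>) / (\<gamma> - 1)) * (log_weight t powr - \<gamma> / (t * (exp 1 * t + 1)))" by simp
    also have "(1 - \<gamma>) / (\<gamma> - 1) = - 1" using assms by (simp add: divide_simps)
    finally show "(F has_real_derivative g t) (at t)" by (simp add: g_def)
    have "isCont log_weight t" using dL by (rule DERIV_isCont)
    then show "isCont g t" unfolding g_def using t L
      by (intro continuous_intros) (auto simp: add_pos_pos less_imp_neq[symmetric] add_nonneg_eq_0_iff)
    show "0 \<le> g t" using t by (simp add: g_def)
  next
    have "filterlim (\<lambda>t. 1 / t :: real) at_top (at_right 0)"
      using filterlim_inverse_at_top_right by (simp add: inverse_eq_divide)
    then have "filterlim (\<lambda>t. exp 1 + 1 / t :: real) at_top (at_right 0)"
      by (intro filterlim_tendsto_add_at_top[OF tendsto_const])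
    then have "filterlim log_weight at_top (at_right 0)"
      unfolding log_weight_def by (rule filterlim_compose[OF ln_at_top])
    then have "((\<lambda>t. log_weight t powr (1 - \<gamma>)) \<longlongrightarrow> 0) (at_right 0)"
      by (intro tendsto_neg_powr) (use assms in auto)
    from tendsto_divide[OF this tendsto_const[of "\<gamma> - 1"]]
    show "((F \<circ> real_of_ereal) \<longlongrightarrow> 0) (at_right 0)"
      unfolding zero_ereal_def ereal_tendsto_simps F_def using assms by simp
    have "isCont F 1"
    proof -
      have 1: "exp 1 + 1 \<noteq> (0::real)" using exp_gt_zero[of "1::real"] by linarith
      have "log_weight 1 \<noteq> 0" using log_weight_ge_1[of 1] by simp
      then have 2: "ln (exp 1 + 1 / 1 :: real) \<noteq> 0" by (simp add: log_weight_def)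
      show ?thesis unfolding F_def log_weight_def using assms 1 2 by (intro continuous_intros) auto
    qed
    then show "((F \<circ> real_of_ereal) \<longlongrightarrow> F 1) (at_left (ereal 1))"
      unfolding ereal_tendsto_simps by (auto simp: isCont_def intro: tendsto_within_subset)
  qed auto
  moreover have "einterval 0 (ereal 1) = {0<..<1}" by (auto simp: einterval_iff)
  ultimately have g: "(\<integral>\<^sup>+t. ennreal (g t) * indicator {0<..<1} t \<partial>lborel) = ennreal (F 1)" by simp
  have [measurable]: "g \<in> borel_measurable borel" unfolding g_def by measurable
  have "(\<integral>\<^sup>+t. ennreal (log_weight t powr - \<gamma> / t) * indicator {0<..<1} t \<partial>lborel) 
     \<le> (\<integral>\<^sup>+t. ennreal (exp 1 + 1) * (ennreal (g t) * indicator {0<..<1} t) \<partial>lborel)"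
  proof (rule nn_integral_mono)
    fix t :: real
    show "ennreal (log_weight t powr - \<gamma> / t) * indicator {0<..<1} t \<le> ennreal (exp 1 + 1) * (ennreal (g t) * indicator {0<..<1} t)"
    proof (cases "0 < t \<and> t < 1")
      case True
      have "log_weight t powr - \<gamma> / t = (exp 1 * t + 1) * g t" using True by (simp add: g_def add_pos_pos less_imp_neq[symmetric])
      also have "\<dots> \<le> (exp 1 + 1) * g t" using True by (intro mult_right_mono) (auto simp: g_def)
      finally have "ennreal (log_weight t powr - \<gamma> / t) \<le> ennreal ((exp 1 + 1) * g t)" by (rule ennreal_leI)
      also have "\<dots> = ennreal (exp 1 + 1) * ennreal (g t)" by (rule ennreal_mult') (simp add: add_nonneg_nonneg)
      finally show ?thesis using True by simp
    qed auto
  qed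
  also have "\<dots> = ennreal (exp 1 + 1) * ennreal (F 1)" by (subst nn_integral_cmult) (simp_all add: g)
  also have "\<dots> \<le> ennreal ((exp 1 + 1) * (1 / (\<gamma> - 1)))"
  proof -
    have "log_weight 1 powr (1 - \<gamma>) \<le> log_weight 1 powr 0" using log_weight_ge_1[of 1] assms by (intro powr_mono) auto
    then have "F 1 \<le> 1 / (\<gamma> - 1)" using log_weight_ge_1[of 1] assms by (simp add: F_def divide_right_mono)
    then have "ennreal ((exp 1 + 1) * F 1) \<le> ennreal ((exp 1 + 1) * (1 / (\<gamma> - 1)))"
      by (intro ennreal_leI mult_left_mono) (auto simp: add_nonneg_nonneg)
    moreover have "ennreal ((exp 1 + 1) * F 1) = ennreal (exp 1 + 1) * ennreal (F 1)"
      by (rule ennreal_mult') (simp add: add_nonneg_nonneg)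
    ultimately show ?thesis by (simp only:)
  qed
  finally show ?thesis by simp
qed

section \<open>The kernel away from and near the diagonal\<close>

context quasi_normed_group
begin

abbreviation c\<^sub>Q :: real where "c\<^sub>Q \<equiv> ball_vol * Q"

lemma c\<^sub>Q_nonneg [simp]: "0 \<le> c\<^sub>Q" using Q_pos by simp

lemma nn_integral_N_powr_ball:
  assumes "\<beta> < Q" "0 \<le> R"
  shows "(\<integral>\<^sup>+z. ennreal (N z powr - \<beta>) * indicator {z. N z \<le> R} z \<partial>lborel) \<le> ennreal (c\<^sub>Q / (Q - \<beta>) * R powr (Q - \<beta>))"
proof -
  have "(\<integral>\<^sup>+z. ennreal (N z powr - \<beta>) * indicator {z. N z \<le> R} z \<partial>lborel) 
     = (\<integral>\<^sup>+z. ennreal (N z powr - \<beta>) * indicator {..R} (N z) \<partial>lborel)"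
    by (intro nn_integral_cong) (auto split: split_indicator)
  also have "\<dots> = (\<integral>\<^sup>+t. ennreal (c\<^sub>Q * t powr (Q - 1)) * indicator {0<..} t * (ennreal (t powr - \<beta>) * indicator {..R} t) \<partial>lborel)"
    by (rule nn_integral_N[of "\<lambda>t. ennreal (t powr - \<beta>) * indicator {..R} t"]) measurable
  also have "\<dots> \<le> (\<integral>\<^sup>+t. ennreal c\<^sub>Q * (ennreal (t powr (Q - \<beta> - 1)) * indicator {0<..<R} t) \<partial>lborel)"
  proof (rule nn_integral_mono_AE, use AE_lborel_singleton[of R] in eventually_elim)
    case (elim t)
    have "Q - 1 + - \<beta> = Q - \<beta> - 1" by simp
    then have "t powr (Q - 1) * t powr - \<beta> = t powr (Q - \<beta> - 1)" by (simp only: flip: powr_add)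
    then have eq: "c\<^sub>Q * t powr (Q - 1) * t powr - \<beta> = c\<^sub>Q * t powr (Q - \<beta> - 1)" by (simp only: mult.assoc)
    show ?case using elim c\<^sub>Q_nonneg by (auto split: split_indicator simp: eq simp flip: ennreal_mult')
  qed
  also have "\<dots> = ennreal c\<^sub>Q * (\<integral>\<^sup>+t. ennreal (t powr (Q - \<beta> - 1)) * indicator {0<..<R} t \<partial>lborel)"
    by (rule nn_integral_cmult) measurable
  also have "\<dots> \<le> ennreal c\<^sub>Q * ennreal (R powr (Q - \<beta>) / (Q - \<beta>))"
  proof (cases "R > 0")
    case True
    then show ?thesis using nn_integral_powr_0[of "Q - \<beta>" R] assms by simp
  qed (use assms in auto)
  also have "\<dots> = ennreal (c\<^sub>Q / (Q - \<beta>) * R powr (Q - \<beta>))"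
    using c\<^sub>Q_nonneg by (simp flip: ennreal_mult')
  finally show ?thesis .
qed

text \<open>For \<open>t > 0\<close> and \<open>p' > 1\<close> this is the smaller of the two powers
  allowed by \<open>kernel_bounds\<close> at \<open>a = Q / p\<close>, where
  \<open>a - Q = - (Q / p')\<close>.\<close>

definition k0 :: "real \<Rightarrow> real \<Rightarrow> real" where
  "k0 p' t = (if t < 1 then t powr (- (Q / p')) else t powr - Q)"

lemma k0_nonneg [simp]: "0 \<le> k0 p' t" by (simp add: k0_def)

lemma borel_k0 [measurable]: "k0 p' \<in> borel_measurable borel"
  unfolding k0_def[abs_def] by measurable

lemma k0_le:
  assumes "1 < p'" "0 \<le> t" shows "k0 p' t \<le> t powr (- (Q / p'))"
proof -
  have "Q / p' \<le> Q" using assms Q_pos by (simp add: divide_le_eq)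
  then show ?thesis using assms by (auto simp: k0_def intro!: powr_mono)
qed

text \<open>The \<open>p'\<close>-th power of the norm in \<open>L^p'\<close> of the majorant
  outside a ball, as it enters Hoelder's inequality.\<close>

definition kernel_tail :: "real \<Rightarrow> real \<Rightarrow> ennreal" where
  "kernel_tail p' R = (\<integral>\<^sup>+z. ennreal (k0 p' (N z) powr p') * indicator {z. N z > R} z \<partial>lborel)"

lemma kernel_tail_polar:
  "kernel_tail p' R = (\<integral>\<^sup>+t. ennreal (c\<^sub>Q * t powr (Q - 1)) * indicator {0<..} t * (ennreal (k0 p' t powr p') * indicator {R<..} t) \<partial>lborel)"
proof -
  have "kernel_tail p' R = (\<integral>\<^sup>+z. ennreal (k0 p' (N z) powr p') * indicator {R<..} (N z) \<partial>lborel)"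
    unfolding kernel_tail_def by (intro nn_integral_cong) (auto split: split_indicator)
  also have "\<dots> = (\<integral>\<^sup>+t. ennreal (c\<^sub>Q * t powr (Q - 1)) * indicator {0<..} t * (ennreal (k0 p' t powr p') * indicator {R<..} t) \<partial>lborel)"
    by (rule nn_integral_N[of "\<lambda>t. ennreal (k0 p' t powr p') * indicator {R<..} t"]) measurable
  finally show ?thesis .
qed

text \<open>The power \<open>t powr - Q\<close> dominates both branches of \<open>k0\<close>, so the
  bound holds for every positive radius. This matters for radii \<open>\<epsilon> * t\<close> with
  \<open>t \<ge> 1\<close>, which may lie below 1.\<close>

lemma kernel_tail_large:
  assumes "1 < p'" "0 < R"
  shows "kernel_tail p' R \<le> ennreal (c\<^sub>Q * (R powr - (Q * (p' - 1)) / (Q * (p' - 1))))"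
proof -
  have "kernel_tail p' R \<le> (\<integral>\<^sup>+t. ennreal c\<^sub>Q * (ennreal (t powr (- (Q * (p' - 1)) - 1)) * indicator {R<..} t) \<partial>lborel)"
    unfolding kernel_tail_polar
  proof (rule nn_integral_mono)
    fix t :: real
    show "ennreal (c\<^sub>Q * t powr (Q - 1)) * indicator {0<..} t * (ennreal (k0 p' t powr p') * indicator {R<..} t)
       \<le> ennreal c\<^sub>Q * (ennreal (t powr (- (Q * (p' - 1)) - 1)) * indicator {R<..} t)"
    proof (cases "R < t")
      case True
      then have t: "t > 0" using assms by simp
      have "k0 p' t \<le> t powr - Q"
      proof (cases "t < 1")
        case True
        have "- Q \<le> - (Q / p')" using assms Q_pos by (simp add: divide_le_eq)
        then have "t powr (- (Q / p')) \<le> t powr - Q" using t True by (intro powr_mono') auto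
        then show ?thesis using True by (simp add: k0_def)
      qed (simp add: k0_def)
      then have "k0 p' t powr p' \<le> (t powr - Q) powr p'" using assms by (intro powr_mono2) auto
      then have "c\<^sub>Q * t powr (Q - 1) * k0 p' t powr p' \<le> c\<^sub>Q * t powr (Q - 1) * t powr (- Q * p')"
        by (intro mult_left_mono) (auto simp: powr_powr)
      also have "\<dots> = c\<^sub>Q * (t powr (Q - 1) * t powr (- Q * p'))" by simp
      also have "t powr (Q - 1) * t powr (- Q * p') = t powr (- (Q * (p' - 1)) - 1)"
        by (simp add: algebra_simps flip: powr_add)
      finally have "c\<^sub>Q * t powr (Q - 1) * k0 p' t powr p' \<le> c\<^sub>Q * t powr (- (Q * (p' - 1)) - 1)" .
      then show ?thesis using True t c\<^sub>Q_nonneg by (simp add: ennreal_leI flip: ennreal_mult')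
    qed simp
  qed
  also have "\<dots> = ennreal c\<^sub>Q * (\<integral>\<^sup>+t. ennreal (t powr (- (Q * (p' - 1)) - 1)) * indicator {R<..} t \<partial>lborel)"
    by (rule nn_integral_cmult) measurable
  also have "(\<integral>\<^sup>+t. ennreal (t powr (- (Q * (p' - 1)) - 1)) * indicator {R<..} t \<partial>lborel)
      = ennreal (R powr - (Q * (p' - 1)) / (Q * (p' - 1)))"
    using assms Q_pos by (intro nn_integral_powr_inf) auto
  finally show ?thesis using c\<^sub>Q_nonneg by (simp flip: ennreal_mult')
qed

text \<open>Below 1 the exponent is critical: \<open>t powr (Q - 1)\<close> times the
  \<open>p'\<close>-th power of \<open>k0\<close> is exactly \<open>1 / t\<close>. Its integral from
  \<open>R\<close> to 1 is the source of the logarithm in the theorem.\<close>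

lemma kernel_tail_small:
  assumes "1 < p'" "0 < R" "R < 1"
  shows "kernel_tail p' R \<le> ennreal (c\<^sub>Q * (- ln R + 1 / (Q * (p' - 1))))"
proof -
  have "kernel_tail p' R \<le> (\<integral>\<^sup>+t. ennreal c\<^sub>Q * (ennreal (1 / t) * indicator {R<..<1} t) 
       + ennreal (c\<^sub>Q * t powr (Q - 1)) * indicator {0<..} t * (ennreal (k0 p' t powr p') * indicator {1<..} t) \<partial>lborel)"
    unfolding kernel_tail_polar
  proof (rule nn_integral_mono_AE, use AE_lborel_singleton[of 1] in eventually_elim)
    case (elim t)
    have "c\<^sub>Q * t powr (Q - 1) * k0 p' t powr p' = c\<^sub>Q * (1 / t)" if "0 < t" "t < 1"
    proof -
      have "t powr (Q - 1) * k0 p' t powr p' = t powr - 1"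
        using that assms by (simp add: k0_def powr_powr flip: powr_add)
      then show ?thesis using that by (simp only: mult.assoc) (simp add: powr_minus_divide)
    qed
    then show ?case using elim assms c\<^sub>Q_nonneg by (auto split: split_indicator simp flip: ennreal_mult')
  qed
  also have "\<dots> = ennreal c\<^sub>Q * (\<integral>\<^sup>+t. ennreal (1 / t) * indicator {R<..<1} t \<partial>lborel) + kernel_tail p' 1"
    unfolding kernel_tail_polar by (subst nn_integral_add) (simp_all add: nn_integral_cmult)
  also have "\<dots> \<le> ennreal c\<^sub>Q * ennreal (- ln R) + ennreal (c\<^sub>Q * (1 powr - (Q * (p' - 1)) / (Q * (p' - 1))))"
    using nn_integral_inverse[of R] kernel_tail_large[of p' 1] assms by (intro add_mono) auto
  also have "\<dots> = ennreal (c\<^sub>Q * (- ln R + 1 / (Q * (p' - 1))))"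
  proof -
    have nn: "0 \<le> c\<^sub>Q * - ln R" "0 \<le> c\<^sub>Q * (1 / (Q * (p' - 1)))"
      using assms Q_pos by (intro mult_nonneg_nonneg c\<^sub>Q_nonneg; simp)+
    show ?thesis
      by (simp only: powr_one_eq_one ennreal_mult'[OF c\<^sub>Q_nonneg, symmetric] ennreal_plus[OF nn, symmetric] distrib_left)
  qed
  finally show ?thesis .
qed


text \<open>The two arguments are inverse to each other. Rewriting one as the other lets left
  invariance handle integrals in either variable.\<close>

lemma N_mul_uminus_swap: "N (mul (- y) x) = N (mul (- x) y)"
proof -
  have "mul (- x) y = - mul (- y) x"
    using inverse_distrib_swap[of "- y" x] by (simp add: ginv_eq_uminus)
  then show ?thesis by simp
qed

lemma borel_mul_pair [measurable]: "(\<lambda>z. mul (fst z) (snd z)) \<in> borel_measurable (borel \<Otimes>\<^sub>M borel)"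
  using mul_continuous by (simp add: borel_prod case_prod_unfold borel_measurable_continuous_onI)

lemma borel_uminus_mul [measurable]: "(\<lambda>z. mul (- snd z) (fst z)) \<in> borel_measurable (borel \<Otimes>\<^sub>M borel)"
  by (rule measurable_compose[OF _ borel_mul_pair, where f = "\<lambda>z. (- snd z, fst z)", simplified]) measurable

text \<open>The part of the convolution kernel near the diagonal, with the power of the weight in it. Its
  homogeneity makes it satisfy the hypothesis of the Schur test exactly for \<open>1 / s = 1 / q + 1 / p'\<close>.\<close>

definition near_kernel :: "real \<Rightarrow> real \<Rightarrow> real \<Rightarrow> real ^ 'n \<Rightarrow> real ^ 'n \<Rightarrow> real" where
  "near_kernel \<epsilon> q p' x y = (if N (mul (- y) x) \<le> \<epsilon> * N x then N x powr (- (Q / q)) * N (mul (- y) x) powr (- (Q / p')) else 0)"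

lemma near_kernel_nonneg: "0 \<le> near_kernel \<epsilon> q p' x y"
  by (simp add: near_kernel_def)

lemma borel_near_kernel: "case_prod (near_kernel \<epsilon> q p') \<in> borel_measurable (borel \<Otimes>\<^sub>M borel)"
  unfolding near_kernel_def case_prod_unfold by measurable

text \<open>The \<open>s\<close>-th power of the kernel is
  \<open>N x powr - \<delta> * N z powr - \<beta>\<close> with \<open>z = mul (- y) x\<close> and
  \<open>\<beta> + \<delta> = Q\<close>. Over a ball of radius \<open>R\<close> the second factor
  integrates to a multiple of \<open>R powr \<delta>\<close>, which the first one cancels. For fixed
  \<open>x\<close> this is immediate; for fixed \<open>y\<close> the first factor depends on the
  variable of integration, and \<open>N x\<close> must be exchanged for \<open>N y\<close>.\<close>

lemma near_kernel_bounds: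
  assumes \<kappa>: "1 \<le> \<kappa>" "\<And>x y. N (mul x y) \<le> \<kappa> * (N x + N y)"
    and exps: "0 < q" "0 < p'" "0 < s" "1 / s = 1 / q + 1 / p'"
  defines "\<epsilon> \<equiv> 1 / (2 * \<kappa>)" and "B \<equiv> c\<^sub>Q / (Q * s / q) * (2 * \<kappa>) powr (Q * s / q)"
  shows "(\<integral>\<^sup>+y. ennreal (near_kernel \<epsilon> q p' x y powr s) \<partial>lborel) \<le> ennreal B" (is ?Y)
    and "(\<integral>\<^sup>+x. ennreal (near_kernel \<epsilon> q p' x y powr s) \<partial>lborel) \<le> ennreal B" (is ?X)
proof -
  define \<delta> where "\<delta> = Q * s / q"
  define \<beta> where "\<beta> = Q * s / p'"
  have "s * (1 / q + 1 / p') = 1" using exps(3) by (simp flip: exps(4))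
  then have "s / q + s / p' = 1" by (simp add: distrib_left)
  then have "Q * (s / q + s / p') = Q" by simp
  then have \<delta>\<beta>: "Q - \<beta> = \<delta>" by (simp add: \<delta>_def \<beta>_def algebra_simps)
  have "\<delta> > 0" using exps Q_pos by (simp add: \<delta>_def)
  with \<delta>\<beta> have \<delta>: "\<delta> > 0" "\<beta> < Q" by simp_all
  have B: "B = c\<^sub>Q / \<delta> * (2 * \<kappa>) powr \<delta>" by (simp add: B_def \<delta>_def)
  have \<epsilon>: "0 < \<epsilon>" "\<epsilon> \<le> 1" "\<kappa> * \<epsilon> = 1 / 2" using \<kappa> by (auto simp: \<epsilon>_def divide_simps)
  have pow: "near_kernel \<epsilon> q p' x y powr s = (if N (mul (- y) x) \<le> \<epsilon> * N x then N x powr - \<delta> * N (mul (- y) x) powr - \<beta> else 0)" for x y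
    using exps by (simp add: near_kernel_def powr_mult powr_powr \<delta>_def \<beta>_def)
  \<comment> \<open>At \<open>N w = 0\<close> the left-hand side is 0, as
    \<open>0 powr _ = 0\<close>.\<close>
  have scale: "N w powr - \<delta> * (c\<^sub>Q / \<delta> * N w powr \<delta>) \<le> c\<^sub>Q / \<delta>" for w
  proof (cases "N w = 0")
    case False
    then have "N w powr - \<delta> * N w powr \<delta> = 1" by (simp flip: powr_add)
    then show ?thesis by (simp add: mult.left_commute)
  qed (use c\<^sub>Q_nonneg \<delta> in simp)
  show ?Y
  proof -
    have "(\<integral>\<^sup>+y. ennreal (near_kernel \<epsilon> q p' x y powr s) \<partial>lborel) \<le> 
       (\<integral>\<^sup>+y. ennreal (N x powr - \<delta>) * (ennreal (N (mul (- x) y) powr - \<beta>) * indicator {z. N z \<le> N x} (mul (- x) y)) \<partial>lborel)"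
    proof (rule nn_integral_mono)
      fix y
      have "\<epsilon> * N x \<le> 1 * N x" using \<epsilon> by (intro mult_right_mono) auto
      then show "ennreal (near_kernel \<epsilon> q p' x y powr s) \<le> ennreal (N x powr - \<delta>) * (ennreal (N (mul (- x) y) powr - \<beta>) * indicator {z. N z \<le> N x} (mul (- x) y))"
        unfolding pow N_mul_uminus_swap[of y x] by (auto split: split_indicator simp: ennreal_mult')
    qed
    also have "\<dots> = ennreal (N x powr - \<delta>) * (\<integral>\<^sup>+y. (ennreal (N (mul (- x) y) powr - \<beta>) * indicator {z. N z \<le> N x} (mul (- x) y)) \<partial>lborel)"
      by (rule nn_integral_cmult) measurable
    also have "(\<integral>\<^sup>+y. (ennreal (N (mul (- x) y) powr - \<beta>) * indicator {z. N z \<le> N x} (mul (- x) y)) \<partial>lborel)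
      = (\<integral>\<^sup>+z. ennreal (N z powr - \<beta>) * indicator {z. N z \<le> N x} z \<partial>lborel)"
      by (rule nn_integral_mul_left[of "\<lambda>z. ennreal (N z powr - \<beta>) * indicator {z. N z \<le> N x} z"]) measurable
    also have "ennreal (N x powr - \<delta>) * \<dots> \<le> ennreal (N x powr - \<delta>) * ennreal (c\<^sub>Q / \<delta> * N x powr \<delta>)"
      using nn_integral_N_powr_ball[of \<beta> "N x"] \<delta> by (intro mult_left_mono) (simp_all add: \<delta>\<beta>)
    also have "\<dots> = ennreal (N x powr - \<delta> * (c\<^sub>Q / \<delta> * N x powr \<delta>))" by (rule ennreal_mult'[symmetric]) simp
    also have "\<dots> \<le> ennreal (c\<^sub>Q / \<delta> * 1)" using scale by (simp add: ennreal_leI)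
    also have "\<dots> \<le> ennreal B" unfolding B
      using \<kappa> \<delta> c\<^sub>Q_nonneg by (intro ennreal_leI mult_left_mono ge_one_powr_ge_zero) auto
    finally show ?thesis .
  qed
  show ?X
  proof -
    have "(\<integral>\<^sup>+x. ennreal (near_kernel \<epsilon> q p' x y powr s) \<partial>lborel) \<le> 
       (\<integral>\<^sup>+x. ennreal ((2 * \<kappa>) powr \<delta> * N y powr - \<delta>) * (ennreal (N (mul (- y) x) powr - \<beta>) * indicator {z. N z \<le> N y} (mul (- y) x)) \<partial>lborel)"
    proof (rule nn_integral_mono)
      fix x
      show "ennreal (near_kernel \<epsilon> q p' x y powr s) \<le> ennreal ((2 * \<kappa>) powr \<delta> * N y powr - \<delta>) * (ennreal (N (mul (- y) x) powr - \<beta>) * indicator {z. N z \<le> N y} (mul (- y) x))"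
      proof (cases "N (mul (- y) x) \<le> \<epsilon> * N x \<and> x \<noteq> 0")
        case False
        then show ?thesis by (auto simp: pow)
      next
        case True
        define z where "z = mul (- y) x"
        have z: "N z \<le> \<epsilon> * N x" using True by (simp add: z_def)
        have x: "N x > 0" using True N_pos by simp
        have "N x = N (mul y z)" by (simp add: z_def)
        also have "\<dots> \<le> \<kappa> * (N y + N z)" by (rule \<kappa>)
        also have "\<dots> \<le> \<kappa> * (N y + \<epsilon> * N x)" using z \<kappa> by (intro mult_left_mono) auto
        also have "\<dots> = \<kappa> * N y + N x / 2" using \<epsilon>(3) by (simp add: distrib_left flip: mult.assoc)
        finally have 1: "N x \<le> 2 * \<kappa> * N y" by simp
        then have y: "N y > 0" using x \<kappa> by (smt (verit) N_nonneg mult_eq_0_iff)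
        have "N z \<le> \<epsilon> * (2 * \<kappa> * N y)" using z 1 \<epsilon>(1) by (meson mult_left_mono less_imp_le order.trans)
        also have "\<dots> = N y" using \<epsilon>(3) by (simp add: mult_ac)
        finally have zy: "N z \<le> N y" .
        have "N (- z) = N z" by simp
        \<comment> \<open>The reverse comparison \<open>N y \<le> 2 * \<kappa> * N x\<close> is what
          replaces \<open>N x powr - \<delta>\<close> by a power of \<open>N y\<close>; it is the
          origin of the factor \<open>(2 * \<kappa>) powr \<delta>\<close> in
          \<open>B\<close>.\<close>
        have "mul x (- z) = y" 
          using inverse_distrib_swap[of "- y" x] by (simp add: z_def flip: ginv_eq_uminus assoc)
        then have "N y \<le> \<kappa> * (N x + N z)" using \<kappa>(2)[of x "- z"] by simp
        also have "\<dots> \<le> \<kappa> * (N x + 1 * N x)" using z \<epsilon>(2) \<kappa>(1) by (intro mult_left_mono add_left_mono order.trans[OF z] mult_right_mono) auto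
        finally have "N y / (2 * \<kappa>) \<le> N x" using \<kappa> by (simp add: divide_le_eq mult_ac)
        then have "N x powr - \<delta> \<le> (N y / (2 * \<kappa>)) powr - \<delta>"
          using y \<kappa> \<delta> by (intro powr_mono2') auto
        also have "\<dots> = (2 * \<kappa>) powr \<delta> * N y powr - \<delta>"
          using y \<kappa> by (simp add: powr_divide powr_minus_divide)
        finally have "N x powr - \<delta> * N z powr - \<beta> \<le> (2 * \<kappa>) powr \<delta> * N y powr - \<delta> * N z powr - \<beta>"
          by (intro mult_right_mono) auto
        then show ?thesis using zy z unfolding pow z_def[symmetric] by (simp add: ennreal_leI flip: ennreal_mult')
      qed
    qed
    also have "\<dots> = ennreal ((2 * \<kappa>) powr \<delta> * N y powr - \<delta>) * (\<integral>\<^sup>+x. (ennreal (N (mul (- y) x) powr - \<beta>) * indicator {z. N z \<le> N y} (mul (- y) x)) \<partial>lborel)"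
      by (rule nn_integral_cmult) measurable
    also have "(\<integral>\<^sup>+x. (ennreal (N (mul (- y) x) powr - \<beta>) * indicator {z. N z \<le> N y} (mul (- y) x)) \<partial>lborel)
      = (\<integral>\<^sup>+z. ennreal (N z powr - \<beta>) * indicator {z. N z \<le> N y} z \<partial>lborel)"
      by (rule nn_integral_mul_left[of "\<lambda>z. ennreal (N z powr - \<beta>) * indicator {z. N z \<le> N y} z"]) measurable
    also have "ennreal ((2 * \<kappa>) powr \<delta> * N y powr - \<delta>) * \<dots> \<le> ennreal ((2 * \<kappa>) powr \<delta> * N y powr - \<delta>) * ennreal (c\<^sub>Q / \<delta> * N y powr \<delta>)"
      using nn_integral_N_powr_ball[of \<beta> "N y"] \<delta> by (intro mult_left_mono) (simp_all add: \<delta>\<beta>)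
    also have "\<dots> = ennreal ((2 * \<kappa>) powr \<delta> * (N y powr - \<delta> * (c\<^sub>Q / \<delta> * N y powr \<delta>)))" 
      by (subst ennreal_mult'[symmetric]) (simp_all add: mult_ac)
    also have "\<dots> \<le> ennreal ((2 * \<kappa>) powr \<delta> * (c\<^sub>Q / \<delta>))" using scale by (intro ennreal_leI mult_left_mono) auto
    also have "\<dots> = ennreal B" by (simp add: B mult.commute)
    finally show ?thesis .
  qed
qed

text \<open>For \<open>t < 1\<close> the additive constants of \<open>kernel_tail_small\<close> are
  absorbed by \<open>log_weight t \<ge> 1\<close>. The result is a pure multiple of
  \<open>log_weight t\<close>, whose power \<open>q / p'\<close> can be merged with the power
  \<open>- r\<close> of the weight.\<close>

definition tail_bound :: "real \<Rightarrow> real \<Rightarrow> real \<Rightarrow> real" where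
  "tail_bound \<epsilon> p' t = (if t < 1 then c\<^sub>Q * (- ln \<epsilon> + 1 + 1 / (Q * (p' - 1))) * log_weight t
     else c\<^sub>Q * \<epsilon> powr - (Q * (p' - 1)) / (Q * (p' - 1)) * t powr - (Q * (p' - 1)))"

lemma borel_tail_bound [measurable]: "tail_bound \<epsilon> p' \<in> borel_measurable borel"
  unfolding tail_bound_def[abs_def] by measurable

lemma tail_bound_nonneg:
  assumes "1 < p'" "0 < \<epsilon>" "\<epsilon> < 1" "0 \<le> t"
  shows "0 \<le> tail_bound \<epsilon> p' t"
proof -
  have "0 \<le> - ln \<epsilon>" using assms by simp
  then have "0 \<le> - ln \<epsilon> + 1 + 1 / (Q * (p' - 1))" using assms Q_pos by (intro add_nonneg_nonneg) auto
  moreover have "0 \<le> log_weight t" using log_weight_ge_1[OF assms(4)] by simp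
  ultimately show ?thesis
    unfolding tail_bound_def using assms Q_pos c\<^sub>Q_nonneg
    by (auto intro!: mult_nonneg_nonneg[OF mult_nonneg_nonneg] divide_nonneg_nonneg mult_nonneg_nonneg)
qed

lemma kernel_tail_le:
  assumes p': "1 < p'" and \<epsilon>: "0 < \<epsilon>" "\<epsilon> < 1" and t: "0 < t"
  shows "kernel_tail p' (\<epsilon> * t) \<le> ennreal (tail_bound \<epsilon> p' t)"
proof (cases "t < 1")
  case True
  let ?d = "1 / (Q * (p' - 1))"
  have d: "?d \<ge> 0" using p' Q_pos by simp
  have l: "ln \<epsilon> \<le> 0" using \<epsilon> by simp
  have "\<epsilon> * t < 1 * 1" using True \<epsilon> t by (intro mult_strict_mono) auto
  then have "kernel_tail p' (\<epsilon> * t) \<le> ennreal (c\<^sub>Q * (- ln (\<epsilon> * t) + ?d))"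
    using p' \<epsilon> t by (intro kernel_tail_small) auto
  also have "- ln (\<epsilon> * t) + ?d \<le> (- ln \<epsilon> + 1 + ?d) * log_weight t"
  proof -
    have "- ln (\<epsilon> * t) + ?d = (- ln \<epsilon>) * 1 + - ln t + ?d * 1" using \<epsilon> t by (simp add: ln_mult)
    also have "\<dots> \<le> (- ln \<epsilon>) * log_weight t + log_weight t + ?d * log_weight t"
      using l d log_weight_ge_1[of t] log_weight_ge_ln[OF t] t by (intro add_mono mult_left_mono) auto
    finally show ?thesis by (simp add: algebra_simps)
  qed
  then have "ennreal (c\<^sub>Q * (- ln (\<epsilon> * t) + ?d)) \<le> ennreal (c\<^sub>Q * ((- ln \<epsilon> + 1 + ?d) * log_weight t))"
    by (intro ennreal_leI mult_left_mono c\<^sub>Q_nonneg)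
  finally show ?thesis using True by (simp add: tail_bound_def mult.assoc)
next
  case False
  have "kernel_tail p' (\<epsilon> * t) \<le> ennreal (c\<^sub>Q * ((\<epsilon> * t) powr - (Q * (p' - 1)) / (Q * (p' - 1))))"
    using p' \<epsilon> t by (intro kernel_tail_large) auto
  also have "c\<^sub>Q * ((\<epsilon> * t) powr - (Q * (p' - 1)) / (Q * (p' - 1))) = tail_bound \<epsilon> p' t"
    using False \<epsilon> t by (simp add: tail_bound_def powr_mult)
  finally show ?thesis .
qed

text \<open>In polar coordinates the factor \<open>t powr - Q\<close> turns the density into a
  multiple of \<open>1 / t\<close>. Near 0 there remains
  \<open>log_weight t powr - \<gamma>\<close>, and \<open>\<gamma> > 1\<close> is the hypothesis on
  \<open>q\<close>; at infinity the decay \<open>t powr - \<delta>\<close> of the tail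
  suffices.\<close>

lemma tail_bound_integral:
  assumes p': "1 < p'" and \<epsilon>: "0 < \<epsilon>" "\<epsilon> < 1" and q: "0 < q" "q < (r - 1) * p'"
  shows "\<exists>C\<ge>0. (\<integral>\<^sup>+x. ennreal (N x powr - Q * log_weight (N x) powr - r * tail_bound \<epsilon> p' (N x) powr (q / p')) \<partial>lborel) \<le> ennreal C"
proof -
  define C3 where "C3 = c\<^sub>Q * (- ln \<epsilon> + 1 + 1 / (Q * (p' - 1)))"
  define C4 where "C4 = c\<^sub>Q * \<epsilon> powr - (Q * (p' - 1)) / (Q * (p' - 1))"
  define \<gamma> where "\<gamma> = r - q / p'"
  define \<delta> where "\<delta> = Q * (p' - 1) * (q / p')"
  have \<gamma>: "\<gamma> > 1" using p' q by (simp add: \<gamma>_def field_simps)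
  have \<delta>: "\<delta> > 0" using p' q Q_pos by (simp add: \<delta>_def)
  have r: "r > 0" using \<gamma> p' q by (simp add: \<gamma>_def) (smt (verit) divide_pos_pos)
  have C3: "C3 \<ge> 0" using tail_bound_nonneg[OF p' \<epsilon>, of 0] \<epsilon> p' Q_pos c\<^sub>Q_nonneg
    unfolding C3_def by (intro mult_nonneg_nonneg add_nonneg_nonneg) auto
  have C4: "C4 \<ge> 0" using p' Q_pos c\<^sub>Q_nonneg unfolding C4_def by (intro divide_nonneg_nonneg mult_nonneg_nonneg) auto
  let ?g = "\<lambda>t. t powr - Q * log_weight t powr - r * tail_bound \<epsilon> p' t powr (q / p')"
  have "(\<integral>\<^sup>+x. ennreal (?g (N x)) \<partial>lborel) = (\<integral>\<^sup>+t. ennreal (c\<^sub>Q * t powr (Q - 1)) * indicator {0<..} t * ennreal (?g t) \<partial>lborel)"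
    by (rule nn_integral_N[of "\<lambda>t. ennreal (?g t)"]) measurable
  also have "\<dots> \<le> (\<integral>\<^sup>+t. ennreal (c\<^sub>Q * C3 powr (q / p')) * (ennreal (log_weight t powr - \<gamma> / t) * indicator {0<..<1} t) 
      + ennreal (c\<^sub>Q * C4 powr (q / p')) * (ennreal (t powr (- \<delta> - 1)) * indicator {1<..} t) \<partial>lborel)"
  proof (rule nn_integral_mono_AE, use AE_lborel_singleton[of 1] in eventually_elim)
    case (elim t)
    show ?case
    proof (cases "0 < t")
      case True
      have L: "log_weight t \<ge> 1" using True by (intro log_weight_ge_1) auto
      have "t powr (Q - 1) * t powr - Q = t powr - 1" by (simp flip: powr_add)
      then have tt: "t powr (Q - 1) * t powr - Q = 1 / t" using True by (simp add: powr_minus_divide)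
      have split: "c\<^sub>Q * t powr (Q - 1) * ?g t = c\<^sub>Q * (t powr (Q - 1) * t powr - Q) * (log_weight t powr - r * tail_bound \<epsilon> p' t powr (q / p'))"
        by (simp only: mult_ac)
      show ?thesis
      proof (cases "t < 1")
        case t1: True
        have "tail_bound \<epsilon> p' t = C3 * log_weight t" using t1 by (simp add: tail_bound_def C3_def)
        then have "tail_bound \<epsilon> p' t powr (q / p') = C3 powr (q / p') * log_weight t powr (q / p')"
          using L C3 by (simp add: powr_mult)
        moreover have "log_weight t powr - r * log_weight t powr (q / p') = log_weight t powr - \<gamma>"
          by (simp add: \<gamma>_def flip: powr_add)
        ultimately have "log_weight t powr - r * tail_bound \<epsilon> p' t powr (q / p') = C3 powr (q / p') * log_weight t powr - \<gamma>"
          by (metis mult.left_commute)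
        then have "c\<^sub>Q * t powr (Q - 1) * ?g t = c\<^sub>Q * C3 powr (q / p') * (log_weight t powr - \<gamma> / t)"
          unfolding split tt by simp
        then show ?thesis using t1 True c\<^sub>Q_nonneg by (simp flip: ennreal_mult')
      next
        case False
        then have t1: "1 < t" using elim by simp
        have "tail_bound \<epsilon> p' t = C4 * t powr - (Q * (p' - 1))" using t1 by (simp add: tail_bound_def C4_def)
        then have "tail_bound \<epsilon> p' t powr (q / p') = C4 powr (q / p') * t powr - \<delta>"
          using C4 by (simp add: powr_mult powr_powr \<delta>_def)
        moreover have "log_weight t powr - r \<le> 1 powr - r"
          using L r by (intro powr_mono2') auto
        ultimately have "log_weight t powr - r * tail_bound \<epsilon> p' t powr (q / p') \<le> 1 * (C4 powr (q / p') * t powr - \<delta>)"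
          by (metis mult_right_mono powr_ge_zero powr_one_eq_one)
        then have "c\<^sub>Q * t powr (Q - 1) * ?g t \<le> c\<^sub>Q * (1 / t) * (1 * (C4 powr (q / p') * t powr - \<delta>))"
          unfolding split tt using t1 c\<^sub>Q_nonneg by (intro mult_left_mono) auto
        also have "\<dots> = c\<^sub>Q * C4 powr (q / p') * (t powr - \<delta> * t powr - 1)" using t1 by (simp add: powr_minus_divide)
        also have "t powr - \<delta> * t powr - 1 = t powr (- \<delta> - 1)" by (simp only: diff_conv_add_uminus powr_add)
        finally show ?thesis using t1 True c\<^sub>Q_nonneg by (simp add: ennreal_leI flip: ennreal_mult')
      qed
    qed simp
  qed
  also have "\<dots> = ennreal (c\<^sub>Q * C3 powr (q / p')) * (\<integral>\<^sup>+t. ennreal (log_weight t powr - \<gamma> / t) * indicator {0<..<1} t \<partial>lborel)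
      + ennreal (c\<^sub>Q * C4 powr (q / p')) * (\<integral>\<^sup>+t. ennreal (t powr (- \<delta> - 1)) * indicator {1<..} t \<partial>lborel)"
    by (subst nn_integral_add) (simp_all add: nn_integral_cmult)
  also have "\<dots> \<le> ennreal (c\<^sub>Q * C3 powr (q / p')) * ennreal ((exp 1 + 1) / (\<gamma> - 1)) + ennreal (c\<^sub>Q * C4 powr (q / p')) * ennreal (1 powr - \<delta> / \<delta>)"
    by (intro add_mono mult_left_mono nn_integral_log_weight[OF \<gamma>] eq_refl[OF nn_integral_powr_inf[OF \<delta>]]) auto
  also have "\<dots> = ennreal (c\<^sub>Q * C3 powr (q / p') * ((exp 1 + 1) / (\<gamma> - 1)) + c\<^sub>Q * C4 powr (q / p') * (1 powr - \<delta> / \<delta>))"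
    (is "_ = ennreal ?C")
  proof -
    have gen: "ennreal a * ennreal b + ennreal c * ennreal d = ennreal (a * b + c * d)"
      if "0 \<le> a" "0 \<le> b" "0 \<le> c" "0 \<le> d" for a b c d
      using that by (simp flip: ennreal_mult' ennreal_plus)
    show ?thesis using \<gamma> \<delta> by (intro gen mult_nonneg_nonneg c\<^sub>Q_nonneg) (auto simp: add_nonneg_nonneg)
  qed
  finally show ?thesis using c\<^sub>Q_nonneg \<gamma> \<delta> by (intro exI[of _ ?C]) (auto simp: add_nonneg_nonneg)
qed

end

section \<open>The estimate for the radial majorant\<close>

lemma lborel_distr_uminus_euclidean: "distr lborel borel uminus = (lborel :: 'a::euclidean_space measure)"
  using lborel_affine[of "-1" "0 :: 'a"] by (simp add: density_1)

lemma complex_lebesgue_ex_borel: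
  fixes f :: "real ^ 'n \<Rightarrow> complex"
  assumes "f \<in> borel_measurable lebesgue"
  shows "\<exists>g\<in>borel_measurable borel. AE x in lborel. f x = g x"
proof -
  have "(\<lambda>x. Re (f x)) \<in> borel_measurable lebesgue" "(\<lambda>x. Im (f x)) \<in> borel_measurable lebesgue"
    using assms by simp_all
  from this[THEN completion_ex_borel_measurable_real]
  obtain g h where gh: "g \<in> borel_measurable lborel" "AE x in lborel. Re (f x) = g x"
      "h \<in> borel_measurable lborel" "AE x in lborel. Im (f x) = h x"
    by blast
  have "AE x in lborel. f x = Complex (g x) (h x)"
    using gh(2,4) by eventually_elim (simp add: complex_eq_iff)
  moreover have "(\<lambda>x. Complex (g x) (h x)) \<in> borel_measurable borel"
    using gh(1,3) by (simp add: borel_measurable_complex_iff)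
  ultimately show ?thesis by (intro bexI)
qed

text \<open>Takes the place of Minkowski's inequality when the two parts of the convolution are put
  together.\<close>

lemma powr_add_le:
  fixes a b q :: real
  assumes "0 \<le> a" "0 \<le> b" "0 < q"
  shows "(a + b) powr q \<le> 2 powr q * (a powr q + b powr q)"
proof -
  have "(a + b) powr q \<le> (2 * max a b) powr q" using assms by (intro powr_mono2) auto
  also have "\<dots> = 2 powr q * max a b powr q" using assms by (simp add: powr_mult)
  also have "\<dots> \<le> 2 powr q * (a powr q + b powr q)" by (intro mult_left_mono) (auto simp: max_def)
  finally show ?thesis .
qed

context quasi_normed_group
begin

text \<open>Extended-valued, because finiteness almost everywhere is part of what has to be
  proved.\<close>

definition potential :: "real \<Rightarrow> (real ^ 'n \<Rightarrow> real) \<Rightarrow> real ^ 'n \<Rightarrow> ennreal" where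
  "potential p' f x = (\<integral>\<^sup>+y. ennreal (k0 p' (N (mul (- y) x)) * f y) \<partial>lborel)"

lemma borel_uminus_mul_slice [measurable]: "(\<lambda>y. mul (- y) x) \<in> borel_measurable borel"
  by (rule measurable_compose[OF _ borel_uminus_mul, where f = "\<lambda>y. (x, y)", simplified]) measurable

text \<open>Inversion is negation, so the map is a left translation by \<open>- x\<close> followed
  by a reflection.\<close>

lemma lborel_uminus_mul: "distr lborel borel (\<lambda>y. mul (- y) x) = lborel"
proof -
  have "mul (- y) x = - mul (- x) y" for y
    using inverse_distrib_swap[of "- x" y] by (simp add: ginv_eq_uminus)
  then have "distr lborel borel (\<lambda>y. mul (- y) x) = distr lborel borel (uminus \<circ> mul (- x))" by (simp add: o_def)
  also have "\<dots> = distr (distr lborel borel (mul (- x))) borel uminus" by (subst distr_distr) auto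
  also have "\<dots> = lborel" by (simp add: lborel_mul_left lborel_distr_uminus_euclidean)
  finally show ?thesis .
qed

text \<open>The far part contributes through \<open>tail_bound_integral\<close>, the near part
  through \<open>Schur_test\<close>. Both bounds are multiples of \<open>A powr (q / p)\<close> with
  factors free of \<open>f\<close>, which is why \<open>C\<close> can be chosen first.\<close>

lemma potential_estimate:
  assumes exps: "1 < p" "1 / p + 1 / p' = 1" "p < q" "q < (r - 1) * p'"
  shows "\<exists>C>0. \<forall>f A. f \<in> borel_measurable borel \<longrightarrow> (\<forall>y. 0 \<le> f y) \<longrightarrow> 0 \<le> A \<longrightarrow>
    (\<integral>\<^sup>+y. ennreal (f y powr p) \<partial>lborel) \<le> ennreal A \<longrightarrow>
    (AE x in lborel. potential p' f x < \<infinity>) \<and>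
    (\<integral>\<^sup>+x. ennreal (N x powr - Q * log_weight (N x) powr - r * enn2real (potential p' f x) powr q) \<partial>lborel) \<le> ennreal (C * A powr (q / p))"
proof -
  have p': "1 < p'"
  proof -
    have "1 / p' = 1 - 1 / p" using exps by simp
    moreover have "0 < 1 - 1 / p" "1 - 1 / p < 1" using exps by simp_all
    ultimately have "0 < 1 / p'" "1 / p' < 1" by simp_all
    then show ?thesis by (simp add: divide_less_eq split: if_splits)
  qed
  have q: "0 < q" using exps by simp
  obtain \<kappa> where \<kappa>: "1 \<le> \<kappa>" "\<And>x y. N (mul x y) \<le> \<kappa> * (N x + N y)" using quasi_triangle by blast
  define \<epsilon> where "\<epsilon> = 1 / (2 * \<kappa>)"
  have \<epsilon>: "0 < \<epsilon>" "\<epsilon> < 1" using \<kappa> by (auto simp: \<epsilon>_def)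
  define s where "s = 1 / (1 / q + 1 / p')"
  have s: "0 < s" "1 / s = 1 / q + 1 / p'" using q p' by (auto simp: s_def add_pos_pos)
  define B where "B = c\<^sub>Q / (Q * s / q) * (2 * \<kappa>) powr (Q * s / q)"
  have B: "0 \<le> B" using s q Q_pos c\<^sub>Q_nonneg unfolding B_def by (intro mult_nonneg_nonneg divide_nonneg_nonneg) auto
  note near = near_kernel_bounds[OF \<kappa> q _ s, folded \<epsilon>_def B_def]
  obtain D where D: "0 \<le> D" "(\<integral>\<^sup>+x. ennreal (N x powr - Q * log_weight (N x) powr - r * tail_bound \<epsilon> p' (N x) powr (q / p')) \<partial>lborel) \<le> ennreal D"
    using tail_bound_integral[OF p' \<epsilon> q exps(4)] by blast
  let ?tb = "\<lambda>x. tail_bound \<epsilon> p' (N x)" and ?w = "\<lambda>x. N x powr - Q * log_weight (N x) powr - r"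
  \<comment> \<open>The summand 1 keeps \<open>C\<close> positive even if \<open>D\<close> and
    \<open>B\<close> vanish.\<close>
  define C where "C = 2 powr q * (D + B powr (1 + q / p')) + 1"
  have "C > 0" using D unfolding C_def by (intro add_nonneg_pos mult_nonneg_nonneg add_nonneg_nonneg) auto
  moreover have "(AE x in lborel. potential p' f x < \<infinity>) \<and>
      (\<integral>\<^sup>+x. ennreal (?w x * enn2real (potential p' f x) powr q) \<partial>lborel) \<le> ennreal (C * A powr (q / p))"
    if [measurable]: "f \<in> borel_measurable borel" and f: "\<And>y. 0 \<le> f y" and A: "0 \<le> A"
      and fA: "(\<integral>\<^sup>+y. ennreal (f y powr p) \<partial>lborel) \<le> ennreal A" for f A
  proof -
    define V where "V x = (\<integral>\<^sup>+y. ennreal (near_kernel \<epsilon> q p' x y * f y) \<partial>lborel)" for x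
    have nk: "case_prod (near_kernel \<epsilon> q p') \<in> borel_measurable (lborel \<Otimes>\<^sub>M lborel)"
      using borel_near_kernel by (simp add: measurable_cong_sets[OF sets_pair_measure_cong[OF sets_lborel sets_lborel] refl])
    have V_fin: "AE x in lborel. V x < \<infinity>"
      and V_int: "(\<integral>\<^sup>+x. ennreal (enn2real (V x) powr q) \<partial>lborel) \<le> ennreal (B powr (1 + q / p') * A powr (q / p))"
      unfolding V_def
      by (rule Schur_test[where s = s and B = B and A = A, OF lborel.sigma_finite_measure_axioms lborel.sigma_finite_measure_axioms nk];
          use near p' s q exps f fA A B near_kernel_nonneg in simp)+
    \<comment> \<open>Since \<open>near_kernel\<close> contains \<open>N x powr (- (Q / q))\<close>,
      the opposite power appears in front of \<open>V x\<close>.\<close>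
    have pot: "potential p' f x \<le> ennreal (?tb x powr (1 / p') * A powr (1 / p)) + ennreal (N x powr (Q / q)) * V x"
      if "x \<noteq> 0" for x
    proof -
      have Nx: "N x > 0" using that by (rule N_pos)
      \<comment> \<open>The cut-off is expressed through \<open>mul (- x) y\<close>, a left
        translate of \<open>y\<close>, so that the integral becomes \<open>kernel_tail\<close> by
        left invariance.\<close>
      let ?far = "\<lambda>y. k0 p' (N (mul (- y) x)) * indicator {z. N z > \<epsilon> * N x} (mul (- x) y)"
      have "(\<integral>\<^sup>+y. ennreal (?far y powr p') \<partial>lborel) 
          = (\<integral>\<^sup>+y. ennreal (k0 p' (N (mul (- x) y)) powr p') * indicator {z. N z > \<epsilon> * N x} (mul (- x) y) \<partial>lborel)"
        using p' by (intro nn_integral_cong) (auto simp: N_mul_uminus_swap[of _ x] split: split_indicator)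
      also have "\<dots> = kernel_tail p' (\<epsilon> * N x)"
        unfolding kernel_tail_def
        by (rule nn_integral_mul_left[of "\<lambda>z. ennreal (k0 p' (N z) powr p') * indicator {z. N z > \<epsilon> * N x} z"]) measurable
      also have "\<dots> \<le> ennreal (?tb x)" by (rule kernel_tail_le[OF p' \<epsilon> Nx])
      finally have "(\<integral>\<^sup>+y. ennreal (?far y powr p') \<partial>lborel) \<le> ennreal (?tb x)" .
      then have "(\<integral>\<^sup>+y. ennreal (?far y * f y) \<partial>lborel) \<le> ennreal (?tb x powr (1 / p') * A powr (1 / p))"
        using fA f A p' exps tail_bound_nonneg[OF p' \<epsilon> N_nonneg[of x]] by (intro nn_integral_Holder) (auto simp: add.commute)
      moreover have "potential p' f x \<le> (\<integral>\<^sup>+y. ennreal (?far y * f y) + ennreal (N x powr (Q / q)) * ennreal (near_kernel \<epsilon> q p' x y * f y) \<partial>lborel)"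
        unfolding potential_def
      proof (rule nn_integral_mono)
        fix y
        show "ennreal (k0 p' (N (mul (- y) x)) * f y) \<le> ennreal (?far y * f y) + ennreal (N x powr (Q / q)) * ennreal (near_kernel \<epsilon> q p' x y * f y)"
        proof (cases "N (mul (- y) x) \<le> \<epsilon> * N x")
          case True
          have "N x powr (Q / q) * near_kernel \<epsilon> q p' x y = N (mul (- y) x) powr (- (Q / p'))"
            using True that by (simp add: near_kernel_def flip: mult.assoc powr_add)
          then have "k0 p' (N (mul (- y) x)) * f y \<le> N x powr (Q / q) * (near_kernel \<epsilon> q p' x y * f y)"
            using k0_le[OF p' N_nonneg, of "mul (- y) x"] f[of y] by (simp add: mult_right_mono flip: mult.assoc)
          then have "ennreal (k0 p' (N (mul (- y) x)) * f y) \<le> ennreal (N x powr (Q / q)) * ennreal (near_kernel \<epsilon> q p' x y * f y)"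
            by (simp add: ennreal_leI flip: ennreal_mult')
          then show ?thesis by (simp add: add_increasing)
        next
          case False
          then show ?thesis by (simp add: N_mul_uminus_swap[of y x])
        qed
      qed
      moreover have "\<dots> = (\<integral>\<^sup>+y. ennreal (?far y * f y) \<partial>lborel) + ennreal (N x powr (Q / q)) * V x"
        unfolding V_def using nk by (subst nn_integral_add) (auto simp: nn_integral_cmult)
      ultimately show ?thesis by (auto intro: order.trans add_right_mono)
    qed
    have ne0: "AE x in lborel. x \<noteq> (0 :: real ^ 'n)" by (rule AE_lborel_singleton)
    have fin: "AE x in lborel. potential p' f x < \<infinity>"
      using V_fin ne0
    proof eventually_elim
      case (elim x)
      have "ennreal (?tb x powr (1 / p') * A powr (1 / p)) + ennreal (N x powr (Q / q)) * V x < \<infinity>"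
        using elim by (simp add: ennreal_mult_less_top)
      then show ?case using pot[OF elim(2)] by (rule order.strict_trans1[rotated])
    qed
    have "(\<integral>\<^sup>+x. ennreal (?w x * enn2real (potential p' f x) powr q) \<partial>lborel) \<le> 
       (\<integral>\<^sup>+x. ennreal (2 powr q) * (ennreal (A powr (q / p)) * ennreal (?w x * ?tb x powr (q / p')) + ennreal (enn2real (V x) powr q)) \<partial>lborel)"
    proof (rule nn_integral_mono_AE, use V_fin ne0 in eventually_elim)
      case (elim x)
      have Nx: "N x > 0" using elim(2) by (rule N_pos)
      let ?u = "enn2real (potential p' f x)" and ?v = "enn2real (V x)"
      let ?a = "?tb x powr (1 / p') * A powr (1 / p)" and ?b = "N x powr (Q / q) * ?v"
      have "ennreal ?a + ennreal (N x powr (Q / q)) * V x = ennreal ?a + ennreal (N x powr (Q / q)) * ennreal ?v"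
        using elim by (simp add: ennreal_enn2real_if)
      also have "\<dots> = ennreal (?a + ?b)" by (simp add: enn2real_nonneg flip: ennreal_mult' ennreal_plus)
      finally have "potential p' f x \<le> ennreal (?a + ?b)" using pot[OF elim(2)] by simp
      then have "?u \<le> ?a + ?b" by (rule enn2real_leI[rotated]) simp
      then have "?u powr q \<le> (?a + ?b) powr q" using q by (intro powr_mono2) auto
      also have "\<dots> \<le> 2 powr q * (?a powr q + ?b powr q)" using q by (intro powr_add_le) auto
      also have "?a powr q = A powr (q / p) * ?tb x powr (q / p')" using q by (simp add: powr_mult powr_powr)
      also have "?b powr q = N x powr Q * ?v powr q" using q by (simp add: powr_mult powr_powr)
      finally have "?w x * ?u powr q \<le> ?w x * (2 powr q * (A powr (q / p) * ?tb x powr (q / p') + N x powr Q * ?v powr q))"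
        by (intro mult_left_mono) auto
      also have "\<dots> = 2 powr q * (A powr (q / p) * (?w x * ?tb x powr (q / p')) + (N x powr - Q * N x powr Q) * (log_weight (N x) powr - r * ?v powr q))"
        by (simp add: algebra_simps)
      \<comment> \<open>The power of the weight cancels the one taken out of the near kernel; what
        remains of the weight is at most 1 because \<open>r > 1\<close>.\<close>
      also have "N x powr - Q * N x powr Q = 1" using elim(2) by (simp flip: powr_add)
      also have "1 * (log_weight (N x) powr - r * ?v powr q) \<le> 1 * ?v powr q"
      proof -
        have "\<not> r - 1 \<le> 0"
        proof
          assume "r - 1 \<le> 0"
          then have "(r - 1) * p' \<le> 0" using p' by (intro mult_nonpos_nonneg) auto
          then show False using q exps by linarith
        qed
        then have "log_weight (N x) powr - r \<le> 1 powr - r"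
          using log_weight_ge_1[OF N_nonneg[of x]] by (intro powr_mono2') auto
        from mult_right_mono[OF this, of "?v powr q"] show ?thesis by simp
      qed
      finally have "?w x * ?u powr q \<le> 2 powr q * (A powr (q / p) * (?w x * ?tb x powr (q / p')) + ?v powr q)" by simp
      then have "ennreal (?w x * ?u powr q) \<le> ennreal (2 powr q * (A powr (q / p) * (?w x * ?tb x powr (q / p')) + ?v powr q))"
        by (rule ennreal_leI)
      also have "\<dots> = ennreal (2 powr q) * (ennreal (A powr (q / p)) * ennreal (?w x * ?tb x powr (q / p')) + ennreal (?v powr q))"
        by (simp add: ennreal_mult' ennreal_plus del: powr_mult)
      finally show ?case .
    qed
    also have "\<dots> = ennreal (2 powr q) * (ennreal (A powr (q / p)) * (\<integral>\<^sup>+x. ennreal (?w x * ?tb x powr (q / p')) \<partial>lborel) + (\<integral>\<^sup>+x. ennreal (enn2real (V x) powr q) \<partial>lborel))"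
    proof -
      have [measurable]: "V \<in> borel_measurable lborel" unfolding V_def using nk by measurable
      show ?thesis by (simp add: nn_integral_cmult nn_integral_add)
    qed
    also have "\<dots> \<le> ennreal (2 powr q) * (ennreal (A powr (q / p)) * ennreal D + ennreal (B powr (1 + q / p') * A powr (q / p)))"
      by (intro mult_left_mono add_mono D V_int) auto
    also have "\<dots> = ennreal (2 powr q * (A powr (q / p) * D + B powr (1 + q / p') * A powr (q / p)))"
      using D by (simp flip: ennreal_mult' ennreal_plus)
    also have "\<dots> \<le> ennreal (C * A powr (q / p))"
      by (intro ennreal_leI) (simp add: C_def algebra_simps)
    finally show ?thesis using fin by blast
  qed
  ultimately show ?thesis by blast
qed

end

section \<open>From the majorant to the convolution\<close>

context quasi_normed_group
begin

lemma kernel_bound_k0: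
  assumes T: "kernel_bounds N Q (Q / p) C T" and p: "1 / p + 1 / p' = 1" and "z \<noteq> 0"
  shows "norm (T z) \<le> C * k0 p' (N z)"
proof -
  have "Q * (1 / p + 1 / p') = Q" using p by simp
  then have "Q / p - Q = - (Q / p')" by (simp add: distrib_left)
  then show ?thesis using T \<open>z \<noteq> 0\<close> unfolding kernel_bounds_def k0_def by auto
qed

text \<open>The function \<open>f\<close> and the kernel are replaced by Borel functions that agree with them almost
  everywhere. By invariance of the null sets this does not change the convolution at any point.\<close>

lemma conv_borel:
  assumes T: "kernel_bounds N Q a C T" and f: "f \<in> borel_measurable lebesgue"
  shows "\<exists>h G. h \<in> borel_measurable borel \<and> (AE y in lborel. f y = h y) \<and> G \<in> borel_measurable (borel \<Otimes>\<^sub>M borel) \<and>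
    (\<forall>x. AE y in lborel. f y * T (mul (ginv y) x) = G (x, y)) \<and>
    (\<forall>x. conv_exists mul ginv f T x \<longleftrightarrow> integrable lborel (\<lambda>y. G (x, y))) \<and>
    (\<forall>x. conv mul ginv f T x = (\<integral>y. G (x, y) \<partial>lborel))"
proof -
  obtain h where h [measurable]: "h \<in> borel_measurable borel" and fh: "AE y in lborel. f y = h y"
    using complex_lebesgue_ex_borel[OF f] by blast
  \<comment> \<open>\<open>T\<close> is only known to be measurable away from 0, so its value there
    is replaced by 0.\<close>
  have "(\<lambda>x. if x \<in> - {0} then T x else 0) \<in> borel_measurable lebesgue"
    by (rule borel_measurable_if_I) (use T in \<open>auto simp: kernel_bounds_def\<close>)
  from complex_lebesgue_ex_borel[OF this]
  obtain S where S [measurable]: "S \<in> borel_measurable borel" and TS0: "AE z in lborel. (if z \<in> - {0} then T z else 0) = S z"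
    by blast
  have TS: "AE z in lborel. T z = S z"
    using TS0 AE_lborel_singleton[of "0 :: real ^ 'n"] by eventually_elim auto
  define G where "G = (\<lambda>(x, y). h y * S (mul (- y) x))"
  have G: "G \<in> borel_measurable (borel \<Otimes>\<^sub>M borel)" unfolding G_def case_prod_unfold by measurable
  have ae: "AE y in lborel. f y * T (mul (ginv y) x) = G (x, y)" for x
  proof -
    have "AE z in distr lborel borel (\<lambda>y. mul (- y) x). T z = S z"
      unfolding lborel_uminus_mul by (rule TS)
    then have "AE y in lborel. T (mul (- y) x) = S (mul (- y) x)"
      by (rule AE_distrD[rotated]) simp
    with fh show ?thesis by eventually_elim (simp add: G_def ginv_eq_uminus)
  qed
  have slice: "(\<lambda>y. G (x, y)) \<in> borel_measurable lborel" for x using G by simp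
  have slice': "(\<lambda>y. G (x, y)) \<in> borel_measurable lebesgue" for x
    by (rule measurable_completion[OF slice])
  have meas: "(\<lambda>y. f y * T (mul (ginv y) x)) \<in> borel_measurable lebesgue" for x
    by (rule borel_measurable_AE[OF slice']) (use AE_completion[OF ae[of x]] in \<open>auto elim!: eventually_mono\<close>)
  have "conv_exists mul ginv f T x \<longleftrightarrow> integrable lborel (\<lambda>y. G (x, y))" for x
    unfolding conv_exists_def integrable_completion[OF slice, symmetric]
    by (rule integrable_cong_AE[OF meas slice' AE_completion[OF ae]])
  moreover have "conv mul ginv f T x = (\<integral>y. G (x, y) \<partial>lborel)" for x
    unfolding conv_def integral_completion[OF slice, symmetric]
    by (rule integral_cong_AE[OF meas slice' AE_completion[OF ae]])
  ultimately show ?thesis using h fh G ae by (intro exI[of _ h] exI[of _ G]) simp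
qed

text \<open>Domination of the integrand outside the null set \<open>y = x\<close>. Finiteness of the
  potential gives absolute convergence, so the norm estimated is that of a genuine integral and not
  of the default value 0.\<close>

lemma conv_le_potential:
  assumes T: "kernel_bounds N Q (Q / p) C T" and p: "1 / p + 1 / p' = 1" and C: "C > 0"
    and h [measurable]: "h \<in> borel_measurable borel" and fh: "AE y in lborel. f y = h y"
    and G: "G \<in> borel_measurable (borel \<Otimes>\<^sub>M borel)"
    and ae: "AE y in lborel. f y * T (mul (ginv y) x) = G (x, y)"
    and fin: "potential p' (\<lambda>y. norm (h y)) x < \<infinity>"
  shows "integrable lborel (\<lambda>y. G (x, y))"
    and "norm (\<integral>y. G (x, y) \<partial>lborel) \<le> C * enn2real (potential p' (\<lambda>y. norm (h y)) x)"
proof -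
  have slice [measurable]: "(\<lambda>y. G (x, y)) \<in> borel_measurable lborel" using G by simp
  have "AE y in lborel. norm (G (x, y)) \<le> C * (k0 p' (N (mul (- y) x)) * norm (h y))"
    using ae fh AE_lborel_singleton[of x]
  proof eventually_elim
    case (elim y)
    have "mul (- y) x \<noteq> 0"
    proof
      assume "mul (- y) x = 0"
      then have "mul y (mul (- y) x) = mul y 0" by simp
      then show False using elim(3) by simp
    qed
    from kernel_bound_k0[OF T p this]
    have "norm (h y) * norm (T (mul (- y) x)) \<le> norm (h y) * (C * k0 p' (N (mul (- y) x)))"
      by (intro mult_left_mono) auto
    then show ?case using elim by (simp add: norm_mult ginv_eq_uminus mult_ac flip: elim(1))
  qed
  then have "(\<integral>\<^sup>+y. ennreal (norm (G (x, y))) \<partial>lborel) \<le> (\<integral>\<^sup>+y. ennreal C * ennreal (k0 p' (N (mul (- y) x)) * norm (h y)) \<partial>lborel)"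
    using C by (intro nn_integral_mono_AE) (auto elim!: eventually_mono simp: ennreal_leI simp flip: ennreal_mult')
  also have "\<dots> = ennreal C * potential p' (\<lambda>y. norm (h y)) x"
    unfolding potential_def by (rule nn_integral_cmult) measurable
  finally have le: "(\<integral>\<^sup>+y. ennreal (norm (G (x, y))) \<partial>lborel) \<le> ennreal C * potential p' (\<lambda>y. norm (h y)) x" .
  also have "\<dots> = ennreal (C * enn2real (potential p' (\<lambda>y. norm (h y)) x))"
    using C fin by (simp add: ennreal_mult' ennreal_enn2real_if)
  finally have le: "(\<integral>\<^sup>+y. ennreal (norm (G (x, y))) \<partial>lborel) \<le> ennreal (C * enn2real (potential p' (\<lambda>y. norm (h y)) x))" .
  then show int: "integrable lborel (\<lambda>y. G (x, y))"
    by (intro integrableI_bounded slice order.strict_trans1[OF le]) simp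
  have "ennreal (norm (\<integral>y. G (x, y) \<partial>lborel)) \<le> (\<integral>\<^sup>+y. ennreal (norm (G (x, y))) \<partial>lborel)"
    by (rule integral_norm_bound_ennreal[OF int])
  then have "ennreal (norm (\<integral>y. G (x, y) \<partial>lborel)) \<le> ennreal (C * enn2real (potential p' (\<lambda>y. norm (h y)) x))"
    using le by (rule order.trans)
  then show "norm (\<integral>y. G (x, y) \<partial>lborel) \<le> C * enn2real (potential p' (\<lambda>y. norm (h y)) x)"
    using C by (simp add: enn2real_nonneg)
qed

text \<open>Raising the quotient to the power \<open>q\<close> turns its denominator into the weight
  of \<open>potential_estimate\<close>. It remains to bound the convolution pointwise by
  \<open>C\<close> times the potential and to take the root of order \<open>q\<close>.\<close>

lemma weighted_convolution_bound:
  assumes exps: "1 < p" "1 / p + 1 / p' = 1" "p < q" "q < (r - 1) * p'" and C: "C > 0"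
  shows "\<exists>K>0. \<forall>T f. kernel_bounds N Q (Q / p) C T \<longrightarrow> in_Lp p f \<longrightarrow>
    (let F = (\<lambda>x. conv mul ginv f T x / complex_of_real (log_weight (N x) powr (r / q) * N x powr (Q / q)))
     in (AE x in lebesgue. conv_exists mul ginv f T x) \<and> in_Lp q F \<and> Lp_norm q F \<le> K * Lp_norm p f)"
proof -
  have q: "q > 0" using exps by simp
  obtain D where D: "D > 0" and est: "\<And>h A. h \<in> borel_measurable borel \<Longrightarrow> (\<And>y. 0 \<le> h y) \<Longrightarrow> 0 \<le> A \<Longrightarrow>
    (\<integral>\<^sup>+y. ennreal (h y powr p) \<partial>lborel) \<le> ennreal A \<Longrightarrow>
    (AE x in lborel. potential p' h x < \<infinity>) \<and>
    (\<integral>\<^sup>+x. ennreal (N x powr - Q * log_weight (N x) powr - r * enn2real (potential p' h x) powr q) \<partial>lborel) \<le> ennreal (D * A powr (q / p))"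
    using potential_estimate[OF exps] by blast
  \<comment> \<open>\<open>D\<close> comes from the majorant alone and \<open>C\<close> is the
    kernel constant, so \<open>K\<close> is fixed before \<open>T\<close> and
    \<open>f\<close>.\<close>
  define K where "K = C * D powr (1 / q)"
  have K: "K > 0" using C D by (simp add: K_def)
  have main: "(AE x in lebesgue. conv_exists mul ginv f T x) \<and> in_Lp q F \<and> Lp_norm q F \<le> K * Lp_norm p f"
    if T: "kernel_bounds N Q (Q / p) C T" and f: "in_Lp p f" 
      and F: "F = (\<lambda>x. conv mul ginv f T x / complex_of_real (log_weight (N x) powr (r / q) * N x powr (Q / q)))" for T f F
  proof -
    have fm: "f \<in> borel_measurable lebesgue" and fi: "integrable lebesgue (\<lambda>x. norm (f x) powr p)"
      using f by (auto simp: in_Lp_def)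
    obtain h G where h [measurable]: "h \<in> borel_measurable borel" and fh: "AE y in lborel. f y = h y" 
      and G: "G \<in> borel_measurable (borel \<Otimes>\<^sub>M borel)"
      and ae: "\<And>x. AE y in lborel. f y * T (mul (ginv y) x) = G (x, y)"
      and ex: "\<And>x. conv_exists mul ginv f T x \<longleftrightarrow> integrable lborel (\<lambda>y. G (x, y))"
      and cv: "\<And>x. conv mul ginv f T x = (\<integral>y. G (x, y) \<partial>lborel)"
      using conv_borel[OF T fm] by blast
    define A where "A = (\<integral>x. norm (f x) powr p \<partial>lebesgue)"
    have A: "0 \<le> A" by (simp add: A_def)
    have "(\<integral>\<^sup>+y. ennreal (norm (h y) powr p) \<partial>lborel) = (\<integral>\<^sup>+y. ennreal (norm (h y) powr p) \<partial>lebesgue)"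
      by (rule nn_integral_completion[symmetric])
    also have "\<dots> = (\<integral>\<^sup>+y. ennreal (norm (f y) powr p) \<partial>lebesgue)"
      by (rule nn_integral_cong_AE) (use AE_completion[OF fh] in \<open>auto elim!: eventually_mono\<close>)
    also have "\<dots> = ennreal A" unfolding A_def by (rule nn_integral_eq_integral[OF fi]) simp
    finally have hA: "(\<integral>\<^sup>+y. ennreal (norm (h y) powr p) \<partial>lborel) = ennreal A" .
    let ?u = "\<lambda>x. enn2real (potential p' (\<lambda>y. norm (h y)) x)"
    have fin: "AE x in lborel. potential p' (\<lambda>y. norm (h y)) x < \<infinity>"
      and u: "(\<integral>\<^sup>+x. ennreal (N x powr - Q * log_weight (N x) powr - r * ?u x powr q) \<partial>lborel) \<le> ennreal (D * A powr (q / p))"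
      using est[of "\<lambda>y. norm (h y)" A] A hA by auto
    note bound = conv_le_potential[OF T exps(2) C h fh G ae]
    have "AE x in lborel. conv_exists mul ginv f T x"
      using fin by eventually_elim (simp add: ex bound(1))
    then have exists: "AE x in lebesgue. conv_exists mul ginv f T x" by (rule AE_completion)
    have "(\<lambda>x. \<integral>y. G (x, y) \<partial>lborel) \<in> borel_measurable borel"
    proof -
      have "(\<lambda>(x, y). G (x, y)) \<in> borel_measurable (lborel \<Otimes>\<^sub>M lborel)"
        using G by (simp add: measurable_cong_sets[OF sets_pair_measure_cong[OF sets_lborel sets_lborel] refl])
      from lborel.borel_measurable_lebesgue_integral[OF this] show ?thesis by simp
    qed
    then have Fm: "F \<in> borel_measurable borel" unfolding F cv by measurable
    have "AE x in lborel. norm (F x) powr q \<le> C powr q * (N x powr - Q * log_weight (N x) powr - r * ?u x powr q)"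
      using fin AE_lborel_singleton[of "0 :: real ^ 'n"]
    proof eventually_elim
      case (elim x)
      have Nx: "N x > 0" using elim by (intro N_pos) auto
      have L: "log_weight (N x) > 0" using log_weight_ge_1[OF N_nonneg[of x]] by simp
      let ?d = "log_weight (N x) powr (r / q) * N x powr (Q / q)"
      have d: "?d > 0" using elim(2) L by (intro mult_pos_pos) simp_all
      have "norm (F x) = norm (\<integral>y. G (x, y) \<partial>lborel) / ?d" unfolding F cv using d by (simp add: norm_divide norm_mult)
      also have "\<dots> \<le> (C * ?u x) / ?d" using bound(2)[OF elim(1)] d by (intro divide_right_mono) auto
      finally have "norm (F x) powr q \<le> ((C * ?u x) / ?d) powr q" using q by (intro powr_mono2) auto
      also have "\<dots> = C powr q * ?u x powr q / (?d powr q)" using C d by (simp add: powr_divide powr_mult)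
      also have "?d powr q = log_weight (N x) powr r * N x powr Q" using q by (simp add: powr_mult powr_powr)
      also have "C powr q * ?u x powr q / (log_weight (N x) powr r * N x powr Q) = C powr q * (N x powr - Q * log_weight (N x) powr - r * ?u x powr q)"
        using Nx L by (simp add: powr_minus divide_inverse mult_ac)
      finally show ?case .
    qed
    then have "(\<integral>\<^sup>+x. ennreal (norm (F x) powr q) \<partial>lborel) \<le> (\<integral>\<^sup>+x. ennreal (C powr q) * ennreal (N x powr - Q * log_weight (N x) powr - r * ?u x powr q) \<partial>lborel)"
      by (intro nn_integral_mono_AE) (auto elim!: eventually_mono simp: ennreal_leI simp flip: ennreal_mult')
    also have "\<dots> = ennreal (C powr q) * (\<integral>\<^sup>+x. ennreal (N x powr - Q * log_weight (N x) powr - r * ?u x powr q) \<partial>lborel)"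
    proof (rule nn_integral_cmult)
      have "(\<lambda>x. potential p' (\<lambda>y. norm (h y)) x) \<in> borel_measurable lborel"
        unfolding potential_def by (rule lborel.borel_measurable_nn_integral) measurable
      then show "(\<lambda>x. ennreal (N x powr - Q * log_weight (N x) powr - r * ?u x powr q)) \<in> borel_measurable lborel" by measurable
    qed
    also have "\<dots> \<le> ennreal (C powr q) * ennreal (D * A powr (q / p))" by (intro mult_left_mono u) auto
    also have "\<dots> = ennreal (C powr q * (D * A powr (q / p)))" by (simp add: ennreal_mult')
    finally have le: "(\<integral>\<^sup>+x. ennreal (norm (F x) powr q) \<partial>lborel) \<le> ennreal (C powr q * (D * A powr (q / p)))" .
    have [measurable]: "(\<lambda>x. norm (F x) powr q) \<in> borel_measurable lborel" using Fm by measurable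
    have int: "integrable lborel (\<lambda>x. norm (F x) powr q)"
      by (rule integrableI_bounded) (use order.strict_trans1[OF le] in auto)
    then have "integrable lebesgue (\<lambda>x. norm (F x) powr q)" by (simp add: integrable_completion)
    moreover have "F \<in> borel_measurable lebesgue" using Fm by (intro measurable_completion) simp
    ultimately have FL: "in_Lp q F" by (simp add: in_Lp_def)
    have "ennreal (\<integral>x. norm (F x) powr q \<partial>lborel) \<le> ennreal (C powr q * (D * A powr (q / p)))"
      using le by (subst nn_integral_eq_integral[OF int, symmetric]) auto
    then have "(\<integral>x. norm (F x) powr q \<partial>lborel) \<le> C powr q * (D * A powr (q / p))"
      using D by (simp add: ennreal_le_iff)
    then have "(\<integral>x. norm (F x) powr q \<partial>lebesgue) \<le> C powr q * (D * A powr (q / p))"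
      by (simp add: integral_completion)
    then have "Lp_norm q F \<le> (C powr q * (D * A powr (q / p))) powr (1 / q)"
      unfolding Lp_norm_def using q by (intro powr_mono2) auto
    also have "\<dots> = K * A powr (1 / p)"
      using C D q by (simp add: powr_mult powr_powr K_def)
    also have "A powr (1 / p) = Lp_norm p f" by (simp add: Lp_norm_def A_def)
    finally show ?thesis using exists FL by blast
  qed
  show ?thesis using K main by (auto simp: Let_def)
qed

end

theorem theorem3p7:
  fixes mul :: "real ^ 'n \<Rightarrow> real ^ 'n \<Rightarrow> real ^ 'n"
    and ginv A :: "real ^ 'n \<Rightarrow> real ^ 'n"
    and N :: "real ^ 'n \<Rightarrow> real"
    and Q p p' q r a C\<^sub>2 :: real
  assumes "homogeneous_group mul ginv A"
    and "Q = hom_dim A"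
    and "homogeneous_quasi_norm ginv A N"
    and "1 < p" and "p < r"
    and "1 / p + 1 / p' = 1"
    and "p < q" and "q < (r - 1) * p'"
    and "a = Q / p"
    and "C\<^sub>2 > 0"
  shows "\<exists>C\<^sub>1>0. \<forall>T f. kernel_bounds N Q a C\<^sub>2 T \<longrightarrow> in_Lp p f \<longrightarrow>
    (let F = (\<lambda>x. conv mul ginv f T x /
                complex_of_real (ln (exp 1 + 1 / N x) powr (r / q) * N x powr (Q / q)))
     in (AE x in lebesgue. conv_exists mul ginv f T x) \<and>
        in_Lp q F \<and>
        Lp_norm q F \<le> C\<^sub>1 * Lp_norm p f)"
proof -
  interpret homogeneous_group mul ginv A by fact
  interpret quasi_normed_group mul ginv A N by unfold_locales fact
  show ?thesis
    using weighted_convolution_bound[OF assms(4,6,7,8,10)] assms(2,9) by (simp only: log_weight_def)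
qed

end
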